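(* Let $r,m$ be positive integers and let $\mathfrak{I}_{(r,m)}^{(TP)}$ be the set of trace-preserving completely positive maps on $\mathcal{M}_D(\mathbb{C})$ of Kraus rank $r$ that are irreducible of degree $m$. Then $\mathfrak{I}_{(r,m)}^{(TP)}$ decomposes into path-connected components, and two maps $\mathcal{T}^{(0)},\mathcal{T}^{(1)}\in\mathfrak{I}_{(r,m)}^{(TP)}$ lie in the same path-connected component if and only if they have the same multiplicity index. In this case they can be connected by a path $t\mapsto\mathcal{T}^{(t)}\in\mathfrak{I}_{(r,m)}^{(TP)}$, $t\in[0,1]$, whose matrix entries depend analytically on $t$.
   Context: A CP map on $\mathcal{M}_D(\mathbb{C})$ has the form $\mathcal{T}(X)=\sum_iA_iXA_i^\dagger$; its Kraus rank is the minimal number of such $A_i$ (equal to the rank of the Choi matrix $(\mathcal{T}\otimes\mathrm{id})(|\varphi\rangle\langle\varphi|)$, $\varphi=\sum_i|ii\rangle$). Its dual is $\mathcal{T}^*(X)=\sum_iA_i^\dagger XA_i$; $\mathcal{T}$ is trace-preserving iff $\mathcal{T}^*(\mathbb{1})=\mathbb{1}$. $\mathcal{T}$ is irreducible iff its spectral radius is a non-degenerate eigenvalue whose left and right eigenvectors are positive definite; it is irreducible of degree $m$ if in addition its peripheral spectrum (eigenvalues of modulus equal to the spectral radius) consists of $m$ eigenvalues. Known structure: if $\mathcal{T}$ is trace-preserving and irreducible of degree $m$, then $\mathcal{T}^*$ is unital and irreducible of degree $m$, its peripheral spectrum is $\{\beta^k\}_{k=1}^m$ with $\beta=e^{2\pi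 i/m}$, and there is a unitary $U$ with $\mathcal{T}^*(U)=\beta U$ having spectral decomposition $U=\sum_{k=1}^m\beta^kP_k$ with spectral projectors $P_k$. Setting $d_k=\mathrm{tr}\,P_k$ (the multiplicity of eigenvalue $\beta^k$ of $U$), the multiplicity index of $\mathcal{T}$ is the equivalence class of the tuple $(d_1,\dots,d_m)$ under cyclic permutations (this is well defined since the unitary eigenvectors of $\mathcal{T}^*$ for $\beta$ are exactly the $cU$, $|c|=1$, and multiplying by powers of $\beta$ cyclically permutes the tuple). *)

theory Defs
  imports "HOL-Analysis.Analysis"
begin

text \<open>Matrices in M_D(C) are represented as complex^'n^'n, with D = CARD('n).
  Linear maps on M_D(C) are functions on this type; the space of such maps carries the
  product (pointwise) topology, which on linear maps is the usual finite-dimensional topology.\<close>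

type_synonym 'n cmat = "complex^'n^'n"

definition adj :: "'n::finite cmat \<Rightarrow> 'n cmat" where
  "adj A = (\<chi> i j. cnj (A $ j $ i))"

definition smul :: "complex \<Rightarrow> 'n::finite cmat \<Rightarrow> 'n cmat" where
  "smul c A = (\<chi> i j. c * A $ i $ j)"

definition munit :: "'n::finite \<Rightarrow> 'n \<Rightarrow> 'n cmat" where
  "munit i j = (\<chi> a b. if a = i \<and> b = j then 1 else 0)"

definition unitary :: "'n::finite cmat \<Rightarrow> bool" where
  "unitary U \<longleftrightarrow> adj U ** U = mat 1 \<and> U ** adj U = mat 1"

definition pos_def :: "'n::finite cmat \<Rightarrow> bool" where
  "pos_def X \<longleftrightarrow> adj X = X \<and>
     (\<forall>v::complex^'n. v \<noteq> 0 \<longrightarrow> 0 < Re (\<Sum>i\<in>UNIV. cnj (v $ i) * (X *v v) $ i))"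

definition kraus_map :: "'n::finite cmat list \<Rightarrow> 'n cmat \<Rightarrow> 'n cmat" where
  "kraus_map As X = (\<Sum>A\<leftarrow>As. A ** X ** adj A)"

definition is_CP :: "('n::finite cmat \<Rightarrow> 'n cmat) \<Rightarrow> bool" where
  "is_CP T \<longleftrightarrow> (\<exists>As. T = kraus_map As)"

definition kraus_rank :: "('n::finite cmat \<Rightarrow> 'n cmat) \<Rightarrow> nat" where
  "kraus_rank T = (LEAST r. \<exists>As. length As = r \<and> T = kraus_map As)"

definition trace_preserving :: "('n::finite cmat \<Rightarrow> 'n cmat) \<Rightarrow> bool" where
  "trace_preserving T \<longleftrightarrow> (\<forall>X. trace (T X) = trace X)"

definition dual_map :: "('n::finite cmat \<Rightarrow> 'n cmat) \<Rightarrow> 'n cmat \<Rightarrow> 'n cmat" where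
  "dual_map T X = (THE S. \<forall>Y. trace (adj S ** Y) = trace (adj X ** T Y))"

definition spectrum_map :: "('n::finite cmat \<Rightarrow> 'n cmat) \<Rightarrow> complex set" where
  "spectrum_map T = {mu. \<exists>X. X \<noteq> 0 \<and> T X = smul mu X}"

definition spectral_radius_map :: "('n::finite cmat \<Rightarrow> 'n cmat) \<Rightarrow> real" where
  "spectral_radius_map T = Max (cmod ` spectrum_map T)"

definition peripheral_spectrum :: "('n::finite cmat \<Rightarrow> 'n cmat) \<Rightarrow> complex set" where
  "peripheral_spectrum T = {mu \<in> spectrum_map T. cmod mu = spectral_radius_map T}"

definition nondegenerate_eigenvalue :: "('n::finite cmat \<Rightarrow> 'n cmat) \<Rightarrow> complex \<Rightarrow> bool" where
  "nondegenerate_eigenvalue T mu \<longleftrightarrow>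
     (\<exists>X0. X0 \<noteq> 0 \<and>
        {X. \<exists>k. ((\<lambda>Y. T Y - smul mu Y) ^^ k) X = 0} = {smul c X0 | c. True})"

definition irreducible_map :: "('n::finite cmat \<Rightarrow> 'n cmat) \<Rightarrow> bool" where
  "irreducible_map T \<longleftrightarrow>
     (let \<rho> = complex_of_real (spectral_radius_map T) in
        \<rho> \<in> spectrum_map T \<and> nondegenerate_eigenvalue T \<rho> \<and>
        (\<exists>X. pos_def X \<and> T X = smul \<rho> X) \<and>
        (\<exists>Y. pos_def Y \<and> dual_map T Y = smul (cnj \<rho>) Y))"

definition irreducible_deg :: "nat \<Rightarrow> ('n::finite cmat \<Rightarrow> 'n cmat) \<Rightarrow> bool" where
  "irreducible_deg m T \<longleftrightarrow> irreducible_map T \<and> card (peripheral_spectrum T) = m"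

definition I_TP :: "nat \<Rightarrow> nat \<Rightarrow> ('n::finite cmat \<Rightarrow> 'n cmat) set" where
  "I_TP r m = {T. is_CP T \<and> trace_preserving T \<and> kraus_rank T = r \<and> irreducible_deg m T}"

definition beta :: "nat \<Rightarrow> complex" where
  "beta m = exp (2 * of_real pi * \<i> / of_nat m)"

definition spectral_decomp :: "nat \<Rightarrow> 'n::finite cmat \<Rightarrow> (nat \<Rightarrow> 'n cmat) \<Rightarrow> bool" where
  "spectral_decomp m U P \<longleftrightarrow>
     (\<forall>k\<in>{1..m}. adj (P k) = P k \<and> P k ** P k = P k) \<and>
     (\<forall>j\<in>{1..m}. \<forall>k\<in>{1..m}. j \<noteq> k \<longrightarrow> P j ** P k = 0) \<and>
     (\<Sum>k=1..m. P k) = mat 1 \<and>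
     U = (\<Sum>k=1..m. smul (beta m ^ k) (P k))"

text \<open>Multiplicity index: the cyclic equivalence class of (d_1,...,d_m), d_k = tr P_k,
  for a unitary U with T^*(U) = beta U; collected over all such U and all cyclic shifts.\<close>
definition mult_index :: "nat \<Rightarrow> ('n::finite cmat \<Rightarrow> 'n cmat) \<Rightarrow> complex list set" where
  "mult_index m T = {rotate j (map (\<lambda>k. trace (P k)) [1..<m+1]) | j U P.
      unitary U \<and> dual_map T U = smul (beta m) U \<and> spectral_decomp m U P}"

definition real_analytic_on :: "real set \<Rightarrow> (real \<Rightarrow> complex) \<Rightarrow> bool" where
  "real_analytic_on S f \<longleftrightarrow>
     (\<forall>t0\<in>S. \<exists>r>0. \<exists>c::nat \<Rightarrow> complex. \<forall>t\<in>S. \<bar>t - t0\<bar> < r \<longrightarrow>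
        (\<lambda>n. c n * of_real (t - t0) ^ n) sums f t)"

end

(* A trace-preserving Kraus tuple A_1, ..., A_r is irreducible of degree m exactly when there is
   a unitary U with U A_i = beta A_i U and, for some N, the words in the A_i of lengths N, ...,
   N + m - 1 span all matrices; Kraus rank r means that the A_i are linearly independent.
   For the spanning property, the powers of the dual map, averaged over m consecutive exponents,
   converge along a subsequence to X |-> m tr(X0 X) 1, whose Choi form is positive definite.

   Both conditions are nonvanishing of determinants. After rotating U and conjugating by a
   unitary, two maps with the same multiplicity index share the same U, and along the complex
   line through their Kraus tuples the conditions fail at finitely many points only. A path
   avoiding these points is made trace preserving by the similarity with the square root of
   the dual Perron eigenvector. An analytic path results from polynomial approximation, followed
   by right multiplication with the inverse square root of sum A_i^* A_i, because the conditions
   are open. Conversely, unitary eigenvectors of the dual map with U^m = 1 form compact sets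
   and the multiplicities are integers, so the index is locally constant. *)

theory Submission
  imports Defs "HOL-Complex_Analysis.Cauchy_Integral_Formula"
    "HOL-Computational_Algebra.Fundamental_Theorem_Algebra"
begin

text \<open>A window of \<open>m\<close> consecutive lengths appears because the relation with
  \<open>U\<close> grades the matrices: a word of length \<open>n\<close> commutes with
  \<open>U\<close> up to \<open>beta^n\<close>, so one length reaches only one of \<open>m\<close>
  graded parts. The line is complex because finitely many points cut a real segment but not the
  plane; for this the determinants must be polynomial in the tuple, hence they contain words in the
  \<open>A_i\<close> and no adjoints.

  Trace preservation does involve adjoints, hence the two normalisations. A similarity transforms
  all words alike and so keeps the spanning property even far from the identity; right
  multiplication does not, and is used only close to the identity. Inverse square roots are limits
  of Newton iterates, which are polynomials in their argument, so one uniform estimate yields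
  commutation, continuity and holomorphy.

  The unitary that matches the two eigenvectors has to be undone along the path as well: it is
  joined to 1 inside the unitary group, and this path is made analytic by the same approximation,
  read as a tuple with a single Kraus operator.\<close>

lemma smul_nth [simp]: "smul c A $ i $ j = c * A $ i $ j"
  by (simp add: smul_def)

lemma adj_nth [simp]: "adj A $ i $ j = cnj (A $ j $ i)"
  by (simp add: adj_def)

lemma munit_nth: "munit i j $ a $ b = (if a = i \<and> b = j then 1 else 0)"
  by (simp add: munit_def)

lemma matrix_mult_nth: "(A ** B) $ i $ j = (\<Sum>k\<in>UNIV. A $ i $ k * B $ k $ j)"
  by (simp add: matrix_matrix_mult_def)

lemma mat_nth: "mat c $ i $ j = (if i = j then c else 0)"
  by (simp add: mat_def)

lemma cmat_eq_iff: "A = B \<longleftrightarrow> (\<forall>i j. A $ i $ j = B $ i $ j)"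
  by (simp add: vec_eq_iff)

lemma matrix_mult_minus_left: "(- A) ** B = - (A ** (B::'n::finite cmat))"
  by (simp add: cmat_eq_iff matrix_mult_nth sum_negf)

lemma matrix_mult_minus_right: "A ** (- B) = - (A ** (B::'n::finite cmat))"
  by (simp add: cmat_eq_iff matrix_mult_nth sum_negf)

lemma matrix_mult_add_left: "(A + B) ** C = A ** C + B ** (C::'n::finite cmat)"
  by (simp add: cmat_eq_iff matrix_mult_nth sum.distrib algebra_simps)

lemma matrix_mult_diff_left: "(A - B) ** C = A ** C - B ** (C::'n::finite cmat)"
  by (simp add: cmat_eq_iff matrix_mult_nth sum_subtractf algebra_simps)

lemma matrix_mult_diff_right: "C ** (A - B) = C ** A - C ** (B::'n::finite cmat)"
  by (simp add: cmat_eq_iff matrix_mult_nth sum_subtractf algebra_simps)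

lemma matrix_mult_sum_left: "sum f S ** C = (\<Sum>i\<in>S. f i ** (C::'n::finite cmat))"
  by (induction S rule: infinite_finite_induct) (simp_all add: matrix_mult_add_left)

lemma matrix_mult_sum_right: "C ** sum f S = (\<Sum>i\<in>S. C ** (f i::'n::finite cmat))"
  by (induction S rule: infinite_finite_induct) (simp_all add: matrix_add_ldistrib)

lemma smul_mult_left: "smul c A ** B = smul c (A ** B)"
  by (simp add: cmat_eq_iff matrix_mult_nth sum_distrib_left algebra_simps)

lemma smul_mult_right: "A ** smul c B = smul c (A ** B)"
  by (simp add: cmat_eq_iff matrix_mult_nth sum_distrib_left algebra_simps)

lemmas mat_distribs = matrix_mult_add_left matrix_add_ldistrib matrix_mult_diff_left
  matrix_mult_diff_right matrix_mult_sum_left matrix_mult_sum_right smul_mult_left smul_mult_right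
  matrix_mult_minus_left matrix_mult_minus_right

lemmas mat_assoc = matrix_mul_assoc[symmetric]

lemma smul_smul [simp]: "smul a (smul b A) = smul (a * b) A"
  by (simp add: cmat_eq_iff)

lemma smul_one [simp]: "smul 1 A = A" by (simp add: cmat_eq_iff)
lemma smul_zero_left [simp]: "smul 0 A = 0" by (simp add: cmat_eq_iff)
lemma smul_zero_right [simp]: "smul c 0 = 0" by (simp add: cmat_eq_iff)
lemma smul_add_right: "smul c (A + B) = smul c A + smul c B" by (simp add: cmat_eq_iff algebra_simps)
lemma smul_diff_right: "smul c (A - B) = smul c A - smul c B" by (simp add: cmat_eq_iff algebra_simps)
lemma smul_add_left: "smul (c + d) A = smul c A + smul d A" by (simp add: cmat_eq_iff algebra_simps)
lemma smul_diff_left: "smul (c - d) A = smul c A - smul d A" by (simp add: cmat_eq_iff algebra_simps)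
lemma smul_minus_left: "smul (- c) A = - smul c A" by (simp add: cmat_eq_iff)
lemma smul_sum_right: "smul c (sum f S) = (\<Sum>i\<in>S. smul c (f i))"
  by (induction S rule: infinite_finite_induct) (simp_all add: smul_add_right)
lemma smul_sum_left: "smul (sum f S) A = (\<Sum>i\<in>S. smul (f i) A)"
  by (induction S rule: infinite_finite_induct) (simp_all add: smul_add_left)
lemma smul_of_real: "smul (of_real c) A = c *\<^sub>R A"
  by (simp add: cmat_eq_iff) (simp add: scaleR_conv_of_real)
lemma smul_eq_0_iff: "smul c A = 0 \<longleftrightarrow> c = 0 \<or> A = 0"
  by (auto simp: cmat_eq_iff)
lemma adj_adj [simp]: "adj (adj A) = A" by (simp add: cmat_eq_iff)
lemma adj_zero [simp]: "adj 0 = 0" by (simp add: cmat_eq_iff)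
lemma adj_one [simp]: "adj (mat 1) = mat 1" by (simp add: cmat_eq_iff mat_nth)
lemma adj_add: "adj (A + B) = adj A + adj B" by (simp add: cmat_eq_iff)
lemma adj_diff: "adj (A - B) = adj A - adj B" by (simp add: cmat_eq_iff)
lemma adj_smul: "adj (smul c A) = smul (cnj c) (adj A)" by (simp add: cmat_eq_iff)
lemma adj_mult: "adj (A ** B) = adj B ** adj A"
  by (simp add: cmat_eq_iff matrix_mult_nth mult.commute)
lemma adj_sum: "adj (sum f S) = (\<Sum>i\<in>S. adj (f i))"
  by (induction S rule: infinite_finite_induct) (simp_all add: adj_add)
lemma adj_scaleR: "adj (c *\<^sub>R A) = c *\<^sub>R adj A" by (simp add: cmat_eq_iff)
lemma adj_eq_0_iff [simp]: "adj A = 0 \<longleftrightarrow> A = 0"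
  by (metis adj_adj adj_zero)

lemmas adj_distribs = adj_add adj_diff adj_smul adj_mult adj_sum adj_scaleR

lemma trace_smul: "trace (smul c A) = c * trace A" by (simp add: trace_def sum_distrib_left)
lemma trace_zero [simp]: "trace (0::'n::finite cmat) = 0" by (simp add: trace_def)
lemma trace_sum: "trace (sum f S) = (\<Sum>i\<in>S. trace (f i :: 'n::finite cmat))"
  by (induction S rule: infinite_finite_induct) (simp_all add: trace_add)
lemma trace_adj: "trace (adj A) = cnj (trace A)" by (simp add: trace_def)
lemma trace_scaleR: "trace (c *\<^sub>R A) = c *\<^sub>R trace (A::'n::finite cmat)"
  by (simp add: trace_def scaleR_sum_right)
lemma trace_rotate: "trace (A ** (B ** C)) = trace (B ** (C ** (A::'n::finite cmat)))"
  by (metis trace_mul_sym matrix_mul_assoc)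

lemma trace_mult_eq: "trace (A ** B) = (\<Sum>i\<in>UNIV. \<Sum>j\<in>UNIV. A $ i $ j * B $ j $ i)"
  by (simp add: trace_def matrix_mult_nth)

lemma trace_mult_munit: "trace (A ** munit i j) = A $ j $ i"
proof -
  have "trace (A ** munit i j) = (\<Sum>a\<in>UNIV. \<Sum>b\<in>UNIV. if b = i then (if a = j then A $ a $ b else 0) else 0)"
    unfolding trace_mult_eq munit_nth by (intro sum.cong refl) auto
  also have "\<dots> = A $ j $ i" by simp
  finally show ?thesis .
qed

lemma cnj_mult_self: "cnj z * z = of_real ((cmod z)\<^sup>2)"
  by (metis complex_norm_square mult.commute)

lemma trace_adj_mult_self: "trace (adj A ** A) = of_real (\<Sum>i\<in>UNIV. \<Sum>j\<in>UNIV. (cmod (A $ j $ i))\<^sup>2)"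
  unfolding trace_mult_eq of_real_sum by (simp add: cnj_mult_self del: of_real_power)

lemma trace_adj_mult_self_eq_0: "trace (adj A ** A) = 0 \<longleftrightarrow> A = 0"
proof
  assume "trace (adj A ** A) = 0"
  then have "(\<Sum>i\<in>UNIV. \<Sum>j\<in>UNIV. (cmod (A $ j $ i))\<^sup>2) = 0"
    unfolding trace_adj_mult_self by (simp only: of_real_eq_0_iff)
  then show "A = 0"
    by (subst (asm) sum_nonneg_eq_0_iff; (auto intro!: sum_nonneg)?)
       (auto simp: sum_nonneg_eq_0_iff cmat_eq_iff)
qed simp

text \<open>Nondegeneracy of the trace form. Identities for dual maps and for annihilators are
  proved by testing them under the trace.\<close>

lemma trace_mult_eq_0_imp: "(\<And>B. trace (A ** B) = 0) \<Longrightarrow> A = (0::'n::finite cmat)"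
  by (metis cmat_eq_iff trace_mult_munit zero_index)

section \<open>The Hermitian inner product on column vectors\<close>

definition cip :: "complex^'n::finite \<Rightarrow> complex^'n \<Rightarrow> complex" where
  "cip u v = (\<Sum>i\<in>UNIV. cnj (u $ i) * v $ i)"

lemma cip_add_left: "cip (u + v) w = cip u w + cip v w" by (simp add: cip_def sum.distrib algebra_simps)
lemma cip_add_right: "cip u (v + w) = cip u v + cip u w" by (simp add: cip_def sum.distrib algebra_simps)
lemma cip_diff_left: "cip (u - v) w = cip u w - cip v w" by (simp add: cip_def sum_subtractf algebra_simps)
lemma cip_diff_right: "cip u (v - w) = cip u v - cip u w" by (simp add: cip_def sum_subtractf algebra_simps)
lemma cip_smult_left: "cip (c *s u) w = cnj c * cip u w" by (simp add: cip_def sum_distrib_left algebra_simps)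
lemma cip_smult_right: "cip u (c *s w) = c * cip u w" by (simp add: cip_def sum_distrib_left algebra_simps)
lemma cip_zero [simp]: "cip 0 v = 0" "cip u 0 = 0" by (simp_all add: cip_def)
lemma cip_sum_right: "cip u (sum f S) = (\<Sum>i\<in>S. cip u (f i))"
  by (induction S rule: infinite_finite_induct) (simp_all add: cip_add_right)
lemma cip_commute: "cip u v = cnj (cip v u)" by (simp add: cip_def mult.commute)
lemma cip_adj: "cip u (A *v v) = cip (adj A *v u) v"
  unfolding cip_def matrix_vector_mult_def
  by (simp add: sum_distrib_left sum_distrib_right, subst sum.swap) (simp add: algebra_simps)
lemma cip_self: "cip v v = of_real ((norm v)\<^sup>2)"
  unfolding cip_def cnj_mult_self
  by (simp add: norm_vec_def L2_set_def sum_nonneg)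
lemma cip_self_eq_0: "cip v v = 0 \<longleftrightarrow> v = 0"
  by (simp add: cip_self)
lemma Re_cip_eq_inner: "Re (cip u v) = u \<bullet> v"
  by (simp add: cip_def inner_vec_def inner_complex_def)

lemma Re_cip_le: "\<bar>Re (cip u v)\<bar> \<le> norm u * norm v"
  by (simp add: Re_cip_eq_inner Cauchy_Schwarz_ineq2)

lemma norm_vsmult: "norm (c *s (v::complex^'n::finite)) = cmod c * norm v"
proof -
  have "(norm (c *s v))\<^sup>2 = (cmod c * norm v)\<^sup>2"
  proof -
    have "complex_of_real ((norm (c *s v))\<^sup>2) = of_real ((cmod c * norm v)\<^sup>2)"
      unfolding cip_self[symmetric] power_mult_distrib of_real_mult cip_smult_left cip_smult_right cnj_mult_self[symmetric]
      by (simp add: algebra_simps)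
    then show ?thesis by (simp only: of_real_eq_iff)
  qed
  then show ?thesis by (simp add: power2_eq_iff_nonneg)
qed

lemma smul_mv: "smul c A *v v = c *s (A *v v)"
  by (simp add: vec_eq_iff matrix_vector_mult_def sum_distrib_left algebra_simps)
lemma mv_smult: "A *v (c *s v) = c *s (A *v (v::complex^'n::finite))"
  by (simp add: vec_eq_iff matrix_vector_mult_def sum_distrib_left algebra_simps)
lemma sum_mv: "sum f S *v v = (\<Sum>i\<in>S. f i *v (v::complex^'n::finite))"
  by (induction S rule: infinite_finite_induct) (simp_all add: matrix_vector_mult_add_rdistrib)
lemma scaleR_mv: "(c *\<^sub>R A) *v v = c *\<^sub>R (A *v (v::complex^'n::finite))"
  by (simp add: vec_eq_iff matrix_vector_mult_def scaleR_sum_right)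

lemma cmat_eqI: "(\<And>v. A *v v = B *v v) \<Longrightarrow> A = (B::'n::finite cmat)"
  by (simp add: matrix_eq)

section \<open>Rank-one, semidefinite and definite matrices\<close>

definition outer :: "complex^'n::finite \<Rightarrow> complex^'n \<Rightarrow> 'n cmat" where
  "outer u v = (\<chi> i j. u $ i * cnj (v $ j))"

lemma trace_mult_outer: "trace (A ** outer u v) = cip v (A *v u)"
  unfolding trace_mult_eq cip_def matrix_vector_mult_def outer_def
  by (simp add: sum_distrib_left algebra_simps)

lemma outer_eq_0_iff: "outer u v = 0 \<longleftrightarrow> u = 0 \<or> v = 0"
  by (auto simp: outer_def vec_eq_iff)

text \<open>Hermiticity is a separate clause because nonnegativity of the real part of the form does
  not force it.\<close>

definition psd :: "'n::finite cmat \<Rightarrow> bool" where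
  "psd X \<longleftrightarrow> adj X = X \<and> (\<forall>v. 0 \<le> Re (cip v (X *v v)))"

lemma pos_def_cip: "pos_def X \<longleftrightarrow> adj X = X \<and> (\<forall>v. v \<noteq> 0 \<longrightarrow> 0 < Re (cip v (X *v v)))"
  by (simp add: pos_def_def cip_def)

lemma pos_def_imp_psd: "pos_def X \<Longrightarrow> psd X"
  unfolding pos_def_cip psd_def by (metis cip_zero(1) less_eq_real_def zero_complex.sel(1))

lemma psdD: "psd X \<Longrightarrow> adj X = X" "psd X \<Longrightarrow> 0 \<le> Re (cip v (X *v v))"
  by (auto simp: psd_def)

lemma herm_cip_real: "adj X = X \<Longrightarrow> cip v (X *v v) = of_real (Re (cip v (X *v v)))"
  by (metis cip_adj cip_commute Reals_cnj_iff of_real_Re)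

lemma herm_cip_commute: "adj X = X \<Longrightarrow> cip u (X *v v) = cnj (cip v (X *v u))"
  by (metis cip_adj cip_commute)

lemma psd_add: "psd X \<Longrightarrow> psd Y \<Longrightarrow> psd (X + Y)"
  by (simp add: psd_def adj_add matrix_vector_mult_add_rdistrib cip_add_right)

lemma psd_zero [simp]: "psd 0" by (simp add: psd_def)

lemma psd_sum: "(\<And>i. i \<in> S \<Longrightarrow> psd (f i)) \<Longrightarrow> psd (sum f S)"
  by (induction S rule: infinite_finite_induct) (simp_all add: psd_add)

lemma cip_conj_form: "cip v ((A ** X ** adj A) *v v) = cip (adj A *v v) (X *v (adj A *v v))"
  by (simp add: cip_adj matrix_vector_mul_assoc[symmetric])

lemma psd_conj: "psd X \<Longrightarrow> psd (A ** X ** adj A)"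
  unfolding psd_def cip_conj_form by (simp add: adj_mult mat_assoc)

lemma cip_scaleR_right: "cip u (c *\<^sub>R v) = of_real c * cip u v"
  unfolding cip_def sum_distrib_left by (intro sum.cong refl) (simp, simp add: scaleR_conv_of_real)

lemma psd_scaleR: "0 \<le> c \<Longrightarrow> psd X \<Longrightarrow> psd (c *\<^sub>R X)"
  by (simp add: psd_def adj_scaleR scaleR_mv cip_scaleR_right)

lemma psd_one [simp]: "psd (mat 1)"
  by (simp add: psd_def cip_self del: of_real_power)

lemma pos_def_one: "pos_def (mat 1)"
  by (simp add: pos_def_cip cip_self del: of_real_power)

text \<open>Quadratic minimisation along \<open>v + t w\<close> with \<open>w = X v\<close>.\<close>
lemma psd_kernel:
  assumes X: "psd X" and z: "Re (cip v (X *v v)) = 0"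
  shows "X *v v = 0"
proof -
  define w where "w = X *v v"
  define a where "a = (norm w)\<^sup>2"
  define b where "b = Re (cip w (X *v w))"
  have vv: "cip v (X *v v) = 0" using z herm_cip_real psdD(1)[OF X] by (metis of_real_0)
  have wv: "cip w (X *v v) = of_real a" by (simp add: a_def w_def cip_self)
  have vw: "cip v (X *v w) = of_real a"
    using herm_cip_commute[OF psdD(1)[OF X], of v w] wv by simp
  have b0: "b \<ge> 0" unfolding b_def by (rule psdD(2)[OF X])
  have key: "0 \<le> - 2 * s * a + s\<^sup>2 * b" for s :: real
  proof -
    have "0 \<le> Re (cip (v - complex_of_real s *s w) (X *v (v - complex_of_real s *s w)))"
      by (rule psdD(2)[OF X])
    also have "\<dots> = - 2 * s * a + s\<^sup>2 * b"
      unfolding matrix_vector_mult_diff_distrib mv_smult cip_diff_left cip_diff_right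
        cip_smult_left cip_smult_right vv wv vw
      by (simp add: b_def power2_eq_square algebra_simps)
    finally show ?thesis .
  qed
  have "a \<le> 0"
  proof (cases "b = 0")
    case True
    then show ?thesis using key[of 1] by simp
  next
    case False
    then have "b > 0" using b0 by simp
    \<comment> \<open>The quadratic in \<open>s\<close> has its minimum at
      \<open>a / b\<close>.\<close>
    then have "0 \<le> - 2 * (a / b) * a + (a / b)\<^sup>2 * b" using key by blast
    also have "\<dots> = - (a\<^sup>2 / b)" using \<open>b > 0\<close> by (simp add: power2_eq_square field_simps)
    finally have "a\<^sup>2 / b \<le> 0" by simp
    then show ?thesis using \<open>b > 0\<close> by (simp add: divide_le_0_iff)
  qed
  then have "w = 0" by (simp add: a_def)
  then show ?thesis by (simp add: w_def)
qed

lemma cip_axis: "cip (axis i 1) (X *v axis j 1) = X $ i $ j"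
proof -
  have "cip (axis i 1) v = v $ i" for v :: "complex^'a"
  proof -
    have "cip (axis i 1) v = (\<Sum>k\<in>UNIV. if k = i then v $ k else 0)"
      unfolding cip_def by (intro sum.cong refl) (simp add: axis_def)
    then show ?thesis by simp
  qed
  moreover have "(X *v axis j 1) $ i = (\<Sum>k\<in>UNIV. if k = j then X $ i $ k else 0)"
    unfolding matrix_vector_mult_def vec_lambda_beta by (intro sum.cong refl) (simp add: axis_def)
  ultimately show ?thesis by simp
qed

lemma trace_psd:
  assumes "psd X" shows "trace X = of_real (Re (trace X))" "0 \<le> Re (trace X)"
proof -
  have diag: "X $ i $ i = cip (axis i 1) (X *v axis i 1)" for i by (simp add: cip_axis)
  have "X $ i $ i = of_real (Re (X $ i $ i))" "0 \<le> Re (X $ i $ i)" for i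
    using herm_cip_real[OF psdD(1)[OF assms]] psdD(2)[OF assms] unfolding diag by auto
  then show "trace X = of_real (Re (trace X))" "0 \<le> Re (trace X)"
    unfolding trace_def by (metis (no_types, lifting) Re_sum of_real_sum sum.cong) (simp add: \<open>\<And>i. 0 \<le> Re (X $ i $ i)\<close> sum_nonneg)
qed

lemma psd_diag_nth:
  assumes "psd X" shows "X $ i $ i = of_real (Re (X $ i $ i))" "0 \<le> Re (X $ i $ i)"
proof -
  have diag: "X $ i $ i = cip (axis i 1) (X *v axis i 1)" by (simp add: cip_axis)
  show "X $ i $ i = of_real (Re (X $ i $ i))" "0 \<le> Re (X $ i $ i)"
    using herm_cip_real[OF psdD(1)[OF assms]] psdD(2)[OF assms] unfolding diag by auto
qed

lemma psd_trace_0: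
  assumes "psd X" "trace X = 0" shows "X = 0"
proof -
  have "(\<Sum>i\<in>UNIV. Re (X $ i $ i)) = 0"
    using assms(2) by (metis trace_def Re_sum zero_complex.sel(1))
  then have "Re (X $ i $ i) = 0" for i
    using psd_diag_nth(2)[OF assms(1)] by (subst (asm) sum_nonneg_eq_0_iff) auto
  then have "X *v axis i 1 = 0" for i
    by (intro psd_kernel[OF assms(1)]) (simp add: cip_axis)
  then have "X $ i $ j = 0" for i j
    using cip_axis[of i X j] by simp
  then show ?thesis by (simp add: cmat_eq_iff)
qed

text \<open>An entry is controlled by the two diagonal entries of its row and column, hence by the
  trace. This bounds the set of density matrices.\<close>

lemma psd_entry_bound:
  assumes "psd X" shows "cmod (X $ i $ j) \<le> Re (trace X)"
proof (cases "i = j")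
  case True
  have "cmod (X $ i $ i) = Re (X $ i $ i)"
    by (metis psd_diag_nth[OF assms] norm_of_real abs_of_nonneg)
  also have "\<dots> \<le> (\<Sum>i\<in>UNIV. Re (X $ i $ i))"
    by (rule member_le_sum) (use psd_diag_nth(2)[OF assms] in auto)
  finally show ?thesis using True by (simp add: trace_def Re_sum)
next
  case False
  define z where "z = X $ i $ j"
  \<comment> \<open>The phase \<open>u\<close> turns the two cross terms of the form into
    \<open>- 2 * cmod z\<close>; the value 1 at \<open>z = 0\<close> keeps it unimodular.\<close>
  define u where "u = (if z = 0 then 1 else - cnj z / of_real (cmod z))"
  have u: "cmod u = 1" by (auto simp: u_def norm_divide)
  have uz: "u * z = - of_real (cmod z)"
  proof (cases "z = 0")
    case False
    then show ?thesis by (simp add: u_def cnj_mult_self power2_eq_square)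
  qed simp
  have "X $ j $ i = cnj z" using psdD(1)[OF assms] unfolding z_def by (metis adj_nth)
  define v where "v = axis i 1 + u *s axis j 1"
  have "0 \<le> Re (cip v (X *v v))" by (rule psdD(2)[OF assms])
  also have "cip v (X *v v) = X $ i $ i + u * z + cnj u * cnj z + cnj u * u * X $ j $ j"
    unfolding v_def matrix_vector_right_distrib mv_smult cip_add_left cip_add_right cip_smult_left cip_smult_right cip_axis
    by (simp add: z_def \<open>X $ j $ i = cnj z\<close>[unfolded z_def] algebra_simps)
  also have "\<dots> = X $ i $ i + X $ j $ j - 2 * of_real (cmod z)"
    by (simp only: uz cnj_mult_self u complex_cnj_mult[symmetric]) simp
  finally have "2 * cmod z \<le> Re (X $ i $ i) + Re (X $ j $ j)" by simp
  also have "\<dots> = (\<Sum>k\<in>{i,j}. Re (X $ k $ k))" using False by simp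
  also have "\<dots> \<le> (\<Sum>i\<in>UNIV. Re (X $ i $ i))"
    by (rule sum_mono2) (use psd_diag_nth(2)[OF assms] in auto)
  also have "\<dots> = Re (trace X)" by (simp add: trace_def)
  finally show ?thesis using norm_ge_zero[of z] unfolding z_def by linarith
qed

lemma pos_def_invertible:
  assumes "pos_def X" shows "\<exists>Y. X ** Y = mat 1 \<and> Y ** X = mat 1"
proof -
  have "X *v v = 0 \<Longrightarrow> v = 0" for v
    using assms unfolding pos_def_cip by (metis cip_zero(2) less_irrefl zero_complex.sel(1))
  then have "invertible X"
    using invertible_left_inverse matrix_left_invertible_ker by blast
  then show ?thesis by (auto simp: invertible_def)
qed

text \<open>The form attains a positive minimum on the unit sphere, and homogeneity carries the
  bound to all vectors.\<close>

lemma pos_def_bound: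
  assumes "pos_def X"
  obtains e where "e > 0" "\<And>v. e * (norm v)\<^sup>2 \<le> Re (cip v (X *v v))"
proof -
  define f where "f = (\<lambda>v. Re (cip v (X *v v)))"
  have cont: "continuous_on UNIV f"
    unfolding f_def cip_def by (intro continuous_intros matrix_vector_mult_linear_continuous_on)
  have "\<exists>x\<in>sphere 0 1. \<forall>y\<in>sphere 0 1. f x \<le> f y"
  proof (rule continuous_attains_inf)
    show "sphere (0::complex^'a) 1 \<noteq> {}" by simp
    show "continuous_on (sphere 0 1) f" using cont continuous_on_subset by blast
  qed simp
  then obtain x where x: "norm x = 1" "\<And>y. norm y = 1 \<Longrightarrow> f x \<le> f y" by (auto simp: dist_norm)
  have "f x > 0" using assms x(1) unfolding f_def pos_def_cip by (metis norm_zero zero_neq_one)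
  moreover have "f x * (norm v)\<^sup>2 \<le> f v" for v
  proof (cases "v = 0")
    case False
    define y where "y = complex_of_real (1 / norm v) *s v"
    have "norm y = 1" using False by (simp add: y_def norm_vsmult norm_divide)
    then have "f x \<le> f y" using x by auto
    also have "f y = f v / (norm v)\<^sup>2"
      unfolding f_def y_def mv_smult cip_smult_left cip_smult_right
      by (simp add: power2_eq_square field_simps)
    finally show ?thesis using False by (simp add: field_simps)
  qed (simp add: f_def)
  ultimately show thesis using that unfolding f_def by blast
qed

section \<open>Unitary matrices, powers and scalars\<close>

lemma unitary_adj: "unitary U \<Longrightarrow> unitary (adj U)"
  by (auto simp: unitary_def)

lemma unitary_mult: "unitary U \<Longrightarrow> unitary V \<Longrightarrow> unitary (U ** V)"
  unfolding unitary_def adj_mult mat_assoc by (metis mat_assoc matrix_mul_rid matrix_mul_lid)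

lemma unitaryI: "adj U ** U = mat 1 \<Longrightarrow> unitary U"
  unfolding unitary_def using matrix_left_right_inverse by blast

lemma unitary_smul: "cmod c = 1 \<Longrightarrow> unitary U \<Longrightarrow> unitary (smul c U)"
  by (simp add: unitary_def adj_smul mat_distribs cnj_mult_self mult.commute[of c])

primrec mpow :: "'n::finite cmat \<Rightarrow> nat \<Rightarrow> 'n cmat" where
  "mpow A 0 = mat 1" | "mpow A (Suc k) = A ** mpow A k"

lemma mpow_smul: "mpow (smul c A) k = smul (c ^ k) (mpow A k)"
  by (induction k) (simp_all add: mat_distribs mult.commute)

lemma mpow_commute: "A ** mpow A k = mpow A k ** A"
  by (induction k) (simp, metis mat_assoc mpow.simps(2))

lemma unitary_mpow: "unitary U \<Longrightarrow> unitary (mpow U k)"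
  by (induction k) (auto simp: unitary_mult, simp add: unitary_def)

text \<open>Commuting with the matrix units \<open>munit b c\<close> forces the off-diagonal entries
  to vanish and all diagonal entries to agree.\<close>

lemma scalar_of_commute:
  assumes "\<And>M. Y ** M = M ** (Y::'n::finite cmat)"
  shows "\<exists>c. Y = smul c (mat 1)"
proof -
  have *: "Y $ a $ b = (if a = b then Y $ c $ c else 0)" for a b c
  proof -
    have "(Y ** munit b c) $ a $ c = (munit b c ** Y) $ a $ c" using assms by simp
    moreover have "(Y ** munit b c) $ a $ c = (\<Sum>k\<in>UNIV. if k = b then Y $ a $ k else 0)"
      unfolding matrix_mult_nth munit_nth by (intro sum.cong) auto
    moreover have "(munit b c ** Y) $ a $ c = (\<Sum>k\<in>UNIV. if k = c then (if a = b then Y $ k $ c else 0) else 0)"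
      unfolding matrix_mult_nth munit_nth by (intro sum.cong) auto
    ultimately show ?thesis by simp
  qed
  show ?thesis
    \<comment> \<open>All diagonal entries agree, so any index serves; \<open>undefined\<close>
      names one.\<close>
    by (rule exI[of _ "Y $ undefined $ undefined"])
       (simp add: cmat_eq_iff mat_nth, metis *)
qed

lemma mat1_neq_0: "(mat 1 :: 'n::finite cmat) \<noteq> 0"
  by (simp add: cmat_eq_iff mat_nth)

lemma smul_mat1_inj: "smul a (mat 1 :: 'n::finite cmat) = smul b (mat 1) \<Longrightarrow> a = b"
  by (metis mat1_neq_0 right_minus_eq smul_diff_left smul_eq_0_iff)

subsection \<open>Continuity of matrix operations\<close>

lemma tendsto_cmatI: "(\<And>i j. ((\<lambda>x. f x $ i $ j) \<longlongrightarrow> A $ i $ j) F) \<Longrightarrow> (f \<longlongrightarrow> (A::'n::finite cmat)) F"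
  by (intro vec_tendstoI)

lemma tendsto_cmat_nth: "(f \<longlongrightarrow> A) F \<Longrightarrow> ((\<lambda>x. f x $ i $ j) \<longlongrightarrow> (A::'n::finite cmat) $ i $ j) F"
  by (intro tendsto_vec_nth)

lemma tendsto_matrix_mult [tendsto_intros]:
  "(f \<longlongrightarrow> A) F \<Longrightarrow> (g \<longlongrightarrow> B) F \<Longrightarrow> ((\<lambda>x. f x ** g x) \<longlongrightarrow> A ** (B::'n::finite cmat)) F"
  unfolding matrix_matrix_mult_def
  by (intro vec_tendstoI) (auto intro!: tendsto_intros)

lemma tendsto_matrix_vector_mult [tendsto_intros]:
  "(f \<longlongrightarrow> A) F \<Longrightarrow> (g \<longlongrightarrow> v) F \<Longrightarrow> ((\<lambda>x. f x *v g x) \<longlongrightarrow> (A::'n::finite cmat) *v v) F"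
  unfolding matrix_vector_mult_def
  by (intro vec_tendstoI) (auto intro!: tendsto_intros)

lemma tendsto_adj [tendsto_intros]: "(f \<longlongrightarrow> A) F \<Longrightarrow> ((\<lambda>x. adj (f x)) \<longlongrightarrow> adj (A::'n::finite cmat)) F"
  unfolding adj_def by (intro vec_tendstoI) (auto intro!: tendsto_intros)

lemma tendsto_smul [tendsto_intros]:
  "(c \<longlongrightarrow> a) F \<Longrightarrow> (f \<longlongrightarrow> A) F \<Longrightarrow> ((\<lambda>x. smul (c x) (f x)) \<longlongrightarrow> smul a (A::'n::finite cmat)) F"
  unfolding smul_def by (intro vec_tendstoI) (auto intro!: tendsto_intros)

lemma tendsto_trace [tendsto_intros]: "(f \<longlongrightarrow> A) F \<Longrightarrow> ((\<lambda>x. trace (f x)) \<longlongrightarrow> trace (A::'n::finite cmat)) F"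
  unfolding trace_def by (auto intro!: tendsto_intros)

lemma tendsto_cip [tendsto_intros]:
  "(f \<longlongrightarrow> u) F \<Longrightarrow> (g \<longlongrightarrow> v) F \<Longrightarrow> ((\<lambda>x. cip (f x) (g x)) \<longlongrightarrow> cip u v) F"
  unfolding cip_def by (auto intro!: tendsto_intros)

lemma continuous_on_cmat_ops [continuous_intros]:
  fixes f g :: "'a::topological_space \<Rightarrow> 'n::finite cmat" and u w :: "'a \<Rightarrow> complex^'n"
  shows "continuous_on S f \<Longrightarrow> continuous_on S g \<Longrightarrow> continuous_on S (\<lambda>x. f x ** g x)"
    and "continuous_on S f \<Longrightarrow> continuous_on S w \<Longrightarrow> continuous_on S (\<lambda>x. f x *v w x)"
    and "continuous_on S f \<Longrightarrow> continuous_on S (\<lambda>x. adj (f x))"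
    and "continuous_on S c \<Longrightarrow> continuous_on S f \<Longrightarrow> continuous_on S (\<lambda>x. smul (c x) (f x))"
    and "continuous_on S f \<Longrightarrow> continuous_on S (\<lambda>x. trace (f x))"
    and "continuous_on S u \<Longrightarrow> continuous_on S w \<Longrightarrow> continuous_on S (\<lambda>x. cip (u x) (w x))"
  by (auto simp: continuous_on_def intro!: tendsto_intros)

lemma continuous_on_cmatI:
  "(\<And>i j. continuous_on S (\<lambda>x. f x $ i $ j)) \<Longrightarrow> continuous_on S (f :: _ \<Rightarrow> 'n::finite cmat)"
  by (auto simp: continuous_on_def intro!: tendsto_cmatI)

subsection \<open>Operator bounds\<close>

text \<open>An upper bound for the Euclidean operator norm, written as a predicate. The norm of the
  matrix type is the Frobenius norm, whose value at the identity is not 1 in general; the geometric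
  estimates below need the value 1.\<close>

definition opn :: "real \<Rightarrow> 'n::finite cmat \<Rightarrow> bool" where
  "opn q E \<longleftrightarrow> (\<forall>v. norm (E *v v) \<le> q * norm v)"

lemma opn_mono: "opn p E \<Longrightarrow> p \<le> q \<Longrightarrow> opn q E"
  unfolding opn_def by (meson mult_right_mono norm_ge_zero order_trans)

lemma opn_mult:
  assumes "opn p A" "opn q B" "0 \<le> p" shows "opn (p * q) (A ** B)"
  unfolding opn_def matrix_vector_mul_assoc[symmetric]
proof
  fix v
  have "norm (A *v (B *v v)) \<le> p * norm (B *v v)" using assms by (simp add: opn_def)
  also have "\<dots> \<le> p * (q * norm v)" using assms by (intro mult_left_mono) (auto simp: opn_def)
  finally show "norm (A *v (B *v v)) \<le> p * q * norm v" by (simp add: mult.assoc)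
qed

lemma opn_add: "opn p A \<Longrightarrow> opn q B \<Longrightarrow> opn (p + q) (A + B)"
  unfolding opn_def matrix_vector_mult_add_rdistrib distrib_right
  by (meson add_mono norm_triangle_ineq order_trans)

lemma opn_scaleR: "0 \<le> c \<Longrightarrow> opn q A \<Longrightarrow> opn (c * q) (c *\<^sub>R A)"
  by (simp add: opn_def scaleR_mv mult_left_mono mult.assoc)

lemma opn_one: "opn 1 (mat 1)" by (simp add: opn_def)

lemma opn_zero: "0 \<le> q \<Longrightarrow> opn q 0" by (simp add: opn_def)

lemma opn_nth: assumes "opn q A" shows "cmod (A $ i $ j) \<le> q"
proof -
  have "A $ i $ j = cip (axis i 1) (A *v axis j 1)" by (simp add: cip_axis)
  also have "\<dots> = (A *v axis j 1) $ i"
    unfolding cip_def by (subst sum.remove[of _ i]) (auto simp: axis_def intro: sum.neutral)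
  finally have "cmod (A $ i $ j) \<le> norm (A *v axis j 1)"
    using Finite_Cartesian_Product.norm_nth_le[of "A *v axis j 1" i] by simp
  also have "\<dots> \<le> q * norm (axis j (1::complex))" using assms unfolding opn_def by blast
  also have "norm (axis j (1::complex)) = 1" by (rule norm_Basis) (simp add: axis_in_Basis_iff)
  finally show ?thesis by simp
qed

lemma norm_vec_le_sum: "norm (v::complex^'n::finite) \<le> (\<Sum>i\<in>UNIV. cmod (v $ i))"
  unfolding norm_vec_def by (rule L2_set_le_sum) simp

lemma opn_sum_nth: "opn (\<Sum>i\<in>UNIV. \<Sum>j\<in>UNIV. cmod (E $ i $ j)) E"
  unfolding opn_def
proof
  fix v
  have "norm (E *v v) \<le> (\<Sum>i\<in>UNIV. cmod ((E *v v) $ i))" by (rule norm_vec_le_sum)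
  also have "\<dots> \<le> (\<Sum>i\<in>UNIV. \<Sum>j\<in>UNIV. cmod (E $ i $ j) * norm v)"
    unfolding matrix_vector_mult_def
    by (auto intro!: sum_mono order_trans[OF norm_sum] mult_left_mono
        simp: norm_mult Finite_Cartesian_Product.norm_nth_le)
  finally show "norm (E *v v) \<le> (\<Sum>i\<in>UNIV. \<Sum>j\<in>UNIV. cmod (E $ i $ j)) * norm v"
    by (simp add: sum_distrib_right)
qed

lemma eventually_opn:
  assumes "(f \<longlongrightarrow> (0::'n::finite cmat)) F" "0 < q"
  shows "eventually (\<lambda>x. opn q (f x)) F"
proof -
  have "((\<lambda>x. \<Sum>i\<in>UNIV. \<Sum>j\<in>UNIV. cmod (f x $ i $ j)) \<longlongrightarrow>
      (\<Sum>i\<in>UNIV. \<Sum>j\<in>UNIV. cmod ((0::'n cmat) $ i $ j))) F"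
    by (intro tendsto_intros tendsto_cmat_nth assms)
  then have "eventually (\<lambda>x. (\<Sum>i\<in>UNIV. \<Sum>j\<in>UNIV. cmod (f x $ i $ j)) < q) F"
    using assms(2) by (auto dest: order_tendstoD(2))
  then show ?thesis
    by eventually_elim (rule opn_mono[OF opn_sum_nth], simp)
qed

text \<open>Polarisation together with the parallelogram law; hermiticity is what keeps the constant
  \<open>q\<close> unchanged.\<close>

lemma opn_herm:
  assumes E: "adj E = E" and q: "0 \<le> q"
    and f: "\<And>v. \<bar>Re (cip v (E *v v))\<bar> \<le> q * (norm v)\<^sup>2"
  shows "opn q E"
  unfolding opn_def
proof
  fix v
  define w where "w = E *v v"
  show "norm (E *v v) \<le> q * norm v"
  proof (cases "w = 0 \<or> v = 0")
    case True
    then show ?thesis using q by (auto simp: w_def)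
  next
    case False
    \<comment> \<open>\<open>u\<close> is \<open>E *v v\<close> stretched to the length of
      \<open>v\<close>, so that the two norms in the parallelogram law agree.\<close>
    define s where "s = norm v / norm w"
    define u where "u = complex_of_real s *s w"
    have s: "s > 0" using False by (simp add: s_def)
    have nu: "norm u = norm v" using False by (simp add: u_def norm_vsmult s_def norm_divide)
    have "4 * Re (cip u (E *v v)) = Re (cip (u + v) (E *v (u + v))) - Re (cip (u - v) (E *v (u - v)))"
      using herm_cip_commute[OF E, of v u]
      by (simp add: matrix_vector_right_distrib matrix_vector_mult_diff_distrib cip_add_left cip_add_right
          cip_diff_left cip_diff_right)
    also have "\<dots> \<le> q * (norm (u + v))\<^sup>2 + q * (norm (u - v))\<^sup>2"
      using f[of "u + v"] f[of "u - v"] by linarith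
    also have "\<dots> = q * (2 * (norm u)\<^sup>2 + 2 * (norm v)\<^sup>2)"
      by (simp add: power2_norm_eq_inner inner_add_left inner_add_right inner_diff_left inner_diff_right
          inner_commute algebra_simps)
    also have "\<dots> = 4 * q * (norm v)\<^sup>2" by (simp add: nu)
    finally have "Re (cip u (E *v v)) \<le> q * (norm v)\<^sup>2" by simp
    moreover have "cip u (E *v v) = of_real (s * (norm w)\<^sup>2)"
      by (simp add: u_def cip_smult_left w_def[symmetric] cip_self)
    ultimately have "s * (norm w)\<^sup>2 \<le> q * (norm v)\<^sup>2" by (metis Re_complex_of_real)
    then have "norm v * norm w \<le> q * (norm v)\<^sup>2" using False by (simp add: s_def power2_eq_square)
    then have "norm v * norm w \<le> norm v * (q * norm v)" by (simp add: power2_eq_square algebra_simps)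
    then show ?thesis using False by (simp add: w_def)
  qed
qed

subsection \<open>Inverse square roots by Newton iteration\<close>

text \<open>Newton's iteration \<open>X (3 - S X^2) / 2\<close> for the inverse square root of
  \<open>S = mat 1 - E\<close>, started at the identity. It uses no inverses, so every iterate is a
  polynomial in \<open>E\<close>.\<close>

primrec nwt :: "'n::finite cmat \<Rightarrow> nat \<Rightarrow> 'n cmat" where
  "nwt E 0 = mat 1"
| "nwt E (Suc k) = nwt E k ** (mat 1 + (1/2) *\<^sub>R (mat 1 - (mat 1 - E) ** nwt E k ** nwt E k))"

definition nres :: "'n::finite cmat \<Rightarrow> nat \<Rightarrow> 'n cmat" where
  "nres E k = mat 1 - (mat 1 - E) ** nwt E k ** nwt E k"

lemma scaleR_mm_left: "(c *\<^sub>R (A::'n::finite cmat)) ** (B::'n cmat) = c *\<^sub>R (A ** B)"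
  unfolding smul_of_real[symmetric] by (rule smul_mult_left)

lemma scaleR_mm_right: "(A::'n::finite cmat) ** (c *\<^sub>R (B::'n cmat)) = c *\<^sub>R (A ** B)"
  unfolding smul_of_real[symmetric] by (rule smul_mult_right)

lemma nwt_commute:
  assumes "C ** E = E ** C" shows "C ** nwt E k = nwt E k ** C"
proof (induction k)
  case (Suc k)
  have a: "C ** (nwt E k ** Y) = nwt E k ** (C ** Y)" for Y using Suc by (metis mat_assoc)
  have b: "C ** (E ** Y) = E ** (C ** Y)" for Y using assms by (metis mat_assoc)
  show ?case
    by (simp add: mat_distribs mat_assoc a b Suc scaleR_mm_left scaleR_mm_right)
qed simp

text \<open>All matrices involved are polynomials in \<open>E\<close> and commute, so the scalar
  identity \<open>1 - (1 - R) (1 + R/2)^2 = 3/4 R^2 + 1/4 R^3\<close> applies: the residual is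
  essentially squared in each step.\<close>

lemma nres_Suc: "nres E (Suc k) = (3/4) *\<^sub>R (nres E k ** nres E k) + (1/4) *\<^sub>R (nres E k ** nres E k ** nres E k)"
proof -
  define X S R where "X = nwt E k" and "S = mat 1 - E" and "R = nres E k"
  have XE: "X ** E = E ** X" unfolding X_def by (rule nwt_commute[symmetric]) simp
  have XS: "X ** S = S ** X" by (simp add: S_def mat_distribs XE)
  have R: "R = mat 1 - S ** X ** X" by (simp add: R_def nres_def S_def X_def)
  have XR: "X ** R = R ** X" by (simp add: R mat_distribs, metis XS mat_assoc)
  define H where "H = mat 1 + (1/2) *\<^sub>R R"
  have XH: "H ** X = X ** H" by (simp add: H_def mat_distribs scaleR_mm_left scaleR_mm_right XR)
  have "nwt E (Suc k) = X ** H" by (simp add: X_def H_def R S_def)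
  then have "nres E (Suc k) = mat 1 - S ** (X ** H) ** (X ** H)" by (simp add: nres_def S_def)
  also have "S ** (X ** H) ** (X ** H) = (S ** X ** X) ** (H ** H)" by (metis XH mat_assoc)
  also have "S ** X ** X = mat 1 - R" by (simp add: R)
  also have "mat 1 - (mat 1 - R) ** (H ** H) = (3/4) *\<^sub>R (R ** R) + (1/4) *\<^sub>R (R ** R ** R)"
    by (simp add: H_def mat_distribs scaleR_mm_left scaleR_mm_right mat_assoc scaleR_add_right
        scaleR_diff_right) (simp add: algebra_simps flip: scaleR_add_left)
  finally show ?thesis by (simp add: R_def)
qed

text \<open>The recursion sends a bound \<open>p \<le> q\<close> to at most
  \<open>p * p \<le> q * p\<close>. Geometric decay is what the Weierstrass test below asks
  for.\<close>

lemma opn_nres: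
  assumes "opn q E" "0 \<le> q" "q < 1" shows "opn (q ^ Suc k) (nres E k)"
proof (induction k)
  case 0
  then show ?case using assms by (simp add: nres_def)
next
  case (Suc k)
  define p where "p = q ^ Suc k"
  have p: "0 \<le> p" "p \<le> q" "p \<le> 1"
    using assms by (auto simp: p_def mult_left_le power_le_one) (simp add: mult_le_one power_le_one)
  have IH: "opn p (nres E k)" using Suc by (simp add: p_def)
  have "opn (3/4 * (p * p) + 1/4 * (p * p * p)) (nres E (Suc k))"
    unfolding nres_Suc by (intro opn_add opn_scaleR opn_mult IH) (use p in auto)
  moreover have "3/4 * (p * p) + 1/4 * (p * p * p) \<le> 3/4 * (p * p) + 1/4 * (p * p * 1)"
    using p by (intro add_left_mono mult_left_mono) auto
  moreover have "p * p \<le> q * p" using p by (intro mult_right_mono) auto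
  ultimately show ?case unfolding power_Suc[of q "Suc k"] p_def[symmetric]
    by (elim opn_mono) linarith
qed

lemma nwt_Suc: "nwt E (Suc k) = nwt E k + (1/2) *\<^sub>R (nwt E k ** nres E k)"
  by (simp add: nres_def mat_distribs scaleR_mm_right)

text \<open>Step \<open>k\<close> multiplies the bound by at most
  \<open>1 + q^k \<le> exp (q^k)\<close>, so the bounds stay below the exponential of the geometric
  series.\<close>

lemma opn_nwt:
  assumes E: "opn q E" "0 \<le> q" "q < 1" shows "opn (exp (\<Sum>j<k. q ^ j)) (nwt E k)"
proof (induction k)
  case (Suc k)
  define a where "a = exp (\<Sum>j<k. q ^ j)"
  have "opn (a + 1/2 * (a * q ^ Suc k)) (nwt E (Suc k))"
    unfolding nwt_Suc by (intro opn_add opn_scaleR opn_mult Suc[folded a_def] opn_nres E) (auto simp: a_def)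
  moreover have "a + 1/2 * (a * q ^ Suc k) \<le> a * (1 + q ^ k)"
  proof -
    have "q ^ Suc k \<le> q ^ k" using E by (simp add: mult_left_le_one_le)
    moreover have "0 \<le> q ^ Suc k" using E by simp
    ultimately have "1/2 * q ^ Suc k \<le> q ^ k" by linarith
    then have "a * (1/2 * q ^ Suc k) \<le> a * q ^ k" by (intro mult_left_mono) (auto simp: a_def)
    then show ?thesis by (simp add: algebra_simps)
  qed
  moreover have "a * (1 + q ^ k) \<le> a * exp (q ^ k)"
    by (intro mult_left_mono exp_ge_add_one_self) (simp add: a_def)
  moreover have "a * exp (q ^ k) = exp (\<Sum>j<Suc k. q ^ j)" by (simp add: a_def exp_add)
  ultimately show ?case by (metis opn_mono order_trans)
qed (simp add: opn_one)

lemma nwt_diff_nth: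
  assumes E: "opn q E" "0 \<le> q" "q < 1"
  shows "cmod ((nwt E (Suc k) - nwt E k) $ i $ j) \<le> exp (1 / (1 - q)) * q ^ k"
proof -
  have "(\<Sum>j<k. q ^ j) \<le> (\<Sum>j. q ^ j)"
    using E by (intro sum_le_suminf summable_geometric) auto
  also have "\<dots> = 1 / (1 - q)" using E by (simp add: suminf_geometric)
  finally have "exp (\<Sum>j<k. q ^ j) \<le> exp (1 / (1 - q))" by simp
  then have "opn (exp (1 / (1 - q))) (nwt E k)" using opn_nwt[OF E] opn_mono by blast
  then have "opn (1/2 * (exp (1 / (1 - q)) * q ^ Suc k)) ((1/2) *\<^sub>R (nwt E k ** nres E k))"
    by (intro opn_scaleR opn_mult opn_nres[OF E]) auto
  then have "opn (1/2 * (exp (1 / (1 - q)) * q ^ Suc k)) (nwt E (Suc k) - nwt E k)"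
    unfolding nwt_Suc by simp
  moreover have "1/2 * (exp (1 / (1 - q)) * q ^ Suc k) \<le> exp (1 / (1 - q)) * q ^ k"
  proof -
    have "q ^ Suc k \<le> q ^ k" "0 \<le> q ^ Suc k" using E by (simp_all add: mult_left_le_one_le)
    then have "1/2 * q ^ Suc k \<le> q ^ k" by linarith
    then show ?thesis by (simp add: mult_left_mono)
  qed
  ultimately show ?thesis by (meson opn_mono opn_nth)
qed

text \<open>The inverse square root of \<open>mat 1 - E\<close>, meaningful when
  \<open>opn q E\<close> holds with \<open>q < 1\<close>. The argument is the deviation from the
  identity, which makes the smallness condition explicit.\<close>

definition isq :: "'n::finite cmat \<Rightarrow> 'n cmat" where
  "isq E = (\<chi> i j. lim (\<lambda>k. nwt E k $ i $ j))"

text \<open>The telescoping differences are dominated by a geometric series, so convergence is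
  uniform over all \<open>E\<close> with the same bound; continuity and holomorphy of
  \<open>isq\<close> rest on this.\<close>

lemma uniform_limit_nwt:
  assumes q: "0 \<le> q" "q < 1"
  shows "uniform_limit {E. opn q E} (\<lambda>k E. nwt E k $ i $ j) (\<lambda>E. isq E $ i $ j) sequentially"
proof -
  define l where "l = (\<lambda>E::'a cmat. mat 1 $ i $ j + (\<Sum>k. (nwt E (Suc k) - nwt E k) $ i $ j))"
  have tel: "mat 1 $ i $ j + (\<Sum>k<n. (nwt E (Suc k) - nwt E k) $ i $ j) = nwt E n $ i $ j" for E :: "'a cmat" and n
    using sum_lessThan_telescope[of "\<lambda>k. nwt E k $ i $ j" n] by (simp del: nwt.simps(2))
  have "uniform_limit {E. opn q E} (\<lambda>n E. \<Sum>k<n. (nwt E (Suc k) - nwt E k) $ i $ j)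
      (\<lambda>E. \<Sum>k. (nwt E (Suc k) - nwt E k) $ i $ j) sequentially"
    by (rule Weierstrass_m_test[where M = "\<lambda>k. exp (1 / (1 - q)) * q ^ k"])
       (use nwt_diff_nth q in \<open>auto intro!: summable_mult summable_geometric\<close>)
  then have "uniform_limit {E. opn q E} (\<lambda>n E. mat 1 $ i $ j + (\<Sum>k<n. (nwt E (Suc k) - nwt E k) $ i $ j)) l sequentially"
    unfolding l_def by (intro uniform_limit_intros)
  then have ul: "uniform_limit {E. opn q E} (\<lambda>k E. nwt E k $ i $ j) l sequentially"
    by (simp only: tel)
  have "l E = isq E $ i $ j" if "opn q E" for E
    using tendsto_uniform_limitI[OF ul, of E] that by (simp add: isq_def limI)
  then show ?thesis by (intro uniform_limit_cong'[THEN iffD1, OF _ _ ul]) auto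
qed

lemma nwt_tendsto:
  assumes "opn q E" "0 \<le> q" "q < 1" shows "(\<lambda>k. nwt E k) \<longlonglongrightarrow> isq E"
  by (rule tendsto_cmatI) (use tendsto_uniform_limitI[OF uniform_limit_nwt[OF assms(2,3)]] assms(1) in auto)

lemma isq_commute:
  assumes "opn q E" "0 \<le> q" "q < 1" "C ** E = E ** C" shows "C ** isq E = isq E ** C"
proof (rule LIMSEQ_unique)
  show "(\<lambda>k. C ** nwt E k) \<longlonglongrightarrow> C ** isq E"
    by (intro tendsto_intros nwt_tendsto[OF assms(1-3)])
  have "(\<lambda>k. nwt E k ** C) \<longlonglongrightarrow> isq E ** C"
    by (intro tendsto_intros nwt_tendsto[OF assms(1-3)])
  then show "(\<lambda>k. C ** nwt E k) \<longlonglongrightarrow> isq E ** C"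
    by (simp add: nwt_commute[OF assms(4)])
qed

lemma adj_nwt: assumes "adj E = E" shows "adj (nwt E k) = nwt E k"
proof (induction k)
  case (Suc k)
  have a: "E ** nwt E k = nwt E k ** E" by (rule nwt_commute) simp
  show ?case
    by (simp add: adj_distribs Suc assms mat_distribs scaleR_mm_left scaleR_mm_right mat_assoc)
       (metis a mat_assoc)
qed simp

lemma adj_isq: assumes "opn q E" "0 \<le> q" "q < 1" "adj E = E" shows "adj (isq E) = isq E"
proof (rule LIMSEQ_unique)
  show "(\<lambda>k. adj (nwt E k)) \<longlonglongrightarrow> adj (isq E)"
    by (intro tendsto_intros nwt_tendsto[OF assms(1-3)])
  show "(\<lambda>k. adj (nwt E k)) \<longlonglongrightarrow> isq E"
    using nwt_tendsto[OF assms(1-3)] by (simp add: adj_nwt[OF assms(4)])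
qed

lemma isq_square: assumes E: "opn q E" "0 \<le> q" "q < 1" shows "(mat 1 - E) ** isq E ** isq E = mat 1"
proof -
  have l1: "(\<lambda>k. nres E k) \<longlonglongrightarrow> mat 1 - (mat 1 - E) ** isq E ** isq E"
    unfolding nres_def by (intro tendsto_intros nwt_tendsto[OF E])
  have "(\<lambda>k. nres E k) \<longlonglongrightarrow> 0"
  proof (rule tendsto_cmatI)
    fix i j
    have "(\<lambda>k. q ^ Suc k) \<longlonglongrightarrow> 0" using E by (intro LIMSEQ_Suc LIMSEQ_power_zero) auto
    then have "(\<lambda>k. nres E k $ i $ j) \<longlonglongrightarrow> 0"
      by (rule Lim_null_comparison[rotated]) (use opn_nth[OF opn_nres[OF E]] in auto)
    then show "(\<lambda>k. nres E k $ i $ j) \<longlonglongrightarrow> 0 $ i $ j" by simp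
  qed
  then have "mat 1 - (mat 1 - E) ** isq E ** isq E = 0" using l1 LIMSEQ_unique by blast
  then show ?thesis by simp
qed

lemma continuous_on_nwt: "continuous_on S (\<lambda>E. nwt E k)"
proof (induction k)
  case (Suc k)
  then show ?case by (simp only: nwt.simps) (intro continuous_intros)
qed (simp add: continuous_on_const)

lemma continuous_on_isq: assumes "0 \<le> q" "q < 1" shows "continuous_on {E. opn q E} isq"
proof (rule continuous_on_cmatI)
  fix i j
  show "continuous_on {E. opn q E} (\<lambda>E. isq E $ i $ j)"
    by (rule uniform_limit_theorem[OF _ uniform_limit_nwt[OF assms]])
       (auto intro!: always_eventually continuous_intros continuous_on_nwt)
qed

lemma isq_zero: "isq 0 = mat 1"
proof -
  have "nwt 0 k = (mat 1 :: 'a cmat)" for k by (induction k) auto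
  then have "nwt (0::'a cmat) = (\<lambda>k. mat 1)" by blast
  then have "(\<lambda>k. mat 1) \<longlonglongrightarrow> isq (0::'a cmat)"
    using nwt_tendsto[of "1/2" "0::'a cmat"] by (simp only: opn_zero)
  then show ?thesis by (simp add: LIMSEQ_const_iff)
qed

lemma isq_tendsto_one:
  assumes "(f \<longlongrightarrow> (0::'n::finite cmat)) F" shows "((\<lambda>x. isq (f x)) \<longlongrightarrow> mat 1) F"
proof -
  have "((\<lambda>x. isq (f x)) \<longlongrightarrow> isq 0) F"
    by (rule continuous_on_tendsto_compose[OF continuous_on_isq[of "1/2"] assms])
       (use eventually_opn[OF assms, of "1/2"] in \<open>auto simp: opn_zero\<close>)
  then show ?thesis by (simp add: isq_zero)
qed

text \<open>The iteration contains no conjugation, so its iterates are holomorphic wherever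
  \<open>g\<close> is, and uniform limits stay holomorphic.\<close>

lemma holomorphic_isq:
  assumes S: "open S" and hol: "\<And>i j. (\<lambda>z. g z $ i $ j) holomorphic_on S"
    and q: "0 \<le> q" "q < 1" and g: "\<And>z. z \<in> S \<Longrightarrow> opn q (g z)"
  shows "(\<lambda>z. isq (g z) $ i $ j) holomorphic_on S"
proof (rule holomorphic_uniform_sequence[OF S, where f = "\<lambda>k z. nwt (g z) k $ i $ j"])
  fix k
  have "\<forall>i j. (\<lambda>z. nwt (g z) k $ i $ j) holomorphic_on S"
  proof (induction k)
    case (Suc k)
    then show ?case
      by (auto simp: matrix_mult_nth mat_nth scaleR_conv_of_real
          intro!: holomorphic_intros holomorphic_on_sum hol) 
  qed auto
  then show "(\<lambda>z. nwt (g z) k $ i $ j) holomorphic_on S" by blast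
next
  fix x assume "x \<in> S"
  then obtain d where d: "d > 0" "cball x d \<subseteq> S" using S open_contains_cball by blast
  have "uniform_limit (cball x d) (\<lambda>k z. nwt (g z) k $ i $ j) (\<lambda>z. isq (g z) $ i $ j) sequentially"
    by (rule uniform_limit_compose'[OF uniform_limit_nwt[OF q]]) (use d g in auto)
  then show "\<exists>d>0. cball x d \<subseteq> S \<and>
      uniform_limit (cball x d) (\<lambda>k z. nwt (g z) k $ i $ j) (\<lambda>z. isq (g z) $ i $ j) sequentially"
    using d by blast
qed

subsection \<open>Kraus maps and words\<close>

text \<open>Tuples are functions on the naturals of which \<open>kmap\<close> reads the first
  \<open>r\<close> values, so that each Kraus operator can be followed along a path by
  itself.\<close>

definition kmap :: "nat \<Rightarrow> (nat \<Rightarrow> 'n::finite cmat) \<Rightarrow> 'n cmat \<Rightarrow> 'n cmat" where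
  "kmap r A X = (\<Sum>i<r. A i ** X ** adj (A i))"

text \<open>The Kraus tuple of the dual map; facts about \<open>kmap\<close> thereby apply to
  both.\<close>

definition dag :: "(nat \<Rightarrow> 'n::finite cmat) \<Rightarrow> nat \<Rightarrow> 'n cmat" where
  "dag A i = adj (A i)"

text \<open>The image of the identity under the dual map; it equals \<open>mat 1\<close> exactly for
  trace-preserving tuples.\<close>

definition gram :: "nat \<Rightarrow> (nat \<Rightarrow> 'n::finite cmat) \<Rightarrow> 'n cmat" where
  "gram r A = (\<Sum>i<r. adj (A i) ** A i)"

lemma kraus_map_eq_kmap: "kraus_map As = kmap (length As) (\<lambda>i. As ! i)"
  unfolding kraus_map_def kmap_def
  by (auto simp: fun_eq_iff sum_list_sum_nth atLeast0LessThan intro!: sum.cong)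

lemma kmap_cong: "(\<And>i. i < r \<Longrightarrow> A i = B i) \<Longrightarrow> kmap r A = kmap r B"
  by (simp add: kmap_def fun_eq_iff)

lemma kmap_eq_kraus_map: "kmap r A = kraus_map (map A [0..<r])"
  unfolding kraus_map_eq_kmap by simp (rule kmap_cong, simp)

lemma is_CP_kmap: "is_CP (kmap r A)"
  unfolding is_CP_def kmap_eq_kraus_map by blast

lemma kmap_add: "kmap r A (X + Y) = kmap r A X + kmap r A Y"
  by (simp add: kmap_def mat_distribs sum.distrib)
lemma kmap_diff: "kmap r A (X - Y) = kmap r A X - kmap r A Y"
  by (simp add: kmap_def mat_distribs sum_subtractf)
lemma kmap_smul: "kmap r A (smul c X) = smul c (kmap r A X)"
  by (simp add: kmap_def mat_distribs smul_sum_right)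
lemma kmap_scaleR: "kmap r A (c *\<^sub>R X) = c *\<^sub>R kmap r A X"
  using kmap_smul[of r A "of_real c" X] by (simp add: smul_of_real)
lemma kmap_zero [simp]: "kmap r A 0 = 0"
  by (simp add: kmap_def)
lemma kmap_sum: "kmap r A (sum f S) = (\<Sum>i\<in>S. kmap r A (f i))"
  by (induction S rule: infinite_finite_induct) (simp_all add: kmap_add)
lemma kmap_adj: "kmap r A (adj X) = adj (kmap r A X)"
  by (simp add: kmap_def adj_distribs mat_assoc)
lemma kmap_dag_eq: "kmap r (dag A) X = (\<Sum>i<r. adj (A i) ** X ** A i)"
  by (simp add: kmap_def dag_def)
lemma kmap_dag_one: "kmap r (dag A) (mat 1) = gram r A"
  by (simp add: kmap_dag_eq gram_def)

lemma psd_kmap: "psd X \<Longrightarrow> psd (kmap r A X)"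
  unfolding kmap_def by (intro psd_sum psd_conj)

lemma trace_kmap: "trace (kmap r A X) = trace (gram r A ** X)"
proof -
  have "trace (A i ** X ** adj (A i)) = trace (adj (A i) ** A i ** X)" for i
    by (metis mat_assoc trace_rotate)
  then show ?thesis by (simp add: kmap_def gram_def mat_distribs trace_sum)
qed

lemma trace_kmap_dag: "trace (kmap r (dag A) X ** Y) = trace (X ** kmap r A Y)"
proof -
  have "trace (adj (A i) ** X ** A i ** Y) = trace (X ** (A i ** Y ** adj (A i)))" for i
    by (metis mat_assoc trace_rotate)
  then show ?thesis
    unfolding kmap_dag_eq kmap_def[of r A] by (simp add: mat_distribs trace_sum)
qed

text \<open>The trace form is nondegenerate, so the description in \<open>dual_map\<close> has at
  most one solution and any candidate may be verified directly.\<close>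

lemma dual_map_eqI:
  assumes "\<And>Y. trace (adj S ** Y) = trace (adj X ** T Y)"
  shows "dual_map T X = S"
  unfolding dual_map_def
proof (rule the_equality)
  show "\<forall>Y. trace (adj S ** Y) = trace (adj X ** T Y)" using assms by blast
  fix S' assume "\<forall>Y. trace (adj S' ** Y) = trace (adj X ** T Y)"
  then have "trace ((adj S' - adj S) ** Y) = 0" for Y
    by (simp add: mat_distribs trace_sub assms)
  then have "adj S' - adj S = 0" by (rule trace_mult_eq_0_imp)
  then show "S' = S" by (metis adj_adj eq_iff_diff_eq_0)
qed

lemma dual_map_kmap: "dual_map (kmap r A) = kmap r (dag A)"
proof
  fix X
  show "dual_map (kmap r A) X = kmap r (dag A) X"
    by (rule dual_map_eqI) (metis kmap_adj trace_kmap_dag)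
qed

lemma trace_preserving_kmap: "trace_preserving (kmap r A) \<longleftrightarrow> gram r A = mat 1"
proof
  assume "trace_preserving (kmap r A)"
  then have "trace ((gram r A - mat 1) ** X) = 0" for X
    unfolding trace_preserving_def by (simp add: mat_distribs trace_sub trace_kmap)
  then have "gram r A - mat 1 = 0" by (rule trace_mult_eq_0_imp)
  then show "gram r A = mat 1" by simp
qed (simp add: trace_preserving_def trace_kmap)

primrec wprod :: "(nat \<Rightarrow> 'n::finite cmat) \<Rightarrow> nat list \<Rightarrow> 'n cmat" where
  "wprod A [] = mat 1" | "wprod A (i # w) = A i ** wprod A w"

lemma wprod_append: "wprod A (v @ w) = wprod A v ** wprod A w"
  by (induction v) (simp_all add: mat_assoc)

lemma wprod_dag: "wprod (dag A) w = adj (wprod A (rev w))"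
  by (induction w) (simp_all add: wprod_append adj_mult dag_def)

definition words :: "nat \<Rightarrow> nat \<Rightarrow> nat list set" where
  "words r n = {w. set w \<subseteq> {..<r} \<and> length w = n}"

lemma finite_words [simp]: "finite (words r n)"
  unfolding words_def by (rule finite_lists_length_eq) simp

lemma words_0: "words r 0 = {[]}" by (auto simp: words_def)

lemma words_Suc: "words r (Suc n) = (\<lambda>(i, w). i # w) ` ({..<r} \<times> words r n)"
  by (auto simp: words_def length_Suc_conv image_iff)

text \<open>The bridge between spectrum and algebra: what the iterates do is governed by the words
  of the corresponding length.\<close>

lemma kmap_power: "(kmap r A ^^ n) X = (\<Sum>w\<in>words r n. wprod A w ** X ** adj (wprod A w))"
proof (induction n)
  case (Suc n)
  have "(kmap r A ^^ Suc n) X = (\<Sum>i<r. \<Sum>w\<in>words r n. wprod A (i # w) ** X ** adj (wprod A (i # w)))"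
    by (simp add: Suc kmap_def mat_distribs adj_mult mat_assoc)
  also have "\<dots> = (\<Sum>w\<in>words r (Suc n). wprod A w ** X ** adj (wprod A w))"
    unfolding words_Suc sum.cartesian_product
    by (subst sum.reindex) (auto simp: inj_on_def case_prod_unfold)
  finally show ?case .
qed (simp add: words_0)

lemma kmap_power_diff: "(kmap r A ^^ n) (X - Y) = (kmap r A ^^ n) X - (kmap r A ^^ n) Y"
  by (induction n) (simp_all add: kmap_diff)
lemma kmap_power_add: "(kmap r A ^^ n) (X + Y) = (kmap r A ^^ n) X + (kmap r A ^^ n) Y"
  by (induction n) (simp_all add: kmap_add)
lemma kmap_power_smul: "(kmap r A ^^ n) (smul c X) = smul c ((kmap r A ^^ n) X)"
  by (induction n) (simp_all add: kmap_smul)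
lemma kmap_power_zero [simp]: "(kmap r A ^^ n) 0 = 0"
  by (induction n) simp_all

text \<open>Spanning is expressed by the vanishing of the annihilator for the trace form.\<close>
definition spans :: "nat \<Rightarrow> nat \<Rightarrow> nat \<Rightarrow> (nat \<Rightarrow> 'n::finite cmat) \<Rightarrow> bool" where
  "spans r N m A \<longleftrightarrow> (\<forall>Z. (\<forall>w. set w \<subseteq> {..<r} \<and> N \<le> length w \<and> length w < N + m \<longrightarrow>
      trace (Z ** wprod A w) = 0) \<longrightarrow> Z = 0)"

text \<open>The unital algebra generated by the tuple is the full matrix algebra; by Burnside's
  theorem this means that there is no nontrivial common invariant subspace.\<close>

definition irr :: "nat \<Rightarrow> (nat \<Rightarrow> 'n::finite cmat) \<Rightarrow> bool" where
  "irr r A \<longleftrightarrow> (\<forall>Z. (\<forall>w. set w \<subseteq> {..<r} \<longrightarrow> trace (Z ** wprod A w) = 0) \<longrightarrow> Z = 0)"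

lemma spans_imp_irr: "spans r N m A \<Longrightarrow> irr r A"
  unfolding spans_def irr_def by blast

lemma trace_mult_wprod_dag: "trace (Z ** wprod (dag A) w) = cnj (trace (adj Z ** wprod A (rev w)))"
  by (simp add: wprod_dag trace_adj[symmetric] adj_mult) (rule trace_mul_sym)

text \<open>Adjoints reverse words but keep their lengths, so the window is the same for a tuple and
  its dual.\<close>

lemma spans_dag_imp: assumes "spans r N m (dag A)" shows "spans r N m A"
  unfolding spans_def
proof (intro allI impI)
  fix Z assume *: "\<forall>w. set w \<subseteq> {..<r} \<and> N \<le> length w \<and> length w < N + m \<longrightarrow> trace (Z ** wprod A w) = 0"
  have "trace (adj Z ** wprod (dag A) w) = 0" if "set w \<subseteq> {..<r}" "N \<le> length w" "length w < N + m" for w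
    using *[rule_format, of "rev w"] that by (simp add: trace_mult_wprod_dag)
  then have "adj Z = 0" using assms unfolding spans_def by blast
  then show "Z = 0" by simp
qed

lemma irr_dag: assumes "irr r A" shows "irr r (dag A)"
  unfolding irr_def
proof (intro allI impI)
  fix Z assume *: "\<forall>w. set w \<subseteq> {..<r} \<longrightarrow> trace (Z ** wprod (dag A) w) = 0"
  have "trace (adj Z ** wprod A w) = 0" if "set w \<subseteq> {..<r}" for w
    using *[rule_format, of "rev w"] that by (simp add: trace_mult_wprod_dag)
  then have "adj Z = 0" using assms unfolding irr_def by blast
  then show "Z = 0" by simp
qed

text \<open>A word one letter longer ends in some \<open>A i\<close>, which the cyclic trace moves
  onto \<open>Z\<close>. If \<open>Z\<close> annihilates the longer words, all
  \<open>A i ** Z\<close> vanish, and multiplying by the adjoints and summing gives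
  \<open>Z = 0\<close>.\<close>

lemma spans_Suc:
  assumes "spans r N m A" and g: "gram r A = mat 1" shows "spans r (Suc N) m A"
  unfolding spans_def
proof (intro allI impI)
  fix Z assume *: "\<forall>w. set w \<subseteq> {..<r} \<and> Suc N \<le> length w \<and> length w < Suc N + m \<longrightarrow> trace (Z ** wprod A w) = 0"
  have "A i ** Z = 0" if "i < r" for i
  proof -
    have "trace ((A i ** Z) ** wprod A w) = 0" if w: "set w \<subseteq> {..<r}" "N \<le> length w" "length w < N + m" for w
    proof -
      have "trace ((A i ** Z) ** wprod A w) = trace (Z ** wprod A (w @ [i]))"
        by (simp add: wprod_append) (metis mat_assoc trace_mul_sym)
      also have "\<dots> = 0" using * w \<open>i < r\<close> by simp
      finally show ?thesis .
    qed
    then show ?thesis using assms(1) unfolding spans_def by blast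
  qed
  then have "gram r A ** Z = 0" by (simp add: gram_def mat_distribs mat_assoc)
  then show "Z = 0" using g by simp
qed

lemma spans_mono:
  assumes "spans r N m A" and g: "gram r A = mat 1" "N \<le> N'" shows "spans r N' m A"
  using assms(3) by (induction rule: dec_induct) (auto intro: assms spans_Suc)

text \<open>The Choi quadratic form of a linear map.\<close>
definition qform :: "('n::finite cmat \<Rightarrow> 'n cmat) \<Rightarrow> 'n cmat \<Rightarrow> complex" where
  "qform T Z = (\<Sum>a\<in>UNIV. \<Sum>b\<in>UNIV. \<Sum>c\<in>UNIV. \<Sum>d\<in>UNIV. Z $ a $ b * cnj (Z $ c $ d) * T (munit a c) $ b $ d)"

lemma conj_munit_nth: "(A ** munit a c ** adj A) $ b $ d = A $ b $ a * cnj (A $ d $ c)"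
proof -
  have 1: "(A ** munit a c) $ b $ k = (if k = c then A $ b $ a else 0)" for k
  proof -
    have "(A ** munit a c) $ b $ k = (\<Sum>l\<in>UNIV. if l = a then (if k = c then A $ b $ l else 0) else 0)"
      unfolding matrix_mult_nth munit_nth by (intro sum.cong) auto
    then show ?thesis by simp
  qed
  have "(A ** munit a c ** adj A) $ b $ d = (\<Sum>k\<in>UNIV. if k = c then A $ b $ a * cnj (A $ d $ k) else 0)"
    unfolding matrix_mult_nth[of "A ** munit a c"] 1 by (intro sum.cong) auto
  then show ?thesis by simp
qed

text \<open>The left side depends on the map alone, the right side on a Kraus tuple. Hence all Kraus
  tuples of a map have the same annihilator, and the form vanishes exactly there.\<close>

lemma qform_kraus:
  assumes "\<And>X. T X = (\<Sum>i\<in>I. B i ** X ** adj (B i))" and I: "finite I"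
  shows "qform T Z = of_real (\<Sum>i\<in>I. (cmod (trace (Z ** B i)))\<^sup>2)"
proof -
  have t: "trace (Z ** B i) * cnj (trace (Z ** B i)) =
     (\<Sum>a\<in>UNIV. \<Sum>b\<in>UNIV. \<Sum>c\<in>UNIV. \<Sum>d\<in>UNIV. Z $ a $ b * cnj (Z $ c $ d) * (B i ** munit a c ** adj (B i)) $ b $ d)" for i
  proof -
    define f where "f a b = Z $ a $ b * B i $ b $ a" for a b
    define g where "g = (\<Sum>c\<in>UNIV. \<Sum>d\<in>UNIV. cnj (f c d))"
    have "trace (Z ** B i) * cnj (trace (Z ** B i)) = (\<Sum>a\<in>UNIV. \<Sum>b\<in>UNIV. f a b) * g"
      unfolding trace_mult_eq f_def g_def by (simp only: cnj_sum)
    also have "\<dots> = (\<Sum>a\<in>UNIV. \<Sum>b\<in>UNIV. f a b * g)" by (simp only: sum_distrib_right)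
    also have "\<dots> = (\<Sum>a\<in>UNIV. \<Sum>b\<in>UNIV. \<Sum>c\<in>UNIV. \<Sum>d\<in>UNIV. f a b * cnj (f c d))"
      unfolding g_def by (simp only: sum_distrib_left)
    finally show ?thesis unfolding conj_munit_nth by (simp add: f_def mult_ac)
  qed
  have "of_real (\<Sum>i\<in>I. (cmod (trace (Z ** B i)))\<^sup>2) = (\<Sum>i\<in>I. trace (Z ** B i) * cnj (trace (Z ** B i)))"
    by (simp only: complex_norm_square of_real_sum)
  also have "\<dots> = qform T Z"
    unfolding qform_def assms(1) t sum_component sum_distrib_left
    by (subst sum.swap, intro sum.cong refl)+
  finally show ?thesis by simp
qed

subsection \<open>Annihilators and Kraus rank\<close>

text \<open>Vectorisation indexed by pairs: a family of \<open>D^2\<close> matrices, itself indexed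
  by pairs, becomes a square matrix, and spanning becomes a nonzero determinant.\<close>

definition flat :: "'n::finite cmat \<Rightarrow> complex^('n \<times> 'n)" where
  "flat A = (\<chi> p. A $ fst p $ snd p)"

definition unflat :: "complex^('n \<times> 'n) \<Rightarrow> 'n::finite cmat" where
  "unflat v = (\<chi> i j. v $ (i, j))"

lemma unflat_flat [simp]: "unflat (flat A) = A" by (simp add: flat_def unflat_def cmat_eq_iff)
lemma flat_unflat [simp]: "flat (unflat v) = v" by (simp add: flat_def unflat_def vec_eq_iff)
lemma flat_inject [simp]: "flat A = flat B \<longleftrightarrow> A = B" by (metis unflat_flat)
lemma flat_sum: "flat (sum f S) = (\<Sum>i\<in>S. flat (f i))"
  by (simp add: flat_def vec_eq_iff)
lemma flat_smul: "flat (smul c A) = c *s flat A"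
  by (simp add: flat_def vec_eq_iff)
lemma flat_eq_0_iff [simp]: "flat A = 0 \<longleftrightarrow> A = 0"
  by (auto simp: flat_def vec_eq_iff)

lemma sum_flat: "(\<Sum>p\<in>UNIV. flat A $ p * flat B $ p) = (\<Sum>i\<in>UNIV. \<Sum>j\<in>UNIV. A $ i $ j * B $ i $ j)"
  unfolding flat_def by (simp add: sum.cartesian_product UNIV_Times_UNIV[symmetric] case_prod_unfold del: UNIV_Times_UNIV)

lemma trace_transpose_mult: "trace (transpose Z ** A) = (\<Sum>p\<in>UNIV. flat Z $ p * flat A $ p)"
  unfolding sum_flat trace_mult_eq transpose_def by (simp, rule sum.swap)

text \<open>The orthogonal decomposition is taken over the reals. A complex span is closed under
  multiplication by \<open>\<i>\<close>, so a vector that is real-orthogonal to it is also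
  orthogonal for \<open>cip\<close>.\<close>

lemma annihilator:
  fixes x :: "complex^'N::finite"
  assumes x: "x \<notin> vec.span S"
  obtains z where "\<And>s. s \<in> S \<Longrightarrow> (\<Sum>p\<in>UNIV. z $ p * s $ p) = 0" "(\<Sum>p\<in>UNIV. z $ p * x $ p) \<noteq> 0"
proof -
  define V where "V = vec.span S"
  have scl: "c *\<^sub>R v = complex_of_real c *s v" for c and v :: "complex^'N"
    by (simp add: vec_eq_iff) (simp add: scaleR_conv_of_real)
  have V: "subspace V"
    unfolding subspace_def V_def scl by (auto intro: vec.span_zero vec.span_add vec.span_scale)
  obtain y z where y: "y \<in> span V" and z: "\<And>w. w \<in> span V \<Longrightarrow> orthogonal z w" and xyz: "x = y + z"
    using orthogonal_subspace_decomp_exists[of V x] by metis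
  have VV: "span V = V" using V by (simp add: span_eq_iff)
  have re: "Re (cip z w) = 0" if "w \<in> V" for w
    using z[of w] that VV by (simp add: Re_cip_eq_inner orthogonal_def)
  have zw: "cip z w = 0" if "w \<in> V" for w
  proof -
    have "\<i> *s w \<in> V" using that unfolding V_def by (rule vec.span_scale)
    then have "Re (\<i> * cip z w) = 0" using re by (metis cip_smult_right)
    then show ?thesis using re[OF that] by (simp add: complex_eq_iff)
  qed
  have yV: "y \<in> V" using y VV by blast
  have "z \<noteq> 0" using x yV xyz unfolding V_def by auto
  \<comment> \<open>The pairing in the claim is bilinear while \<open>cip\<close> is sesquilinear,
    hence the conjugated witness.\<close>
  show thesis
  proof (rule that[of "\<chi> p. cnj (z $ p)"])
    fix s assume "s \<in> S"
    then have "cip z s = 0" by (intro zw) (simp add: V_def vec.span_base)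
    then show "(\<Sum>p\<in>UNIV. (\<chi> p. cnj (z $ p)) $ p * s $ p) = 0" by (simp add: cip_def)
  next
    have "cip z x = cip z z" using zw[of y] y VV by (simp add: xyz cip_add_right)
    then have "cip z x \<noteq> 0" using \<open>z \<noteq> 0\<close> by (simp only: cip_self_eq_0 not_False_eq_True)
    then show "(\<Sum>p\<in>UNIV. (\<chi> p. cnj (z $ p)) $ p * x $ p) \<noteq> 0" by (simp add: cip_def)
  qed
qed

definition kindep :: "nat \<Rightarrow> (nat \<Rightarrow> 'n::finite cmat) \<Rightarrow> bool" where
  "kindep r A \<longleftrightarrow> (\<forall>c. (\<Sum>i<r. smul (c i) (A i)) = 0 \<longrightarrow> (\<forall>i<r. c i = 0))"

lemma kindep_flat:
  assumes "kindep r A"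
  shows "inj_on (\<lambda>i. flat (A i)) {..<r}" "vec.independent ((\<lambda>i. flat (A i)) ` {..<r})"
proof -
  show inj: "inj_on (\<lambda>i. flat (A i)) {..<r}"
  proof (rule inj_onI, rule ccontr)
    fix i j assume ij: "i \<in> {..<r}" "j \<in> {..<r}" "flat (A i) = flat (A j)" "i \<noteq> j"
    define c :: "nat \<Rightarrow> complex" where "c k = (if k = i then 1 else if k = j then -1 else 0)" for k
    have "(\<Sum>k<r. smul (c k) (A k)) = (\<Sum>k\<in>{i, j}. smul (c k) (A k))"
      by (rule sum.mono_neutral_right) (use ij in \<open>auto simp: c_def\<close>)
    also have "\<dots> = 0" using ij by (simp add: c_def smul_minus_left)
    finally have "c i = 0" using assms ij unfolding kindep_def by auto
    then show False by (simp add: c_def)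
  qed
  show "vec.independent ((\<lambda>i. flat (A i)) ` {..<r})"
  proof (rule vec.independent_if_scalars_zero)
    fix f x assume s: "(\<Sum>x\<in>(\<lambda>i. flat (A i)) ` {..<r}. f x *s x) = 0" and x: "x \<in> (\<lambda>i. flat (A i)) ` {..<r}"
    have "flat (\<Sum>i<r. smul (f (flat (A i))) (A i)) = 0"
      using s by (simp add: sum.reindex[OF inj] flat_sum flat_smul)
    then have "(\<Sum>i<r. smul (f (flat (A i))) (A i)) = 0" by simp
    then show "f x = 0" using assms x unfolding kindep_def by auto
  qed simp
qed

text \<open>A dependent operator \<open>C\<close>, a combination of the others with coefficients
  \<open>a i\<close>, can be absorbed: adding a multiple of \<open>cnj (a i)\<close> times
  \<open>C\<close> to each \<open>A i\<close> reproduces the term of \<open>C\<close>, and the tuple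
  gets shorter.\<close>

lemma kraus_rank_eq_imp_kindep:
  assumes "kraus_rank (kmap r A) = r" shows "kindep r A"
  unfolding kindep_def
proof (intro allI impI)
  fix c k assume c: "(\<Sum>i<r. smul (c i) (A i)) = 0" and k: "k < r"
  show "c k = 0"
  proof (rule ccontr)
    assume ck: "c k \<noteq> 0"
    define I where "I = {..<r} - {k}"
    define a where "a i = - c i / c k" for i
    define C where "C = A k"
    have fin: "finite I" and split: "(\<Sum>i<r. f i) = f k + (\<Sum>i\<in>I. f i)" for f :: "nat \<Rightarrow> 'a cmat"
      unfolding I_def using k by (auto simp: sum.remove)
    have "smul (1 / c k) (smul (c k) C + (\<Sum>i\<in>I. smul (c i) (A i))) = 0"
      using c unfolding split C_def by simp
    then have "C + (\<Sum>i\<in>I. smul (c i / c k) (A i)) = 0"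
      using ck by (simp add: smul_add_right smul_sum_right)
    then have "C = - (\<Sum>i\<in>I. smul (c i / c k) (A i))" by (simp only: eq_neg_iff_add_eq_0)
    then have Ca: "(\<Sum>i\<in>I. smul (a i) (A i)) = C"
      by (simp add: a_def smul_minus_left sum_negf)
    define n where "n = (\<Sum>i\<in>I. (cmod (a i))\<^sup>2)"
    \<comment> \<open>The two cross terms contribute \<open>2 s\<close> and the square term
      \<open>s^2 n\<close> copies of the term of \<open>C\<close>, so \<open>n s^2 + 2 s = 1\<close>
      is required. The positive root is written so that \<open>n = 0\<close> is included.\<close>
    define s where "s = 1 / (1 + sqrt (1 + n))"
    have n0: "n \<ge> 0" unfolding n_def by (rule sum_nonneg) simp
    have s: "2 * s + s\<^sup>2 * n = 1"
    proof -
      define q where "q = sqrt (1 + n)"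
      have q: "q * q = 1 + n" "q \<ge> 1" using n0 by (auto simp: q_def)
      have "2 / (1 + q) + (1 / (1 + q))\<^sup>2 * (q * q - 1) = 1"
        using q(2) by (simp add: power2_eq_square divide_simps) (simp add: algebra_simps)
      then show ?thesis using q(1) by (simp add: s_def q_def[symmetric])
    qed
    define B where "B i = A i + smul (of_real s * cnj (a i)) C" for i
    have CaX: "(\<Sum>i\<in>I. smul (a i) (A i ** Y)) = C ** Y" for Y
      unfolding Ca[symmetric] by (simp add: mat_distribs)
    have Cadj: "(\<Sum>i\<in>I. smul (cnj (a i)) (adj (A i))) = adj C"
      unfolding Ca[symmetric] by (simp add: adj_distribs)
    have CaY: "(\<Sum>i\<in>I. smul (cnj (a i)) (Y ** adj (A i))) = Y ** adj C" for Y
      unfolding Cadj[symmetric] by (simp add: mat_distribs)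
    have eq: "kmap r A X = (\<Sum>i\<in>I. B i ** X ** adj (B i))" for X
    proof -
      have "(\<Sum>i\<in>I. B i ** X ** adj (B i)) = (\<Sum>i\<in>I. A i ** X ** adj (A i))
         + smul (of_real s) (\<Sum>i\<in>I. smul (a i) (A i ** (X ** adj C)))
         + smul (of_real s) (\<Sum>i\<in>I. smul (cnj (a i)) (C ** X ** adj (A i)))
         + (\<Sum>i\<in>I. smul (of_real (s\<^sup>2) * (cnj (a i) * a i)) (C ** X ** adj C))"
        unfolding smul_sum_right sum.distrib[symmetric] B_def
        by (intro sum.cong refl)
           (simp add: adj_distribs mat_distribs mat_assoc smul_add_right power2_eq_square algebra_simps)
      also have "\<dots> = (\<Sum>i\<in>I. A i ** X ** adj (A i)) + smul (of_real (2 * s + s\<^sup>2 * n)) (C ** X ** adj C)"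
        unfolding CaX CaY cnj_mult_self of_real_mult[symmetric] smul_sum_left[symmetric] of_real_sum[symmetric] sum_distrib_left[symmetric] n_def[symmetric]
        by (simp add: smul_add_left mat_assoc) (simp only: mult_2 smul_add_left)
      also have "\<dots> = kmap r A X" unfolding s kmap_def split C_def by simp
      finally show ?thesis by simp
    qed
    obtain h where h: "bij_betw h {0..<card I} I" using ex_bij_betw_nat_finite[OF fin] by blast
    have "kmap r A = kmap (card I) (B \<circ> h)"
      unfolding fun_eq_iff eq unfolding kmap_def o_def
      using sum.reindex_bij_betw[OF h, of "\<lambda>i. B i ** _ ** adj (B i)"] by (simp add: atLeast0LessThan)
    then have "kraus_rank (kmap r A) \<le> card I"
      unfolding kraus_rank_def kmap_eq_kraus_map[of "card I"]
      by (intro Least_le) (metis length_map length_upt minus_nat.diff_0)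
    also have "card I < r" using k by (simp add: I_def)
    finally show False using assms by simp
  qed
qed

text \<open>Equal Choi forms give equal annihilators, so an independent tuple lies in the span of
  any other Kraus tuple of the same map and cannot be longer.\<close>

lemma kindep_imp_kraus_rank:
  assumes "kindep r A" shows "kraus_rank (kmap r A) = r"
  unfolding kraus_rank_def
proof (rule Least_equality)
  show "\<exists>As. length As = r \<and> kmap r A = kraus_map As"
    unfolding kmap_eq_kraus_map by (rule exI[of _ "map A [0..<r]"]) simp
  fix r' assume "\<exists>As. length As = r' \<and> kmap r A = kraus_map As"
  then obtain B where B: "kmap r A = kmap r' B" using kraus_map_eq_kmap by metis
  have q: "(\<Sum>i<r. (cmod (trace (Z ** A i)))\<^sup>2) = (\<Sum>i<r'. (cmod (trace (Z ** B i)))\<^sup>2)" for Z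
  proof -
    have "qform (kmap r A) Z = of_real (\<Sum>i<r. (cmod (trace (Z ** A i)))\<^sup>2)"
      by (rule qform_kraus) (simp_all add: kmap_def)
    moreover have "qform (kmap r A) Z = of_real (\<Sum>i<r'. (cmod (trace (Z ** B i)))\<^sup>2)"
      by (rule qform_kraus) (simp_all add: B kmap_def)
    ultimately show ?thesis by (simp only: of_real_eq_iff)
  qed
  have "(\<lambda>i. flat (A i)) ` {..<r} \<subseteq> vec.span ((\<lambda>i. flat (B i)) ` {..<r'})"
  proof (rule ccontr)
    assume "\<not> ?thesis"
    then obtain i where i: "i < r" "flat (A i) \<notin> vec.span ((\<lambda>i. flat (B i)) ` {..<r'})" by auto
    from annihilator[OF i(2)] obtain z where z: "\<And>s. s \<in> (\<lambda>i. flat (B i)) ` {..<r'} \<Longrightarrow> (\<Sum>p\<in>UNIV. z $ p * s $ p) = 0"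
      "(\<Sum>p\<in>UNIV. z $ p * flat (A i) $ p) \<noteq> 0" by blast
    define Z where "Z = transpose (unflat z)"
    have tr: "trace (Z ** M) = (\<Sum>p\<in>UNIV. z $ p * flat M $ p)" for M
      unfolding Z_def trace_transpose_mult by simp
    have "(\<Sum>i<r'. (cmod (trace (Z ** B i)))\<^sup>2) = 0"
      by (intro sum.neutral) (auto simp: tr z(1))
    then have "(\<Sum>i<r. (cmod (trace (Z ** A i)))\<^sup>2) = 0" by (simp add: q)
    then have "trace (Z ** A i) = 0" using i(1) by (simp add: sum_nonneg_eq_0_iff)
    then show False using z(2) by (simp add: tr)
  qed
  then have "card ((\<lambda>i. flat (A i)) ` {..<r}) \<le> card ((\<lambda>i. flat (B i)) ` {..<r'})"
    using vec.independent_span_bound[OF _ kindep_flat(2)[OF assms]] by blast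
  also have "\<dots> \<le> r'" using card_image_le[of "{..<r'}"] by (metis card_lessThan finite_lessThan)
  finally show "r \<le> r'" by (simp add: card_image kindep_flat(1)[OF assms])
qed

subsection \<open>Perron--Frobenius theory for irreducible Kraus tuples\<close>

lemma kmap_form: "Re (cip v (kmap r A X *v v)) = (\<Sum>i<r. Re (cip (adj (A i) *v v) (X *v (adj (A i) *v v))))"
  by (simp add: kmap_def sum_mv cip_sum_right cip_conj_form)

text \<open>The kernel of \<open>X\<close> is invariant under the adjoints of all words. A nonzero
  kernel vector \<open>v\<close> and a vector \<open>X *v u\<close> outside zero would give a
  rank-one matrix annihilating every word.\<close>

lemma psd_eigen_pos_def:
  assumes irr: "irr r A" and X: "psd X" "X \<noteq> 0" and eig: "kmap r A X = smul \<rho> X"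
  shows "pos_def X"
  unfolding pos_def_cip
proof (intro conjI allI impI)
  show "adj X = X" by (rule psdD(1)[OF X(1)])
  fix v :: "complex^'a" assume "v \<noteq> 0"
  show "0 < Re (cip v (X *v v))"
  proof (rule ccontr)
    assume "\<not> ?thesis"
    then have "Re (cip v (X *v v)) = 0" using psdD(2)[OF X(1), of v] by linarith
    then have v: "X *v v = 0" by (rule psd_kernel[OF X(1)])
    have step: "X *v (adj (A i) *v y) = 0" if y: "X *v y = 0" and i: "i < r" for y i
    proof -
      have "(\<Sum>i<r. Re (cip (adj (A i) *v y) (X *v (adj (A i) *v y)))) = 0"
        using kmap_form[of y r A X] by (simp add: eig smul_mv y)
      then have "Re (cip (adj (A i) *v y) (X *v (adj (A i) *v y))) = 0"
        using i psdD(2)[OF X(1)] by (simp add: sum_nonneg_eq_0_iff)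
      then show ?thesis by (rule psd_kernel[OF X(1)])
    qed
    have words: "X *v (adj (wprod A w) *v y) = 0" if "X *v y = 0" "set w \<subseteq> {..<r}" for w y
      using that
    proof (induction w arbitrary: y)
      case (Cons i w)
      then show ?case using step[of y i]
        by (simp add: adj_mult matrix_vector_mul_assoc[symmetric])
    qed simp
    obtain u where u: "X *v u \<noteq> 0" using X(2) cmat_eqI[of X 0] by auto
    have "trace (outer (X *v u) v ** wprod A w) = 0" if w: "set w \<subseteq> {..<r}" for w
    proof -
      have "trace (outer (X *v u) v ** wprod A w) = cip v (wprod A w *v (X *v u))"
        by (subst trace_mul_sym) (rule trace_mult_outer)
      also have "\<dots> = cip (X *v (adj (wprod A w) *v v)) u"
        by (metis cip_adj psdD(1)[OF X(1)])
      finally show ?thesis using words[OF v w] by simp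
    qed
    then have "outer (X *v u) v = 0" using irr unfolding irr_def by blast
    then show False using u \<open>v \<noteq> 0\<close> by (simp add: outer_eq_0_iff)
  qed
qed

lemma pos_def_nonzero: "pos_def (X::'n::finite cmat) \<Longrightarrow> X \<noteq> 0"
proof
  assume "pos_def X" "X = 0"
  moreover have "axis (undefined::'n) (1::complex) \<noteq> 0" by (simp add: axis_eq_0_iff)
  ultimately show False unfolding pos_def_cip by force
qed

lemma pos_def_zero_form: "pos_def X \<Longrightarrow> Re (cip v (X *v v)) = 0 \<Longrightarrow> v = 0"
  unfolding pos_def_cip by force

text \<open>Compare \<open>X\<close> with the largest multiple \<open>c Y\<close> below it,
  \<open>c\<close> being the minimum of the quotient of the two forms. The difference
  \<open>Z\<close> is semidefinite with a kernel vector \<open>v0\<close>; applying the map and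
  testing at \<open>v0\<close> forces \<open>a = b\<close>, and then \<open>Z\<close> is a
  semidefinite eigenvector that is not definite, hence zero.\<close>

lemma perron_unique_aux:
  assumes irr: "irr r A" and X: "psd X" "trace X = 1" "kmap r A X = smul (of_real a) X"
    and Y: "psd Y" "trace Y = 1" "kmap r A Y = smul (of_real b) Y" and ab: "a \<le> b"
  shows "X = Y"
proof -
  have pX: "pos_def X" by (rule psd_eigen_pos_def[OF irr X(1) _ X(3)]) (use X(2) in auto)
  have pY: "pos_def Y" by (rule psd_eigen_pos_def[OF irr Y(1) _ Y(3)]) (use Y(2) in auto)
  define f where "f v = Re (cip v (X *v v)) / Re (cip v (Y *v v))" for v
  have Ypos: "Re (cip v (Y *v v)) > 0" if "v \<noteq> 0" for v using pY that by (simp add: pos_def_cip)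
  have Xpos: "Re (cip v (X *v v)) > 0" if "v \<noteq> 0" for v using pX that by (simp add: pos_def_cip)
  have "\<exists>v0\<in>sphere 0 1. \<forall>v\<in>sphere 0 1. f v0 \<le> f v"
  proof (rule continuous_attains_inf)
    have nz: "Re (cip v (Y *v v)) \<noteq> 0" if "v \<in> sphere 0 1" for v
      using Ypos[of v] that by (cases "v = 0") auto
    show "continuous_on (sphere 0 1) f"
      unfolding f_def using nz by (auto intro!: continuous_intros)
  qed simp_all
  then obtain v0 where v0: "norm v0 = 1" and min: "\<And>v. norm v = 1 \<Longrightarrow> f v0 \<le> f v" by auto
  define c where "c = f v0"
  have v00: "v0 \<noteq> 0" using v0 by auto
  have c0: "c > 0" using Xpos[OF v00] Ypos[OF v00] by (simp add: c_def f_def)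
  define Z where "Z = X - c *\<^sub>R Y"
  have Zf: "Re (cip v (Z *v v)) = Re (cip v (X *v v)) - c * Re (cip v (Y *v v))" for v
    by (simp add: Z_def matrix_vector_mult_diff_rdistrib scaleR_mv cip_diff_right cip_scaleR_right)
  have Z0: "Re (cip v0 (Z *v v0)) = 0"
    unfolding Zf c_def f_def using Ypos[OF v00] by simp
  have pZ: "psd Z"
    unfolding psd_def
  proof (intro conjI allI)
    show "adj Z = Z" by (simp add: Z_def adj_distribs psdD(1)[OF X(1)] psdD(1)[OF Y(1)])
    fix v
    show "0 \<le> Re (cip v (Z *v v))"
    proof (cases "v = 0")
      case False
      define y where "y = complex_of_real (1 / norm v) *s v"
      have "norm y = 1" using False by (simp add: y_def norm_vsmult norm_divide)
      then have "c \<le> f y" unfolding c_def by (rule min)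
      also have "f y = f v"
        using False by (simp add: f_def y_def mv_smult cip_smult_left cip_smult_right divide_simps)
      finally show ?thesis unfolding Zf using Ypos[OF False] by (simp add: f_def pos_le_divide_eq)
    qed simp
  qed
  have kZ: "kmap r A Z = a *\<^sub>R X - (c * b) *\<^sub>R Y"
    by (simp add: Z_def kmap_diff kmap_scaleR X(3) Y(3) smul_of_real)
  have "0 \<le> Re (cip v0 (kmap r A Z *v v0))" by (rule psdD(2)[OF psd_kmap[OF pZ]])
  also have "\<dots> = a * Re (cip v0 (X *v v0)) - c * b * Re (cip v0 (Y *v v0))"
    by (simp add: kZ matrix_vector_mult_diff_rdistrib scaleR_mv cip_diff_right cip_scaleR_right)
  also have "Re (cip v0 (X *v v0)) = c * Re (cip v0 (Y *v v0))" using Z0 Zf by simp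
  also have "a * (c * Re (cip v0 (Y *v v0))) - c * b * Re (cip v0 (Y *v v0))
      = (a - b) * (c * Re (cip v0 (Y *v v0)))"
    by (simp add: algebra_simps)
  finally have K: "0 \<le> (a - b) * (c * Re (cip v0 (Y *v v0)))" .
  have "0 < c * Re (cip v0 (Y *v v0))" using c0 Ypos[OF v00] by simp
  then have "a \<ge> b" using K by (metis diff_ge_0_iff_ge zero_le_mult_iff not_less less_le)
  then have ab': "a = b" using ab by simp
  have "Z = 0"
  proof (rule ccontr)
    assume "Z \<noteq> 0"
    moreover have "kmap r A Z = smul (of_real a) Z"
      unfolding kZ ab' by (simp add: Z_def smul_of_real scaleR_diff_right mult.commute)
    ultimately have "pos_def Z" using psd_eigen_pos_def[OF irr pZ] by blast
    then show False using pos_def_zero_form[OF _ Z0] v00 by blast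
  qed
  then have XY: "X = c *\<^sub>R Y" by (simp add: Z_def)
  then have "1 = of_real c * (1::complex)" using X(2) Y(2) by (metis trace_scaleR scaleR_conv_of_real)
  then have "c = 1" by (metis mult.right_neutral of_real_eq_1_iff)
  then show ?thesis using XY by simp
qed

text \<open>Taking traces shows both eigenvalues to be real, so they can be put in order.\<close>

lemma perron_unique:
  assumes irr: "irr r A" and X: "psd X" "trace X = 1" "kmap r A X = smul \<rho> X"
    and Y: "psd Y" "trace Y = 1" "kmap r A Y = smul \<rho>' Y"
  shows "X = Y"
proof -
  have "\<rho> = trace (kmap r A X)" "\<rho>' = trace (kmap r A Y)"
    by (simp_all add: X Y trace_smul)
  then obtain a b where "\<rho> = of_real a" "\<rho>' = of_real b"
    using trace_psd(1)[OF psd_kmap[OF X(1)]] trace_psd(1)[OF psd_kmap[OF Y(1)]] by metis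
  then show ?thesis
    using perron_unique_aux[OF irr] X Y by (metis linear)
qed

lemma trace_scaleR_of_real: "trace (c *\<^sub>R (X::'n::finite cmat)) = of_real c * trace X"
  unfolding trace_scaleR by (rule scaleR_conv_of_real)

definition dens_mats :: "'n::finite cmat set" where
  "dens_mats = {X. psd X \<and> trace X = 1}"

lemma closed_psd: "closed {X::'n::finite cmat. psd X}"
proof -
  have "{X::'n cmat. psd X} = {X. adj X = X} \<inter> (\<Inter>v. {X. 0 \<le> Re (cip v (X *v v))})"
    by (auto simp: psd_def)
  moreover have "closed {X::'n cmat. adj X = X}"
    by (intro closed_Collect_eq continuous_intros)
  moreover have "closed {X::'n cmat. 0 \<le> Re (cip v (X *v v))}" for v
    by (intro closed_Collect_le continuous_intros)
  ultimately show ?thesis by (auto intro!: closed_Int closed_INT)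
qed

lemma norm_cmat_le_sum: "norm (X::'n::finite cmat) \<le> (\<Sum>i\<in>UNIV. \<Sum>j\<in>UNIV. cmod (X $ i $ j))"
proof -
  have "norm X \<le> (\<Sum>i\<in>UNIV. norm (X $ i))" unfolding norm_vec_def[of X] by (rule L2_set_le_sum) simp
  also have "\<dots> \<le> (\<Sum>i\<in>UNIV. \<Sum>j\<in>UNIV. cmod (X $ i $ j))" by (intro sum_mono norm_vec_le_sum)
  finally show ?thesis .
qed

lemma compact_dens_mats: "compact (dens_mats :: 'n::finite cmat set)"
  unfolding compact_eq_bounded_closed
proof
  have "norm X \<le> (\<Sum>i\<in>(UNIV::'n set). \<Sum>j\<in>(UNIV::'n set). 1)" if "X \<in> dens_mats" for X :: "'n cmat"
    by (rule order_trans[OF norm_cmat_le_sum], intro sum_mono)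
       (use psd_entry_bound[of X] that in \<open>auto simp: dens_mats_def\<close>)
  then show "bounded (dens_mats :: 'n cmat set)" by (rule boundedI)
  have "dens_mats = {X::'n cmat. psd X} \<inter> {X. trace X = 1}" by (auto simp: dens_mats_def)
  moreover have "closed {X::'n cmat. trace X = 1}" by (intro closed_Collect_eq continuous_intros)
  ultimately show "closed (dens_mats :: 'n cmat set)" by (metis closed_Int closed_psd)
qed

lemma convex_dens_mats: "convex (dens_mats :: 'n::finite cmat set)"
  by (rule convexI)
     (auto simp: dens_mats_def psd_add psd_scaleR trace_add trace_scaleR_of_real simp flip: of_real_add)

lemma dens_mats_nonempty: "(dens_mats :: 'n::finite cmat set) \<noteq> {}"
proof -
  have "(1 / real CARD('n)) *\<^sub>R mat 1 \<in> (dens_mats :: 'n cmat set)"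
    by (simp add: dens_mats_def psd_scaleR trace_scaleR_of_real trace_I)
  then show ?thesis by blast
qed

lemma continuous_on_kmap: "continuous_on S (kmap r A)"
  unfolding kmap_def by (intro continuous_intros)

text \<open>A semidefinite \<open>X\<close> sent to zero would be an eigenvector for 0, hence
  definite by irreducibility, and then every \<open>adj (A i)\<close> must vanish.\<close>

lemma trace_kmap_nonzero:
  assumes irr: "irr r A" and nz: "\<exists>i<r. A i \<noteq> 0" and X: "psd X" "X \<noteq> 0"
  shows "trace (kmap r A X) \<noteq> 0"
proof
  assume "trace (kmap r A X) = 0"
  then have k0: "kmap r A X = 0" by (rule psd_trace_0[OF psd_kmap[OF X(1)]])
  then have pX: "pos_def X" using psd_eigen_pos_def[OF irr X, of 0] by simp
  have "A i = 0" if "i < r" for i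
  proof -
    have "adj (A i) *v v = 0" for v
    proof -
      have "(\<Sum>i<r. Re (cip (adj (A i) *v v) (X *v (adj (A i) *v v)))) = 0"
        using kmap_form[of v r A X] by (simp add: k0)
      then have "Re (cip (adj (A i) *v v) (X *v (adj (A i) *v v))) = 0"
        using that psdD(2)[OF X(1)] by (simp add: sum_nonneg_eq_0_iff)
      then show ?thesis by (rule pos_def_zero_form[OF pX])
    qed
    then have "adj (A i) = 0" by (intro cmat_eqI) simp
    then show ?thesis by simp
  qed
  then show False using nz by blast
qed

text \<open>Brouwer's theorem for the trace-normalised map on density matrices, where the
  denominator is nonzero by \<open>trace_kmap_nonzero\<close>.\<close>

lemma perron_exists:
  fixes A :: "nat \<Rightarrow> 'n::finite cmat"
  assumes irr: "irr r A" and nz: "\<exists>i<r. A i \<noteq> 0"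
  obtains X where "X \<in> dens_mats" "kmap r A X = smul (trace (kmap r A X)) X"
proof -
  define f where "f X = smul (1 / trace (kmap r A X)) (kmap r A X)" for X
  have d: "psd X" "X \<noteq> 0" if "X \<in> dens_mats" for X :: "'n cmat"
    using that by (auto simp: dens_mats_def)
  have tr: "trace (kmap r A X) \<noteq> 0" if "X \<in> dens_mats" for X
    using trace_kmap_nonzero[OF irr nz d[OF that]] .
  have "f X \<in> dens_mats" if X: "X \<in> dens_mats" for X
  proof -
    note p = psd_kmap[OF d(1)[OF X], of r A]
    have "f X = (1 / Re (trace (kmap r A X))) *\<^sub>R kmap r A X"
      unfolding f_def by (subst trace_psd(1)[OF p]) (simp add: smul_of_real[symmetric])
    then have "psd (f X)" using p trace_psd(2)[OF p] by (simp add: psd_scaleR)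
    then show ?thesis using tr[OF X] by (simp add: dens_mats_def f_def trace_smul)
  qed
  moreover have "continuous_on dens_mats f"
    unfolding f_def using tr by (auto intro!: continuous_intros continuous_on_kmap)
  ultimately obtain X where X: "X \<in> dens_mats" "f X = X"
    using brouwer[OF compact_dens_mats convex_dens_mats dens_mats_nonempty, of f] by blast
  have "kmap r A X = smul (trace (kmap r A X)) (f X)" using tr[OF X(1)] by (simp add: f_def)
  then show thesis using X that by simp
qed

lemma gram_one_nz: assumes "gram r A = mat 1" shows "\<exists>i<r. A i \<noteq> 0"
proof (rule ccontr)
  assume "\<not> ?thesis"
  then have "gram r A = 0" by (auto simp: gram_def intro!: sum.neutral)
  then show False using assms mat1_neq_0 by metis
qed

lemma tp_fixed_point:
  assumes irr: "irr r A" and g: "gram r A = mat 1"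
  obtains X where "pos_def X" "trace X = 1" "kmap r A X = X"
proof -
  obtain X where X: "X \<in> dens_mats" "kmap r A X = smul (trace (kmap r A X)) X"
    using perron_exists[OF irr gram_one_nz[OF g]] by blast
  have tr: "trace (kmap r A X) = 1" using X(1) by (simp add: trace_kmap g dens_mats_def)
  have "pos_def X" by (rule psd_eigen_pos_def[OF irr _ _ X(2)]) (use X(1) in \<open>auto simp: dens_mats_def\<close>)
  then show thesis using that X tr by (simp add: dens_mats_def)
qed

text \<open>Perron uniqueness settles semidefinite fixed points. A Hermitian one becomes
  semidefinite after adding a large multiple of \<open>X0\<close>, and a general one splits into
  Hermitian parts, which are again fixed.\<close>

lemma tp_fixed_unique:
  assumes irr: "irr r A" and g: "gram r A = mat 1"
    and X0: "pos_def X0" "trace X0 = 1" "kmap r A X0 = X0" and X: "kmap r A X = X"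
  shows "\<exists>c. X = smul c X0"
proof -
  have psd: "\<exists>c. W = smul c X0" if W: "psd W" "kmap r A W = W" for W
  proof (cases "W = 0")
    case True
    then show ?thesis by (intro exI[of _ 0]) simp
  next
    case False
    define t where "t = Re (trace W)"
    have t: "trace W = of_real t" using trace_psd(1)[OF W(1)] by (simp add: t_def)
    then have "t \<noteq> 0" using False psd_trace_0[OF W(1)] by auto
    then have t0: "t > 0" using trace_psd(2)[OF W(1)] by (simp add: t_def)
    have "(1 / t) *\<^sub>R W = X0"
    proof (rule perron_unique[OF irr _ _ _ pos_def_imp_psd[OF X0(1)] X0(2), of _ 1 1])
      show "psd ((1 / t) *\<^sub>R W)" using t0 W by (intro psd_scaleR) auto
      show "trace ((1 / t) *\<^sub>R W) = 1" using t0 by (simp add: trace_scaleR_of_real t)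
    qed (simp_all add: kmap_scaleR W X0)
    then have "W = smul (of_real t) X0" using t0 by (simp add: smul_of_real[of t] flip: \<open>(1 / t) *\<^sub>R W = X0\<close>)
    then show ?thesis by blast
  qed
  have herm: "\<exists>c. H = smul c X0" if H: "adj H = H" "kmap r A H = H" for H
  proof -
    obtain e where e: "e > 0" "\<And>v. e * (norm v)\<^sup>2 \<le> Re (cip v (X0 *v v))"
      using pos_def_bound[OF X0(1)] by blast
    define q where "q = (\<Sum>i\<in>UNIV. \<Sum>j\<in>UNIV. cmod (H $ i $ j))"
    have q0: "q \<ge> 0" unfolding q_def by (intro sum_nonneg) auto
    \<comment> \<open>\<open>q\<close> bounds the operator norm of \<open>H\<close> and
      \<open>e\<close> bounds \<open>X0\<close> from below, so this multiple of \<open>X0\<close>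
      outweighs \<open>H\<close>.\<close>
    define W where "W = H + (q / e) *\<^sub>R X0"
    have "psd W"
      unfolding psd_def
    proof (intro conjI allI)
      show "adj W = W" using H pos_def_imp_psd[OF X0(1)] by (simp add: W_def adj_distribs psdD)
      fix v
      have "\<bar>Re (cip v (H *v v))\<bar> \<le> norm v * norm (H *v v)" by (rule Re_cip_le)
      also have "\<dots> \<le> norm v * (q * norm v)"
        using opn_sum_nth[of H] by (intro mult_left_mono) (auto simp: opn_def q_def)
      finally have "- (q * (norm v)\<^sup>2) \<le> Re (cip v (H *v v))" by (simp add: power2_eq_square algebra_simps)
      moreover have "q * (norm v)\<^sup>2 \<le> q / e * Re (cip v (X0 *v v))"
        using mult_left_mono[OF e(2)[of v], of "q / e"] e(1) q0 by simp
      ultimately show "0 \<le> Re (cip v (W *v v))"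
        by (simp add: W_def matrix_vector_mult_add_rdistrib scaleR_mv cip_add_right cip_scaleR_right)
    qed
    moreover have "kmap r A W = W" by (simp add: W_def kmap_add kmap_scaleR H X0)
    ultimately obtain c where "W = smul c X0" using psd by blast
    then have "H = smul (c - of_real (q / e)) X0"
      unfolding W_def smul_diff_left smul_of_real by (simp add: algebra_simps)
    then show ?thesis by blast
  qed
  have aX: "kmap r A (adj X) = adj X" by (simp add: kmap_adj X)
  obtain c where c: "X + adj X = smul c X0"
    using herm[of "X + adj X"] by (auto simp: adj_distribs kmap_add X aX add.commute)
  obtain d where d: "smul \<i> (X - adj X) = smul d X0"
  proof -
    have "adj (smul \<i> (X - adj X)) = smul \<i> (X - adj X)"
      by (simp add: cmat_eq_iff algebra_simps)
    then show thesis using that herm[of "smul \<i> (X - adj X)"] by (auto simp: kmap_smul kmap_diff X aX)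
  qed
  have "X = smul (1/2) (X + adj X) + smul (- \<i> / 2) (smul \<i> (X - adj X))"
    by (simp add: cmat_eq_iff algebra_simps)
  also have "\<dots> = smul (c / 2 - \<i> * d / 2) X0"
    unfolding c d by (simp add: smul_add_left[symmetric])
  finally show ?thesis by blast
qed

subsection \<open>Peripheral eigenvectors\<close>

text \<open>The squared norm of the faithful invariant state \<open>X0\<close>.\<close>
definition nphi :: "'n::finite cmat \<Rightarrow> 'n cmat \<Rightarrow> real" where
  "nphi X0 Y = Re (trace (X0 ** (adj Y ** Y)))"

text \<open>A trace-preserving tuple with a faithful invariant state. The dual \<open>E\<close> is
  then unital and a contraction for the norm defined by \<open>X0\<close>.\<close>

locale tp_kraus =
  fixes r :: nat and A :: "nat \<Rightarrow> 'n::finite cmat" and X0 :: "'n cmat"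
  assumes gram: "gram r A = mat 1"
    and pd: "pos_def X0" and fixed: "kmap r A X0 = X0" and tr1: "trace X0 = 1"
begin

abbreviation "E \<equiv> kmap r (dag A)"

lemma psd_nphi: "psd (Y ** X0 ** adj Y)"
  by (intro psd_conj pos_def_imp_psd pd)

lemma nphi_eq: "nphi X0 Y = Re (trace (Y ** X0 ** adj Y))"
proof -
  have "trace (X0 ** (adj Y ** Y)) = trace (Y ** X0 ** adj Y)"
    by (metis mat_assoc trace_rotate)
  then show ?thesis by (simp add: nphi_def)
qed

lemma nphi_nonneg: "0 \<le> nphi X0 Y"
  unfolding nphi_eq by (rule trace_psd(2)[OF psd_nphi])

lemma nphi_eq_0: assumes "nphi X0 Y = 0" shows "Y = 0"
proof -
  have "trace (Y ** X0 ** adj Y) = 0"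
    using trace_psd(1)[OF psd_nphi[of Y]] assms by (simp add: nphi_eq)
  then have z: "Y ** X0 ** adj Y = 0" by (rule psd_trace_0[OF psd_nphi])
  have "adj Y *v v = 0" for v
    by (rule pos_def_zero_form[OF pd]) (use cip_conj_form[of v Y X0] in \<open>simp add: z\<close>)
  then have "adj Y = 0" by (intro cmat_eqI) simp
  then show ?thesis by simp
qed

lemma nphi_smul: "nphi X0 (smul c Y) = (cmod c)\<^sup>2 * nphi X0 Y"
proof -
  have "trace (X0 ** (adj (smul c Y) ** smul c Y)) = of_real ((cmod c)\<^sup>2) * trace (X0 ** (adj Y ** Y))"
    unfolding cnj_mult_self[symmetric] by (simp add: adj_smul mat_distribs trace_smul)
  then show ?thesis by (simp add: nphi_def del: of_real_power)
qed

lemma trace_X0_E: "trace (X0 ** E Y) = trace (X0 ** Y)"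
  by (metis fixed trace_kmap_dag trace_mul_sym)

text \<open>The Kadison-Schwarz inequality averaged over the invariant state, with its defect
  written out. Equality of the norms therefore gives the relations
  \<open>X ** A i = A i ** E X\<close>.\<close>

lemma schwarz_identity:
  "nphi X0 X = nphi X0 (E X) + (\<Sum>i<r. nphi X0 (X ** A i - A i ** E X))"
proof -
  define Y where "Y = E X"
  define D where "D i = X ** A i - A i ** Y" for i
  have D: "adj (D i) ** D i = adj (A i) ** (adj X ** X) ** A i - (adj (A i) ** adj X ** A i) ** Y
      - adj Y ** (adj (A i) ** X ** A i) + adj Y ** (adj (A i) ** A i) ** Y" for i
    by (simp add: D_def adj_distribs mat_distribs mat_assoc)
  have "(\<Sum>i<r. adj (D i) ** D i) = E (adj X ** X) - E (adj X) ** Y - adj Y ** E X + adj Y ** gram r A ** Y"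
    unfolding D kmap_dag_eq gram_def
    by (simp add: sum.distrib sum_subtractf matrix_mult_sum_left matrix_mult_sum_right)
  also have "\<dots> = E (adj X ** X) - adj Y ** Y"
    by (simp add: kmap_adj Y_def[symmetric] gram)
  finally have eq: "(\<Sum>i<r. adj (D i) ** D i) = E (adj X ** X) - adj Y ** Y" .
  have "(\<Sum>i<r. nphi X0 (D i)) = Re (trace (X0 ** (\<Sum>i<r. adj (D i) ** D i)))"
    by (simp add: nphi_def matrix_mult_sum_right trace_sum)
  also have "\<dots> = Re (trace (X0 ** (E (adj X ** X) - adj Y ** Y)))" by (simp only: eq)
  also have "\<dots> = nphi X0 X - nphi X0 Y"
    by (simp add: nphi_def mat_distribs trace_sub trace_X0_E)
  finally show ?thesis by (simp add: D_def Y_def)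
qed

lemma nphi_E_le: "nphi X0 (E X) \<le> nphi X0 X"
  using schwarz_identity[of X] sum_nonneg[of "{..<r}" "\<lambda>i. nphi X0 (X ** A i - A i ** E X)"] nphi_nonneg
  by simp

lemma nphi_E_eqD:
  assumes "nphi X0 (E X) = nphi X0 X" "i < r" shows "X ** A i = A i ** E X"
proof -
  have "(\<Sum>i<r. nphi X0 (X ** A i - A i ** E X)) = 0"
    using schwarz_identity[of X] assms(1) by simp
  then have "nphi X0 (X ** A i - A i ** E X) = 0"
    using assms(2) nphi_nonneg by (simp add: sum_nonneg_eq_0_iff)
  then show ?thesis using nphi_eq_0 by (metis eq_iff_diff_eq_0)
qed

lemma nphi_pos: "Y \<noteq> 0 \<Longrightarrow> 0 < nphi X0 Y"
  using nphi_nonneg[of Y] nphi_eq_0[of Y] by fastforce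

lemma eigen_modulus: assumes "E Y = smul l Y" "Y \<noteq> 0" shows "cmod l \<le> 1"
proof -
  have "(cmod l)\<^sup>2 * nphi X0 Y \<le> 1 * nphi X0 Y"
    using nphi_E_le[of Y] by (simp add: assms(1) nphi_smul)
  then have "(cmod l)\<^sup>2 \<le> 1" using nphi_pos[OF assms(2)] by simp
  then show ?thesis by (simp add: abs_square_le_1)
qed

text \<open>An eigenvalue of modulus 1 conserves \<open>nphi X0\<close>, so every defect in the
  Schwarz identity vanishes.\<close>

lemma eigen_intertwine:
  assumes "E Y = smul l Y" "cmod l = 1" "i < r" shows "Y ** A i = smul l (A i ** Y)"
  using nphi_E_eqD[of Y i] assms by (simp add: nphi_smul mat_distribs)

lemma intertwine_eigen:
  assumes "\<And>i. i < r \<Longrightarrow> Y ** A i = smul l (A i ** Y)" shows "E Y = smul l Y"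
proof -
  have "E Y = (\<Sum>i<r. smul l (adj (A i) ** A i ** Y))"
    unfolding kmap_dag_eq by (intro sum.cong refl) (simp add: mat_assoc assms mat_distribs)
  also have "\<dots> = smul l (gram r A ** Y)" by (simp add: gram_def mat_distribs smul_sum_right)
  finally show ?thesis by (simp add: gram)
qed

text \<open>Right multiplication by the invariant state carries peripheral eigenvectors of the dual
  to eigenvectors of the map; spectral data are moved between the two in this way.\<close>

lemma dual_transfer:
  assumes "\<And>i. i < r \<Longrightarrow> Y ** A i = smul l (A i ** Y)" "cmod l = 1"
  shows "kmap r A (Y ** X0) = smul (cnj l) (Y ** X0)"
proof -
  have "A i ** Y = smul (cnj l) (Y ** A i)" if "i < r" for i
    using assms that by (simp add: cnj_mult_self)
  then have "kmap r A (Y ** X0) = (\<Sum>i<r. smul (cnj l) (Y ** (A i ** X0 ** adj (A i))))"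
    unfolding kmap_def by (intro sum.cong refl) (metis (no_types, lifting) lessThan_iff mat_assoc smul_mult_left)
  also have "\<dots> = smul (cnj l) (Y ** kmap r A X0)" by (simp add: kmap_def mat_distribs smul_sum_right)
  finally show ?thesis by (simp add: fixed)
qed

lemma mult_X0_eq_0: assumes "Y ** X0 = 0" shows "Y = 0"
  using pos_def_invertible[OF pd] assms by (metis mat_assoc matrix_mul_rid times0_left)

end

lemma inner_cmat: "(Y::'n::finite cmat) \<bullet> W = Re (trace (adj Y ** W))"
  unfolding trace_mult_eq inner_vec_def inner_complex_def
  by (simp, subst sum.swap) simp

text \<open>In finite dimension a map that is not injective is not surjective, and a vector
  orthogonal to its range is an eigenvector of the adjoint. Orthogonality is real at first;
  multiplying by \<open>\<i>\<close> makes it complex.\<close>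

lemma dual_eigenvector:
  fixes A :: "nat \<Rightarrow> 'n::finite cmat"
  assumes "kmap r A Z = smul mu Z" "Z \<noteq> 0"
  obtains Y where "Y \<noteq> 0" "kmap r (dag A) Y = smul (cnj mu) Y"
proof -
  define L where "L X = kmap r A X - smul mu X" for X
  have lin: "linear L"
    by (rule linearI) (simp_all add: L_def kmap_add kmap_scaleR smul_add_right scaleR_diff_right,
       simp add: smul_of_real[symmetric] mult.commute)
  have "\<not> inj L" using assms linear_injective_0[OF lin] by (auto simp: L_def)
  then have "\<not> surj L" using linear_surjective_imp_injective[OF lin] by blast
  moreover have "span (range L) = range L"
    using linear_subspace_image[OF lin subspace_UNIV] by (simp add: span_eq_iff)
  ultimately have "span (range L) \<subset> span UNIV" by (metis psubsetI subset_UNIV span_UNIV)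
  from orthogonal_to_subspace_exists_gen[OF this] obtain Y where Y: "Y \<noteq> 0" "\<And>W. W \<in> span (range L) \<Longrightarrow> orthogonal Y W" by metis
  have re: "Re (trace (adj Y ** L X)) = 0" for X
    using Y(2)[of "L X"] by (simp add: span_base orthogonal_def inner_cmat)
  have tr: "trace (adj Y ** L X) = 0" for X
  proof -
    have "L (smul \<i> X) = smul \<i> (L X)" by (simp add: L_def kmap_smul smul_diff_right mult.commute)
    then have "Re (\<i> * trace (adj Y ** L X)) = 0"
      using re[of "smul \<i> X"] by (simp add: mat_distribs trace_smul)
    then show ?thesis using re[of X] by (simp add: complex_eq_iff)
  qed
  have "trace (adj (kmap r (dag A) Y - smul (cnj mu) Y) ** X) = 0" for X
    using tr[of X] trace_kmap_dag[of r A "adj Y" X]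
    by (simp add: L_def adj_distribs mat_distribs trace_sub trace_smul kmap_adj)
  then have "adj (kmap r (dag A) Y - smul (cnj mu) Y) = 0" by (rule trace_mult_eq_0_imp)
  then have "kmap r (dag A) Y = smul (cnj mu) Y" by simp
  then show thesis using that Y(1) by blast
qed

subsection \<open>Roots of unity and the cyclic structure\<close>

lemma beta_power: "beta m ^ j = exp (2 * of_real pi * \<i> * of_nat j / of_nat m)"
  unfolding beta_def exp_of_nat_mult[symmetric] by (simp add: field_simps)

lemma beta_power_eq_iff: assumes "0 < m" shows "beta m ^ j = beta m ^ k \<longleftrightarrow> j mod m = k mod m"
  unfolding beta_power using complex_root_unity_eq[of m j k] assms by (simp add: cong_def)

lemma beta_power_m: "0 < m \<Longrightarrow> beta m ^ m = 1"
  using beta_power_eq_iff[of m m 0] by simp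

lemma beta_power_eq_1: "0 < m \<Longrightarrow> beta m ^ n = 1 \<longleftrightarrow> m dvd n"
  using beta_power_eq_iff[of m n 0] by (simp add: dvd_eq_mod_eq_0)

lemma norm_beta: "cmod (beta m) = 1"
  by (simp add: beta_def)

lemma roots_unity_beta: assumes "0 < m" shows "{z. z ^ m = 1} = (\<lambda>j. beta m ^ j) ` {..<m}"
proof (rule card_subset_eq[symmetric])
  have m: "m \<ge> 1" using assms by simp
  show "finite {z::complex. z ^ m = 1}" using finite_roots_unity[OF m] .
  show "(\<lambda>j. beta m ^ j) ` {..<m} \<subseteq> {z. z ^ m = 1}"
    using assms by (auto simp: power_mult[symmetric] beta_power_eq_1)
  have "inj_on (\<lambda>j. beta m ^ j) {..<m}"
    using assms by (auto simp: inj_on_def beta_power_eq_iff)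
  then show "card ((\<lambda>j. beta m ^ j) ` {..<m}) = card {z::complex. z ^ m = 1}"
    using card_roots_unity_eq[of m] assms by (simp add: card_image)
qed

text \<open>For a trace-preserving tuple with faithful invariant state and \<open>l\<close> of
  modulus 1, this is equivalent to \<open>V\<close> satisfying the eigenvector equation of the dual
  for \<open>l\<close>, but it is multiplicative in \<open>V\<close> and linear in the
  tuple.\<close>

definition intertwines :: "nat \<Rightarrow> (nat \<Rightarrow> 'n::finite cmat) \<Rightarrow> complex \<Rightarrow> 'n cmat \<Rightarrow> bool" where
  "intertwines r A l V \<longleftrightarrow> (\<forall>i<r. V ** A i = smul l (A i ** V))"

lemma intertwines_wprod:
  assumes "intertwines r A l V" "set w \<subseteq> {..<r}"
  shows "V ** wprod A w = smul (l ^ length w) (wprod A w ** V)"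
  using assms(2)
proof (induction w)
  case (Cons i w)
  have "V ** wprod A (i # w) = smul l (A i ** (V ** wprod A w))"
    using assms(1) Cons.prems unfolding intertwines_def by (simp add: matrix_mul_assoc mat_distribs)
  also have "\<dots> = smul (l ^ length (i # w)) (wprod A (i # w) ** V)"
    using Cons by (simp add: mat_distribs mat_assoc)
  finally show ?case .
qed simp

lemma intertwines_mult:
  assumes "intertwines r A l V" "intertwines r A k W" shows "intertwines r A (l * k) (V ** W)"
  unfolding intertwines_def
proof (intro allI impI)
  fix i assume i: "i < r"
  have "V ** W ** A i = smul k (V ** A i ** W)"
    using assms(2) i by (simp add: intertwines_def mat_assoc smul_mult_right)
  also have "\<dots> = smul (l * k) (A i ** (V ** W))"
    using assms(1) i by (simp add: intertwines_def mat_assoc smul_mult_left mult.commute)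
  finally show "V ** W ** A i = smul (l * k) (A i ** (V ** W))" .
qed

lemma intertwines_one: "intertwines r A 1 (mat 1)" by (simp add: intertwines_def)

lemma intertwines_mpow: "intertwines r A l V \<Longrightarrow> intertwines r A (l ^ k) (mpow V k)"
  by (induction k) (auto simp: intertwines_one intertwines_mult)

lemma intertwines_smul: "intertwines r A l V \<Longrightarrow> intertwines r A l (smul c V)"
  by (simp add: intertwines_def mat_distribs mult.commute)

lemma intertwines_adj:
  assumes V: "unitary V" and l: "cmod l = 1" and "intertwines r A l V"
  shows "intertwines r A (cnj l) (adj V)"
  unfolding intertwines_def
proof (intro allI impI)
  fix i assume i: "i < r"
  have "smul (cnj l) (adj V ** (V ** A i) ** adj V) = adj V ** A i ** (V ** adj V)"
    using assms(3) i l by (simp add: intertwines_def mat_distribs cnj_mult_self mat_assoc)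
  moreover have "adj V ** (V ** A i) ** adj V = A i ** adj V"
    using V by (simp add: unitary_def matrix_mul_assoc)
  moreover have "adj V ** A i ** (V ** adj V) = adj V ** A i"
    using V by (simp add: unitary_def)
  ultimately show "adj V ** A i = smul (cnj l) (A i ** adj V)" by simp
qed

text \<open>For an irreducible tuple this is the peripheral spectrum, see
  \<open>peripheral_spectrum_eq\<close>; in this form it is visibly a group.\<close>

definition spec_group :: "nat \<Rightarrow> (nat \<Rightarrow> 'n::finite cmat) \<Rightarrow> complex set" where
  "spec_group r A = {l. cmod l = 1 \<and> (\<exists>V. unitary V \<and> intertwines r A l V)}"

lemma spec_group_mult: "l \<in> spec_group r A \<Longrightarrow> k \<in> spec_group r A \<Longrightarrow> l * k \<in> spec_group r A"
  unfolding spec_group_def by (auto simp: norm_mult intro: unitary_mult intertwines_mult)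

lemma spec_group_cnj: "l \<in> spec_group r A \<Longrightarrow> cnj l \<in> spec_group r A"
  unfolding spec_group_def by (auto intro: unitary_adj intertwines_adj)

text \<open>Lagrange's argument: multiplication by \<open>l\<close> permutes the finite group, so
  the product of its elements is multiplied by \<open>l^m\<close> and stays the same.\<close>

lemma spec_group_power:
  assumes "card (spec_group r A) = m" "0 < m" "l \<in> spec_group r A" shows "l ^ m = 1"
proof -
  let ?S = "spec_group r A"
  have fin: "finite ?S" using assms by (intro card_ge_0_finite) simp
  have l0: "l \<noteq> 0" using assms(3) by (auto simp: spec_group_def)
  have "(*) l ` ?S = ?S"
  proof (rule card_subset_eq[OF fin])
    show "(*) l ` ?S \<subseteq> ?S" using spec_group_mult assms(3) by auto
    show "card ((*) l ` ?S) = card ?S" using l0 by (intro card_image inj_onI) auto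
  qed
  then have "\<Prod>?S = \<Prod>((*) l ` ?S)" by simp
  also have "\<dots> = (\<Prod>k\<in>?S. l * k)" using l0 by (subst prod.reindex) (auto intro: inj_onI)
  also have "\<dots> = l ^ m * \<Prod>?S" by (simp add: prod.distrib assms(1))
  finally have "\<Prod>?S = l ^ m * \<Prod>?S" .
  moreover have "\<Prod>?S \<noteq> 0" using fin by (auto simp: spec_group_def prod_zero_iff)
  ultimately show ?thesis by simp
qed

lemma spec_group_roots:
  assumes "card (spec_group r A) = m" "0 < m" shows "spec_group r A = {z. z ^ m = 1}"
proof (rule card_subset_eq)
  show "finite {z::complex. z ^ m = 1}" using finite_roots_unity[of m] assms by simp
  show "spec_group r A \<subseteq> {z. z ^ m = 1}" using spec_group_power[OF assms] by blast
  show "card (spec_group r A) = card {z::complex. z ^ m = 1}"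
    using card_roots_unity_eq[of m] assms by simp
qed

subsection \<open>Annihilating polynomials\<close>

definition peval :: "('n::finite cmat \<Rightarrow> 'n cmat) \<Rightarrow> complex poly \<Rightarrow> 'n cmat \<Rightarrow> 'n cmat" where
  "peval T p X = (\<Sum>i\<le>degree p. smul (coeff p i) ((T ^^ i) X))"

lemma peval_altdef: "degree p \<le> n \<Longrightarrow> peval T p X = (\<Sum>i\<le>n. smul (coeff p i) ((T ^^ i) X))"
  unfolding peval_def by (rule sum.mono_neutral_left) (auto simp: coeff_eq_0)

lemma peval_root_factor:
  "peval (kmap r A) ([:- l, 1:] * q) X = kmap r A (peval (kmap r A) q X) - smul l (peval (kmap r A) q X)"
proof -
  let ?T = "kmap r A" and ?n = "degree q"
  have deg: "degree ([:- l, 1:] * q) \<le> Suc ?n"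
    using degree_mult_le[of "[:- l, 1:]" q] by simp
  have c: "coeff ([:- l, 1:] * q) i = (if i = 0 then 0 else coeff q (i - 1)) - l * coeff q i" for i
    by (cases i) (simp_all add: coeff_pCons)
  have "peval ?T ([:- l, 1:] * q) X
      = (\<Sum>i\<le>Suc ?n. smul (if i = 0 then 0 else coeff q (i - 1)) ((?T ^^ i) X)) - (\<Sum>i\<le>Suc ?n. smul (l * coeff q i) ((?T ^^ i) X))"
    unfolding peval_altdef[OF deg] c by (simp add: smul_diff_left sum_subtractf del: sum.atMost_Suc)
  also have "(\<Sum>i\<le>Suc ?n. smul (if i = 0 then 0 else coeff q (i - 1)) ((?T ^^ i) X)) = ?T (peval ?T q X)"
    unfolding peval_def sum.atMost_Suc_shift by (simp add: kmap_sum kmap_smul)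
  also have "(\<Sum>i\<le>Suc ?n. smul (l * coeff q i) ((?T ^^ i) X)) = smul l (peval ?T q X)"
    unfolding peval_def by (simp add: smul_sum_right coeff_eq_0)
  finally show ?thesis .
qed

lemma cmat_munit_expand: "X = (\<Sum>a\<in>UNIV. \<Sum>b\<in>UNIV. smul (X $ a $ b) (munit a b))"
proof -
  have "(\<Sum>a\<in>UNIV. \<Sum>b\<in>UNIV. smul (X $ a $ b) (munit a b)) $ i $ j = X $ i $ j" for i j
  proof -
    have "(\<Sum>a\<in>UNIV. \<Sum>b\<in>UNIV. smul (X $ a $ b) (munit a b)) $ i $ j
        = (\<Sum>a\<in>UNIV. \<Sum>b\<in>UNIV. if b = j then (if a = i then X $ a $ b else 0) else 0)"
      unfolding sum_component by (intro sum.cong refl) (auto simp: munit_nth)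
    then show ?thesis by simp
  qed
  then show ?thesis by (simp add: cmat_eq_iff)
qed

lemma kmap_power_sum: "(kmap r A ^^ n) (sum f S) = (\<Sum>i\<in>S. (kmap r A ^^ n) (f i))"
  by (induction S rule: infinite_finite_induct) (simp_all add: kmap_power_add)

text \<open>The powers of the map are recorded by their values on the matrix units, as vectors of a
  finite-dimensional real space; more powers than dimensions are dependent.\<close>

lemma kmap_annihilating_poly:
  fixes A :: "nat \<Rightarrow> 'n::finite cmat"
  obtains p where "p \<noteq> 0" "\<And>X. peval (kmap r A) p X = 0"
proof -
  let ?T = "kmap r A"
  define Y :: "nat \<Rightarrow> 'n cmat^'n^'n" where "Y i = (\<chi> a b. (?T ^^ i) (munit a b))" for i
  define K where "K = DIM('n cmat^'n^'n)"
  obtain u :: "nat \<Rightarrow> real" where u: "\<exists>i\<le>K. u i \<noteq> 0" "(\<Sum>i\<le>K. u i *\<^sub>R Y i) = 0"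
  proof (cases "inj_on Y {..K}")
    case True
    have "\<not> independent (Y ` {..K})"
      using independent_bound[of "Y ` {..K}"] True by (auto simp: card_image K_def)
    then obtain v where v: "\<exists>y\<in>Y ` {..K}. v y \<noteq> 0" "(\<Sum>y\<in>Y ` {..K}. v y *\<^sub>R y) = 0"
      using dependent_finite[of "Y ` {..K}"] by auto
    show thesis by (rule that[of "\<lambda>i. v (Y i)"]) (use v True in \<open>auto simp: sum.reindex\<close>)
  next
    case False
    then obtain i j where ij: "i \<le> K" "j \<le> K" "i \<noteq> j" "Y i = Y j" by (auto simp: inj_on_def)
    define u :: "nat \<Rightarrow> real" where "u k = (if k = i then 1 else if k = j then -1 else 0)" for k
    have "(\<Sum>k\<le>K. u k *\<^sub>R Y k) = (\<Sum>k\<in>{i, j}. u k *\<^sub>R Y k)"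
      by (rule sum.mono_neutral_right) (use ij in \<open>auto simp: u_def\<close>)
    also have "\<dots> = 0" using ij by (simp add: u_def)
    finally show thesis using ij by (intro that[of u]) (auto simp: u_def)
  qed
  define p where "p = (\<Sum>i\<le>K. monom (complex_of_real (u i)) i)"
  have c: "coeff p i = (if i \<le> K then of_real (u i) else 0)" for i
    by (simp add: p_def coeff_sum)
  have deg: "degree p \<le> K" by (rule degree_le) (simp add: c)
  show thesis
  proof
    show "p \<noteq> 0" using u(1) c by (metis coeff_0 of_real_eq_0_iff)
    fix X
    have mu: "peval ?T p (munit a b) = 0" for a b
    proof -
      have "peval ?T p (munit a b) = (\<Sum>i\<le>K. u i *\<^sub>R Y i) $ a $ b"
        unfolding peval_altdef[OF deg] c by (simp add: Y_def smul_of_real)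
      then show ?thesis by (simp add: u(2))
    qed
    have lin: "peval ?T p (sum f S) = (\<Sum>i\<in>S. peval ?T p (f i))" for f and S :: "'n set"
      unfolding peval_def kmap_power_sum smul_sum_right by (rule sum.swap)
    have sm: "peval ?T p (smul c M) = smul c (peval ?T p M)" for c M
      unfolding peval_def smul_sum_right by (simp add: kmap_power_smul mult.commute)
    show "peval ?T p X = 0"
      by (subst cmat_munit_expand) (simp add: lin sm mu)
  qed
qed

lemma kmap_power_eigen: "kmap r A X = smul mu X \<Longrightarrow> (kmap r A ^^ k) X = smul (mu ^ k) X"
  by (induction k) (simp_all add: kmap_smul mult.commute)

text \<open>Eigenvalues are roots of an annihilating polynomial. Finiteness gives \<open>Max\<close>
  in \<open>spectral_radius_map\<close> its meaning.\<close>

lemma finite_spectrum_kmap: "finite (spectrum_map (kmap r A))"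
proof -
  obtain p where p: "p \<noteq> 0" "\<And>X. peval (kmap r A) p X = 0" using kmap_annihilating_poly by blast
  have "spectrum_map (kmap r A) \<subseteq> {z. poly p z = 0}"
  proof
    fix mu assume "mu \<in> spectrum_map (kmap r A)"
    then obtain X where X: "X \<noteq> 0" "kmap r A X = smul mu X" by (auto simp: spectrum_map_def)
    have "peval (kmap r A) p X = smul (poly p mu) X"
      unfolding peval_def poly_altdef smul_sum_left by (simp add: kmap_power_eigen[OF X(2)])
    then show "mu \<in> {z. poly p z = 0}" using X(1) p(2)[of X] by (simp add: smul_eq_0_iff)
  qed
  then show ?thesis using poly_roots_finite[OF p(1)] finite_subset by blast
qed

subsection \<open>The peripheral spectrum\<close>

text \<open>Irreducibility in the form used for the peripheral structure: the unital dual fixes only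
  scalars.\<close>

locale tp_irr = tp_kraus +
  assumes fixE: "\<And>Y. kmap r (dag A) Y = Y \<Longrightarrow> \<exists>c. Y = smul c (mat 1)"
begin

text \<open>The intertwining relation makes \<open>adj Y ** Y\<close> a fixed point of the dual,
  hence a positive scalar, and \<open>Y\<close> is a multiple of a unitary.\<close>

lemma unitary_eigenvector:
  assumes Y: "E Y = smul l Y" "cmod l = 1" "Y \<noteq> 0"
  shows "l \<in> spec_group r A"
proof -
  have YA: "Y ** A i = smul l (A i ** Y)" if "i < r" for i
    by (rule eigen_intertwine[OF Y(1,2) that])
  have "adj (A i) ** (adj Y ** Y) ** A i = adj Y ** (adj (A i) ** A i) ** Y" if "i < r" for i
  proof -
    have "adj (A i) ** (adj Y ** Y) ** A i = adj (Y ** A i) ** (Y ** A i)"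
      by (simp add: adj_mult mat_assoc)
    also have "\<dots> = smul (cnj l * l) (adj Y ** (adj (A i) ** A i) ** Y)"
      unfolding YA[OF that] by (simp add: adj_distribs mat_distribs mat_assoc mult.commute)
    finally show ?thesis by (simp add: cnj_mult_self Y(2))
  qed
  then have "E (adj Y ** Y) = adj Y ** gram r A ** Y"
    unfolding kmap_dag_eq gram_def by (simp add: matrix_mult_sum_left matrix_mult_sum_right)
  then obtain c where c: "adj Y ** Y = smul c (mat 1)" using fixE[of "adj Y ** Y"] gram by auto
  define s where "s = (\<Sum>i\<in>UNIV. \<Sum>j\<in>UNIV. (cmod (Y $ j $ i))\<^sup>2) / real CARD('a)"
  have "c * of_nat CARD('a) = of_real (\<Sum>i\<in>UNIV. \<Sum>j\<in>UNIV. (cmod (Y $ j $ i))\<^sup>2)"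
    unfolding trace_adj_mult_self[symmetric] c trace_smul trace_I ..
  then have cs: "c = of_real s" by (simp add: s_def divide_simps del: of_real_sum of_real_power)
  have "s \<noteq> 0" using trace_adj_mult_self_eq_0[of Y] Y(3) by (auto simp: c cs)
  moreover have "s \<ge> 0" unfolding s_def by (intro divide_nonneg_nonneg sum_nonneg) auto
  ultimately have s0: "s > 0" by simp
  define k where "k = 1 / sqrt s"
  define V where "V = smul (of_real k) Y"
  have "adj V ** V = smul (of_real (k * k * s)) (mat 1)"
    unfolding V_def by (simp add: adj_smul mat_distribs c cs mult.assoc)
  also have "k * k * s = 1" using s0 by (simp add: k_def)
  finally have "unitary V" by (intro unitaryI) simp
  moreover have "intertwines r A l V"
    unfolding V_def by (rule intertwines_smul) (simp add: intertwines_def YA)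
  ultimately show ?thesis using Y(2) by (auto simp: spec_group_def)
qed

lemma intertwines_eigen: "intertwines r A l V \<Longrightarrow> E V = smul l V"
  unfolding intertwines_def by (intro intertwine_eigen) blast

lemma spec_group_spectrum:
  assumes "l \<in> spec_group r A" shows "l \<in> spectrum_map (kmap r A)"
proof -
  obtain V where V: "unitary V" "intertwines r A (cnj l) V" and l: "cmod l = 1"
    using spec_group_cnj[OF assms] by (auto simp: spec_group_def)
  have "kmap r A (V ** X0) = smul l (V ** X0)"
    using dual_transfer[of V "cnj l"] V(2) l by (simp add: intertwines_def)
  moreover have "V \<noteq> 0" using V(1) by (auto simp: unitary_def mat1_neq_0[symmetric])
  then have "V ** X0 \<noteq> 0" using mult_X0_eq_0 by blast
  ultimately show ?thesis unfolding spectrum_map_def by blast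
qed

lemma spectrum_modulus_le: assumes "mu \<in> spectrum_map (kmap r A)" shows "cmod mu \<le> 1"
proof -
  obtain Z where Z: "Z \<noteq> 0" "kmap r A Z = smul mu Z" using assms by (auto simp: spectrum_map_def)
  obtain Y where "Y \<noteq> 0" "E Y = smul (cnj mu) Y" using dual_eigenvector[OF Z(2,1)] by blast
  then show ?thesis using eigen_modulus by fastforce
qed

lemma one_in_spectrum: "1 \<in> spectrum_map (kmap r A)"
  unfolding spectrum_map_def using fixed pos_def_nonzero[OF pd] by (auto intro!: exI[of _ X0])

lemma spectral_radius_one: "spectral_radius_map (kmap r A) = 1"
  unfolding spectral_radius_map_def
proof (rule Max_eqI)
  show "1 \<in> cmod ` spectrum_map (kmap r A)" using one_in_spectrum by (metis image_eqI norm_one)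
qed (use finite_spectrum_kmap spectrum_modulus_le in auto)

lemma peripheral_spectrum_eq: "peripheral_spectrum (kmap r A) = spec_group r A"
proof
  show "spec_group r A \<subseteq> peripheral_spectrum (kmap r A)"
    unfolding peripheral_spectrum_def spectral_radius_one
    using spec_group_spectrum by (auto simp: spec_group_def)
  show "peripheral_spectrum (kmap r A) \<subseteq> spec_group r A"
  proof
    fix mu assume "mu \<in> peripheral_spectrum (kmap r A)"
    then obtain Z where Z: "Z \<noteq> 0" "kmap r A Z = smul mu Z" and mu: "cmod mu = 1"
      by (auto simp: peripheral_spectrum_def spectral_radius_one spectrum_map_def)
    obtain Y where "Y \<noteq> 0" "E Y = smul (cnj mu) Y" using dual_eigenvector[OF Z(2,1)] by blast
    then have "cnj mu \<in> spec_group r A" using unitary_eigenvector mu by simp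
    then show "mu \<in> spec_group r A" using spec_group_cnj by force
  qed
qed

lemma intertwiner_scalar:
  assumes "intertwines r A 1 V" shows "\<exists>c. V = smul c (mat 1)"
  using fixE[of V] intertwines_eigen[OF assms] by simp

text \<open>The power \<open>V^m\<close> intertwines with factor \<open>beta^m = 1\<close> and is
  therefore a scalar of modulus 1, which a suitable multiple of \<open>V\<close> removes.\<close>

lemma cyclic_unitary:
  assumes m: "0 < m" and V: "unitary V" "intertwines r A (beta m) V"
  obtains d where "cmod d = 1" "unitary (smul d V)" "mpow (smul d V) m = mat 1"
    "intertwines r A (beta m) (smul d V)"
proof -
  have "intertwines r A 1 (mpow V m)"
    using intertwines_mpow[OF V(2), of m] by (simp add: beta_power_m m)
  then obtain c where c: "mpow V m = smul c (mat 1)" using intertwiner_scalar by blast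
  have "unitary (mpow V m)" by (rule unitary_mpow[OF V(1)])
  then have "smul (cnj c * c) (mat 1) = smul 1 (mat 1 :: 'a cmat)"
    unfolding c unitary_def by (simp add: adj_smul mat_distribs mult.commute)
  then have "cnj c * c = 1" by (rule smul_mat1_inj)
  then have "complex_of_real ((cmod c)\<^sup>2) = of_real 1" unfolding cnj_mult_self by simp
  then have "(cmod c)\<^sup>2 = 1" by (simp only: of_real_eq_iff)
  then have c1: "cmod c = 1" by (simp add: abs_square_eq_1)
  \<comment> \<open>An \<open>m\<close>-th root of \<open>1 / c\<close>.\<close>
  define d where "d = exp (Ln (1 / c) / of_nat m)"
  have dm: "d ^ m = 1 / c"
  proof -
    have "c \<noteq> 0" using c1 by auto
    then show ?thesis using m by (simp add: d_def exp_of_nat_mult[symmetric])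
  qed
  then have "cmod d ^ m = 1" using c1 by (metis norm_divide norm_one norm_power div_by_1)
  then have d1: "cmod d = 1" using m power_eq_iff_eq_base[of m "cmod d" 1] by simp
  show thesis
  proof
    show "unitary (smul d V)" by (rule unitary_smul[OF d1 V(1)])
    show "mpow (smul d V) m = mat 1" using c1 by (auto simp: mpow_smul dm c)
    show "intertwines r A (beta m) (smul d V)" by (rule intertwines_smul[OF V(2)])
  qed (rule d1)
qed

end

subsection \<open>Eventual spanning of words\<close>

lemma continuous_on_kmap_power: "continuous_on S (kmap r A ^^ k)"
proof (induction k)
  case (Suc k)
  then show ?case unfolding funpow.simps by (rule continuous_on_compose[OF _ continuous_on_kmap])
qed (simp add: continuous_on_id id_def)

context tp_irr
begin

text \<open>Matrices on which all powers of \<open>E\<close> are isometric for the invariant state.\<close>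
definition isoset :: "'a cmat set" where
  "isoset = {Y. \<forall>k. \<forall>i<r. (E ^^ k) Y ** A i = A i ** (E ^^ Suc k) Y}"

lemma nphi_const_isoset:
  assumes "\<And>k. nphi X0 ((E ^^ k) Y) = nphi X0 Y" shows "Y \<in> isoset"
  unfolding isoset_def
proof (intro CollectI allI impI)
  fix k i assume "i < r"
  show "(E ^^ k) Y ** A i = A i ** (E ^^ Suc k) Y"
    using nphi_E_eqD[of "(E ^^ k) Y" i] assms[of k] assms[of "Suc k"] \<open>i < r\<close> by simp
qed

lemma isoset_E: "Y \<in> isoset \<Longrightarrow> E Y \<in> isoset"
  unfolding isoset_def by (auto simp: funpow_swap1 simp del: funpow.simps) (metis funpow_swap1 funpow.simps(2) o_apply)

lemma isoset_Epow: "Y \<in> isoset \<Longrightarrow> (E ^^ k) Y \<in> isoset"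
  by (induction k) (auto simp: isoset_E)

lemma isoset_diff: "Y \<in> isoset \<Longrightarrow> W \<in> isoset \<Longrightarrow> Y - W \<in> isoset"
  unfolding isoset_def by (simp add: kmap_power_diff kmap_diff mat_distribs)

lemma isoset_smul: "Y \<in> isoset \<Longrightarrow> smul c Y \<in> isoset"
  unfolding isoset_def by (simp add: kmap_power_smul kmap_smul mat_distribs)

lemma isoset_zero: "0 \<in> isoset"
  unfolding isoset_def by simp

lemma isoset_add: "Y \<in> isoset \<Longrightarrow> W \<in> isoset \<Longrightarrow> Y + W \<in> isoset"
  unfolding isoset_def by (simp add: kmap_power_add kmap_add mat_distribs)

lemma isoset_sum: "(\<And>i. i \<in> S \<Longrightarrow> f i \<in> isoset) \<Longrightarrow> sum f S \<in> isoset"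
  by (induction S rule: infinite_finite_induct) (auto simp: isoset_zero isoset_add)

lemma isoset_peval: "Y \<in> isoset \<Longrightarrow> peval E p Y \<in> isoset"
  unfolding peval_def by (intro isoset_sum isoset_smul isoset_Epow)

lemma isoset_nphi: assumes "Y \<in> isoset" shows "nphi X0 (E Y) = nphi X0 Y"
proof -
  have *: "\<forall>k. \<forall>i<r. (E ^^ k) Y ** A i = A i ** (E ^^ Suc k) Y"
    using assms by (simp only: isoset_def mem_Collect_eq)
  have "Y ** A i = A i ** E Y" if "i < r" for i
    using *[rule_format, OF that, of 0] by simp
  then have "(\<Sum>i<r. nphi X0 (Y ** A i - A i ** E Y)) = 0"
    by (intro sum.neutral) (simp add: nphi_def)
  then show ?thesis using schwarz_identity[of Y] by simp
qed

lemma nphi_parallelogram: "nphi X0 (Y - W) \<le> 2 * nphi X0 Y + 2 * nphi X0 W"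
proof -
  have "nphi X0 (Y - W) + nphi X0 (Y + W) = 2 * nphi X0 Y + 2 * nphi X0 W"
    unfolding nphi_def by (simp add: adj_distribs mat_distribs trace_add trace_sub)
  then show ?thesis using nphi_nonneg[of "Y + W"] by linarith
qed

lemma nphi_Epow_le: "nphi X0 ((E ^^ k) Y) \<le> nphi X0 Y"
  by (induction k) (auto intro: order_trans[OF nphi_E_le])

text \<open>A peripheral eigenvalue has no Jordan block since \<open>E\<close> is power bounded.\<close>
lemma no_jordan_block:
  assumes "(E ^^ m) Y = Y + D" "(E ^^ m) D = D" shows "D = 0"
proof (rule ccontr)
  assume "D \<noteq> 0"
  have pow: "(E ^^ (m * k)) Y = Y + smul (of_nat k) D" for k
  proof (induction k)
    case (Suc k)
    have "(E ^^ (m * Suc k)) Y = (E ^^ m) ((E ^^ (m * k)) Y)"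
      by (simp add: funpow_add)
    also have "\<dots> = Y + D + smul (of_nat k) D"
      by (simp add: Suc kmap_power_add kmap_power_smul assms)
    finally show ?case by (simp add: smul_add_left)
  qed simp
  have bd: "real k ^ 2 * nphi X0 D \<le> 4 * nphi X0 Y" for k
  proof -
    have "nphi X0 (smul (of_nat k) D) = nphi X0 ((E ^^ (m * k)) Y - Y)" by (simp add: pow)
    also have "\<dots> \<le> 2 * nphi X0 ((E ^^ (m * k)) Y) + 2 * nphi X0 Y" by (rule nphi_parallelogram)
    also have "\<dots> \<le> 4 * nphi X0 Y" using nphi_Epow_le[of "m * k" Y] by simp
    finally show ?thesis by (simp add: nphi_smul)
  qed
  obtain k :: nat where k: "4 * nphi X0 Y < real k * nphi X0 D"
    using reals_Archimedean3[OF nphi_pos[OF \<open>D \<noteq> 0\<close>]] by blast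
  moreover have "real k * nphi X0 D \<le> real k ^ 2 * nphi X0 D"
    using nphi_nonneg[of D] of_nat_mono[OF le_square[of k], where ?'a = real]
    by (intro mult_right_mono) (auto simp: power2_eq_square)
  ultimately show False using bd[of k] by linarith
qed

text \<open>Induction on the degree of an annihilating polynomial. Splitting off a root
  \<open>l\<close> leaves an eigenvector in \<open>isoset\<close>; if it is nonzero,
  \<open>l\<close> has modulus 1 and \<open>l^m = 1\<close>. Then \<open>D\<close>, the change of
  \<open>Y\<close> under \<open>E^m\<close>, is killed by the remaining factor, so it is fixed by
  \<open>E^m\<close>, and the absence of Jordan blocks gives \<open>D = 0\<close>.\<close>

lemma isoset_periodic_aux:
  assumes per: "\<And>l. l \<in> spec_group r A \<Longrightarrow> l ^ m = 1"
  shows "degree p = n \<Longrightarrow> p \<noteq> 0 \<Longrightarrow> Y \<in> isoset \<Longrightarrow> peval E p Y = 0 \<Longrightarrow> (E ^^ m) Y = Y"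
proof (induction n arbitrary: p Y)
  case 0
  then have "coeff p 0 \<noteq> 0" using leading_coeff_neq_0 by fastforce
  then have "Y = 0" using 0 by (simp add: peval_def smul_eq_0_iff)
  then show ?case by simp
next
  case (Suc n)
  have "\<not> constant (poly p)" using Suc.prems(1) by (simp add: constant_degree)
  then obtain l where "poly p l = 0" using fundamental_theorem_of_algebra by blast
  then obtain q where q: "p = [:- l, 1:] * q" by (metis poly_eq_0_iff_dvd dvdE)
  have q0: "q \<noteq> 0" using q Suc.prems(2) by auto
  have dq: "degree q = n" using Suc.prems(1) q0 unfolding q by (subst (asm) degree_mult_eq) auto
  define z where "z = peval E q Y"
  have zE: "E z = smul l z" using Suc.prems(4) unfolding q peval_root_factor z_def by simp
  show ?case
  proof (cases "z = 0")
    case True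
    then show ?thesis using Suc.IH[OF dq q0 Suc.prems(3)] by (simp add: z_def)
  next
    case False
    have "z \<in> isoset" unfolding z_def by (rule isoset_peval[OF Suc.prems(3)])
    then have "(cmod l)\<^sup>2 * nphi X0 z = nphi X0 z" using isoset_nphi zE nphi_smul by metis
    then have "(cmod l)\<^sup>2 = 1" using nphi_pos[OF False] by simp
    then have "cmod l = 1" by (simp add: abs_square_eq_1)
    then have lm: "l ^ m = 1" using per unitary_eigenvector[OF zE _ False] by blast
    define D where "D = (E ^^ m) Y - Y"
    have D: "D \<in> isoset" unfolding D_def by (intro isoset_diff isoset_Epow Suc.prems(3))
    have comm: "(E ^^ i) ((E ^^ m) Y) = (E ^^ m) ((E ^^ i) Y)" for i
      by (metis add.commute comp_apply funpow_add)
    have "peval E q D = (E ^^ m) z - z"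
      unfolding z_def peval_def D_def
      by (simp add: kmap_power_sum kmap_power_smul kmap_power_diff smul_diff_right comm sum_subtractf)
    also have "\<dots> = 0" using kmap_power_eigen[OF zE, of m] lm by simp
    finally have "(E ^^ m) D = D" by (rule Suc.IH[OF dq q0 D])
    then have "D = 0" by (intro no_jordan_block[of m Y]) (simp_all add: D_def)
    then show ?thesis by (simp add: D_def)
  qed
qed

lemma isoset_periodic:
  assumes "\<And>l. l \<in> spec_group r A \<Longrightarrow> l ^ m = 1" "Y \<in> isoset"
  shows "(E ^^ m) Y = Y"
proof -
  obtain p where "p \<noteq> 0" "\<And>X. peval E p X = 0" using kmap_annihilating_poly by blast
  then show ?thesis using isoset_periodic_aux[OF assms(1) refl _ assms(2)] by blast
qed

text \<open>The sum over one period is fixed by \<open>E\<close>, hence a scalar, and the invariant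
  state determines which one.\<close>

lemma isoset_average:
  assumes "\<And>l. l \<in> spec_group r A \<Longrightarrow> l ^ m = 1" "Y \<in> isoset"
  shows "(\<Sum>i<m. (E ^^ i) Y) = smul (of_nat m * trace (X0 ** Y)) (mat 1)"
proof -
  let ?F = "\<Sum>i<m. (E ^^ i) Y"
  have tr: "trace (X0 ** (E ^^ i) Y) = trace (X0 ** Y)" for i
    by (induction i) (simp_all add: trace_X0_E)
  have "E ?F = (\<Sum>i<m. (E ^^ Suc i) Y)" by (simp add: kmap_sum)
  then have "E ?F + (E ^^ 0) Y = (\<Sum>i<Suc m. (E ^^ i) Y)"
    by (simp only: sum.lessThan_Suc_shift add.commute)
  then have "E ?F = ?F" using isoset_periodic[OF assms] by simp
  then obtain c where c: "?F = smul c (mat 1)" using fixE by blast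
  have "trace (X0 ** ?F) = of_nat m * trace (X0 ** Y)"
    by (simp add: matrix_mult_sum_right trace_sum tr)
  then show ?thesis by (simp add: c mat_distribs trace_smul tr1)
qed

text \<open>Faithfulness of \<open>X0\<close> lets \<open>nphi X0\<close> control every entry, so
  orbits of \<open>E\<close> are bounded.\<close>

lemma entry_le_nphi:
  obtains e where "e > 0" "\<And>Y i j. e * (cmod (Y $ i $ j))\<^sup>2 \<le> nphi X0 Y"
proof -
  obtain e where e: "e > 0" "\<And>v. e * (norm v)\<^sup>2 \<le> Re (cip v (X0 *v v))"
    using pos_def_bound[OF pd] by blast
  have "e * (cmod (Y $ i $ j))\<^sup>2 \<le> nphi X0 Y" for Y i j
  proof -
    define v where "v k = adj Y *v axis k (1::complex)" for k
    have vk: "v i $ j = cnj (Y $ i $ j)"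
    proof -
      have "v i $ j = (\<Sum>k\<in>UNIV. if k = i then cnj (Y $ k $ j) else 0)"
        unfolding v_def matrix_vector_mult_def vec_lambda_beta by (intro sum.cong) (auto simp: axis_def)
      then show ?thesis by simp
    qed
    have "e * (cmod (Y $ i $ j))\<^sup>2 \<le> e * (norm (v i))\<^sup>2"
      using e(1) Finite_Cartesian_Product.norm_nth_le[of "v i" j] by (intro mult_left_mono power_mono) (auto simp: vk)
    also have "\<dots> \<le> Re (cip (v i) (X0 *v v i))" by (rule e(2))
    also have "\<dots> \<le> (\<Sum>k\<in>UNIV. Re (cip (v k) (X0 *v v k)))"
      by (rule member_le_sum) (use psdD(2)[OF pos_def_imp_psd[OF pd]] in auto)
    also have "\<dots> = nphi X0 Y"
      unfolding nphi_eq trace_def Re_sum v_def by (simp only: cip_conj_form[symmetric] cip_axis)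
    finally show ?thesis .
  qed
  then show thesis using that e(1) by blast
qed

text \<open>LaSalle's invariance principle with \<open>nphi X0\<close> as Lyapunov function: it
  decreases along the orbit of \<open>W\<close> to a limit, so it is constant along the orbit of any
  limit point.\<close>

lemma limit_isoset:
  assumes g: "strict_mono g" and lim: "(\<lambda>n. (E ^^ g n) W) \<longlonglongrightarrow> Y"
  shows "Y \<in> isoset"
proof -
  define a where "a n = nphi X0 ((E ^^ n) W)" for n
  have "decseq a" unfolding decseq_Suc_iff a_def using nphi_E_le by simp
  moreover have "bounded (range a)"
    by (rule boundedI[of _ "nphi X0 W"]) (auto simp: a_def abs_of_nonneg nphi_nonneg nphi_Epow_le)
  ultimately obtain L where L: "a \<longlonglongrightarrow> L"
    using decseq_convergent[of a 0] nphi_nonneg by (metis a_def)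
  have "nphi X0 ((E ^^ k) Y) = L" for k
  proof (rule LIMSEQ_unique)
    have "(\<lambda>n. (E ^^ k) ((E ^^ g n) W)) \<longlonglongrightarrow> (E ^^ k) Y"
    proof -
      show ?thesis
        by (rule continuous_on_tendsto_compose[OF continuous_on_kmap_power[of UNIV] lim]) auto
    qed
    then show "(\<lambda>n. nphi X0 ((E ^^ k) ((E ^^ g n) W))) \<longlonglongrightarrow> nphi X0 ((E ^^ k) Y)"
      unfolding nphi_def by (intro tendsto_intros)
    have "strict_mono (\<lambda>n. k + g n)" using g by (simp add: strict_mono_def)
    then have "(\<lambda>n. a (k + g n)) \<longlonglongrightarrow> L" using LIMSEQ_subseq_LIMSEQ[OF L] by (auto simp: o_def)
    then show "(\<lambda>n. nphi X0 ((E ^^ k) ((E ^^ g n) W))) \<longlonglongrightarrow> L"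
      by (simp add: a_def funpow_add)
  qed
  from this this[of 0] show ?thesis by (intro nphi_const_isoset) simp
qed

text \<open>The averaged powers of \<open>E\<close> converge along a subsequence to the map sending \<open>X\<close> to
  \<open>m tr(X0 X) 1\<close>, whose Choi form is positive definite; hence the Choi form of the powers
  eventually has no kernel.\<close>
lemma eventually_spans_dag:
  assumes per: "\<And>l. l \<in> spec_group r A \<Longrightarrow> l ^ m = 1" and m: "0 < m"
  shows "\<exists>N. spans r N m (dag A)"
proof (rule ccontr)
  assume "\<not> ?thesis"
  then have "\<forall>N. \<exists>Z. Z \<noteq> 0 \<and> (\<forall>w. set w \<subseteq> {..<r} \<and> N \<le> length w \<and> length w < N + m \<longrightarrow> trace (Z ** wprod (dag A) w) = 0)"
    unfolding spans_def by blast
  then obtain Z where Z: "\<And>N. Z N \<noteq> 0"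
    "\<And>N w. set w \<subseteq> {..<r} \<Longrightarrow> N \<le> length w \<Longrightarrow> length w < N + m \<Longrightarrow> trace (Z N ** wprod (dag A) w) = 0"
    by metis
  define z where "z N = (1 / norm (Z N)) *\<^sub>R Z N" for N
  have nz: "norm (z N) = 1" for N using Z(1) by (simp add: z_def)
  have zw: "trace (z N ** wprod (dag A) w) = 0"
    if "set w \<subseteq> {..<r}" "N \<le> length w" "length w < N + m" for N w
    using Z(2)[OF that] by (simp add: z_def scaleR_mm_left trace_scaleR)
  \<comment> \<open>Recording a power of \<open>E\<close> by its values on the matrix units turns
    convergence of maps into convergence of vectors.\<close>
  define Y :: "nat \<Rightarrow> 'a cmat^'a^'a" where "Y n = (\<chi> a b. (E ^^ n) (munit a b))" for n
  obtain e where e: "e > 0" "\<And>Y i j. e * (cmod (Y $ i $ j))\<^sup>2 \<le> nphi X0 Y" using entry_le_nphi by blast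
  define B where "B = (\<Sum>a\<in>UNIV. \<Sum>b\<in>UNIV. \<Sum>i\<in>(UNIV::'a set). \<Sum>j\<in>(UNIV::'a set). sqrt (nphi X0 (munit a b) / e))"
  have nY: "norm (Y n) \<le> B" for n
  proof -
    have ent: "cmod ((E ^^ n) W $ i $ j) \<le> sqrt (nphi X0 W / e)" for W i j
    proof (rule real_le_rsqrt)
      have "e * (cmod ((E ^^ n) W $ i $ j))\<^sup>2 \<le> nphi X0 W"
        using e(2) nphi_Epow_le order_trans by blast
      then show "(cmod ((E ^^ n) W $ i $ j))\<^sup>2 \<le> nphi X0 W / e" using e(1) by (simp add: field_simps)
    qed
    have "norm (Y n) \<le> (\<Sum>a\<in>UNIV. norm (Y n $ a))" unfolding norm_vec_def[of "Y n"] by (rule L2_set_le_sum) simp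
    also have "\<dots> \<le> (\<Sum>a\<in>UNIV. \<Sum>b\<in>UNIV. norm (Y n $ a $ b))"
      unfolding norm_vec_def[of "Y n $ _"] by (intro sum_mono L2_set_le_sum) simp
    also have "\<dots> \<le> B"
      unfolding B_def Y_def vec_lambda_beta by (intro sum_mono order_trans[OF norm_cmat_le_sum] ent)
    finally show ?thesis .
  qed
  \<comment> \<open>One subsequence has to serve the powers and the annihilators at once, hence the
    pairs.\<close>
  have "bounded (range (\<lambda>n. (Y n, z n)))"
  proof (rule boundedI)
    fix x assume "x \<in> range (\<lambda>n. (Y n, z n))"
    then obtain n where "x = (Y n, z n)" by auto
    then show "norm x \<le> B + 1" using norm_Pair_le[of "Y n" "z n"] nY[of n] nz[of n] by simp
  qed
  then obtain l g where g: "strict_mono g" and lim: "((\<lambda>n. (Y n, z n)) \<circ> g) \<longlonglongrightarrow> l"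
    using bounded_imp_convergent_subsequence by blast
  obtain L Zl where l: "l = (L, Zl)" by (cases l)
  have limY: "(\<lambda>n. Y (g n)) \<longlonglongrightarrow> L" using tendsto_fst[OF lim] by (simp add: o_def l)
  have limz: "(\<lambda>n. z (g n)) \<longlonglongrightarrow> Zl" using tendsto_snd[OF lim] by (simp add: o_def l)
  have limE: "(\<lambda>n. (E ^^ g n) (munit a b)) \<longlonglongrightarrow> L $ a $ b" for a b
    using tendsto_vec_nth[OF tendsto_vec_nth[OF limY, of a], of b] by (simp add: Y_def)
  have "(\<lambda>n. norm (z (g n))) \<longlonglongrightarrow> norm Zl" by (intro tendsto_intros limz)
  then have "norm Zl = 1" by (simp add: nz LIMSEQ_const_iff)
  then have Zl0: "Zl \<noteq> 0" by auto
  define F where "F W = (\<Sum>i<m. (E ^^ i) W)" for W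
  have FL: "F (L $ a $ b) = smul (of_nat m * X0 $ b $ a) (mat 1)" for a b
  proof -
    have tr: "trace (X0 ** (E ^^ n) W) = trace (X0 ** W)" for n W
      by (induction n) (simp_all add: trace_X0_E)
    have "(\<lambda>n. trace (X0 ** (E ^^ g n) (munit a b))) \<longlonglongrightarrow> trace (X0 ** L $ a $ b)"
      by (intro tendsto_intros limE)
    then have "trace (X0 ** L $ a $ b) = X0 $ b $ a"
      by (simp add: tr trace_mult_munit LIMSEQ_const_iff)
    then show ?thesis
      using isoset_average[OF per limit_isoset[OF g limE[of a b]]] by (simp add: F_def)
  qed
  define G where "G n = (\<lambda>W. F ((E ^^ g n) W))" for n
  have limG: "(\<lambda>n. G n (munit a b)) \<longlonglongrightarrow> F (L $ a $ b)" for a b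
    unfolding G_def F_def
    by (intro tendsto_sum continuous_on_tendsto_compose[OF continuous_on_kmap_power[of UNIV] limE]) auto
  \<comment> \<open>The Kraus operators of \<open>G n\<close> are the words of lengths
    \<open>g n\<close>, ..., \<open>g n + m - 1\<close>, all annihilated by
    \<open>z (g n)\<close>.\<close>
  have q0: "qform (G n) (z (g n)) = 0" for n
  proof -
    have "qform (E ^^ (i + g n)) (z (g n)) = 0" if "i < m" for i
    proof -
      have "qform (E ^^ (i + g n)) (z (g n)) = of_real (\<Sum>w\<in>words r (i + g n). (cmod (trace (z (g n) ** wprod (dag A) w)))\<^sup>2)"
        by (rule qform_kraus) (simp_all add: kmap_power)
      also have "(\<Sum>w\<in>words r (i + g n). (cmod (trace (z (g n) ** wprod (dag A) w)))\<^sup>2) = 0"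
        using zw[of _ "g n"] that by (intro sum.neutral) (auto simp: words_def)
      finally show ?thesis by simp
    qed
    moreover have "qform (G n) (z (g n)) = (\<Sum>i<m. qform (E ^^ (i + g n)) (z (g n)))"
      unfolding qform_def G_def F_def sum_component sum_distrib_left funpow_add o_apply
      by (subst sum.swap, intro sum.cong refl)+
    ultimately show ?thesis by simp
  qed
  have "(\<lambda>n. qform (G n) (z (g n))) \<longlonglongrightarrow>
      (\<Sum>a\<in>UNIV. \<Sum>b\<in>UNIV. \<Sum>c\<in>UNIV. \<Sum>d\<in>UNIV. Zl $ a $ b * cnj (Zl $ c $ d) * F (L $ a $ c) $ b $ d)"
    unfolding qform_def by (intro tendsto_intros tendsto_cmat_nth limz limG)
  then have "(\<Sum>a\<in>UNIV. \<Sum>b\<in>UNIV. \<Sum>c\<in>UNIV. \<Sum>d\<in>UNIV. Zl $ a $ b * cnj (Zl $ c $ d) * F (L $ a $ c) $ b $ d) = 0"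
    unfolding q0 by (simp add: LIMSEQ_const_iff)
  \<comment> \<open>With the limit map inserted, the form is \<open>m\<close> times the sum of the
    \<open>X0\<close>-forms of the columns of \<open>Zl\<close>, which is positive unless
    \<open>Zl = 0\<close>.\<close>
  moreover have "(\<Sum>a\<in>UNIV. \<Sum>b\<in>UNIV. \<Sum>c\<in>UNIV. \<Sum>d\<in>UNIV. Zl $ a $ b * cnj (Zl $ c $ d) * F (L $ a $ c) $ b $ d)
     = of_nat m * (\<Sum>b\<in>UNIV. cip (column b Zl) (X0 *v column b Zl))"
  proof -
    have "(\<Sum>d\<in>UNIV. Zl $ a $ b * cnj (Zl $ c $ d) * F (L $ a $ c) $ b $ d)
        = Zl $ a $ b * cnj (Zl $ c $ b) * (of_nat m * X0 $ c $ a)" for a b c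
    proof -
      have "(\<Sum>d\<in>UNIV. Zl $ a $ b * cnj (Zl $ c $ d) * F (L $ a $ c) $ b $ d)
        = (\<Sum>d\<in>UNIV. if b = d then Zl $ a $ b * cnj (Zl $ c $ d) * (of_nat m * X0 $ c $ a) else 0)"
        unfolding FL smul_nth mat_nth by (intro sum.cong) auto
      then show ?thesis by simp
    qed
    then have "(\<Sum>a\<in>UNIV. \<Sum>b\<in>UNIV. \<Sum>c\<in>UNIV. \<Sum>d\<in>UNIV. Zl $ a $ b * cnj (Zl $ c $ d) * F (L $ a $ c) $ b $ d)
        = (\<Sum>b\<in>UNIV. \<Sum>c\<in>UNIV. \<Sum>a\<in>UNIV. Zl $ a $ b * cnj (Zl $ c $ b) * (of_nat m * X0 $ c $ a))"
    proof (simp only:)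
      have "(\<Sum>a\<in>UNIV. \<Sum>b\<in>UNIV. \<Sum>c\<in>UNIV. h a b c) = (\<Sum>b\<in>UNIV. \<Sum>c\<in>UNIV. \<Sum>a\<in>UNIV. h a b c)"
        for h :: "'a \<Rightarrow> 'a \<Rightarrow> 'a \<Rightarrow> complex"
        by (subst sum.swap) (intro sum.cong refl sum.swap)
      then show "(\<Sum>a\<in>UNIV. \<Sum>b\<in>UNIV. \<Sum>c\<in>UNIV. Zl $ a $ b * cnj (Zl $ c $ b) * (of_nat m * X0 $ c $ a))
        = (\<Sum>b\<in>UNIV. \<Sum>c\<in>UNIV. \<Sum>a\<in>UNIV. Zl $ a $ b * cnj (Zl $ c $ b) * (of_nat m * X0 $ c $ a))" .
    qed
    also have "\<dots> = of_nat m * (\<Sum>b\<in>UNIV. cip (column b Zl) (X0 *v column b Zl))"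
      unfolding cip_def matrix_vector_mult_def column_def
      by (simp add: sum_distrib_left algebra_simps)
    finally show ?thesis .
  qed
  ultimately have "(\<Sum>b\<in>UNIV. cip (column b Zl) (X0 *v column b Zl)) = 0" using m by simp
  then have "Re (\<Sum>b\<in>UNIV. cip (column b Zl) (X0 *v column b Zl)) = 0" by simp
  then have "(\<Sum>b\<in>UNIV. Re (cip (column b Zl) (X0 *v column b Zl))) = 0" by (simp only: Re_sum)
  then have "Re (cip (column b Zl) (X0 *v column b Zl)) = 0" for b
    using psdD(2)[OF pos_def_imp_psd[OF pd]] by (simp add: sum_nonneg_eq_0_iff)
  then have "column b Zl = 0" for b by (rule pos_def_zero_form[OF pd])
  then have "Zl = 0" by (simp add: cmat_eq_iff column_def vec_eq_iff)
  then show False using Zl0 by simp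
qed

end

subsection \<open>Algebraic characterisation of irreducible maps of degree \<open>m\<close>\<close>

text \<open>From spectrum to algebra. A Kraus list of minimal length is independent, the
  \<open>m\<close> peripheral eigenvalues are a group and hence the \<open>m\<close>-th roots of
  unity, and \<open>beta\<close> supplies \<open>U\<close>.\<close>

lemma I_TP_imp_kraus:
  assumes T: "T \<in> I_TP r m" and m: "0 < m"
  obtains A X0 U N where "T = kmap r A" "tp_irr r A X0" "kindep r A"
    "unitary U" "mpow U m = mat 1" "intertwines r A (beta m) U" "spans r N m A"
proof -
  have cp: "is_CP T" and tp: "trace_preserving T" and kr: "kraus_rank T = r" and irr: "irreducible_map T"
    and card: "card (peripheral_spectrum T) = m"
    using T by (auto simp: I_TP_def irreducible_deg_def)
  have "\<exists>As. length As = kraus_rank T \<and> T = kraus_map As"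
    unfolding kraus_rank_def by (rule LeastI_ex) (use cp in \<open>auto simp: is_CP_def\<close>)
  then obtain A where TA: "T = kmap r A" using kr kraus_map_eq_kmap by metis
  define \<rho> where "\<rho> = complex_of_real (spectral_radius_map T)"
  obtain X where X: "pos_def X" "T X = smul \<rho> X" and nd: "nondegenerate_eigenvalue T \<rho>"
    using irr by (auto simp: irreducible_map_def \<rho>_def Let_def)
  have trX: "trace X \<noteq> 0" using psd_trace_0[OF pos_def_imp_psd[OF X(1)]] pos_def_nonzero[OF X(1)] by blast
  \<comment> \<open>Trace preservation allows only the eigenvalue 1 for an eigenvector of nonzero
    trace.\<close>
  have "trace X = \<rho> * trace X" using tp X(2) by (metis trace_preserving_def trace_smul)
  then have r1: "\<rho> = 1" using trX by simp
  have g: "gram r A = mat 1" using tp by (simp add: TA trace_preserving_kmap)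
  have tX: "trace X = of_real (Re (trace X))" "Re (trace X) > 0"
    using trace_psd[OF pos_def_imp_psd[OF X(1)]] trX by (auto simp: less_le)
  define X0 where "X0 = (1 / Re (trace X)) *\<^sub>R X"
  have pd: "pos_def X0"
    unfolding pos_def_cip X0_def
    using X(1) tX(2) by (auto simp: pos_def_cip adj_scaleR scaleR_mv cip_scaleR_right)
  have fX0: "kmap r A X0 = X0" using X(2) unfolding TA X0_def by (simp add: kmap_scaleR r1)
  have trX0: "trace X0 = 1" unfolding X0_def trace_scaleR_of_real by (subst tX(1)) (use tX(2) in simp)
  interpret tp: tp_kraus r A X0 by unfold_locales (use g pd fX0 trX0 in auto)
  \<comment> \<open>Nondegeneracy is given for the map and wanted for its dual. A fixed point
    \<open>Y\<close> of the dual is carried to the fixed point \<open>Y ** X0\<close> of the map,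
    and multiplication by \<open>X0\<close> is injective.\<close>
  have fixE: "\<exists>c. Y = smul c (mat 1)" if Y: "kmap r (dag A) Y = Y" for Y
  proof -
    have "Y ** A i = smul 1 (A i ** Y)" if "i < r" for i
      by (rule tp.eigen_intertwine) (use Y that in auto)
    then have "T (Y ** X0) = Y ** X0" using tp.dual_transfer[of Y 1] by (simp add: TA)
    then have *: "Y ** X0 \<in> {W. \<exists>k. ((\<lambda>Y. T Y - smul 1 Y) ^^ k) W = 0}" "X0 \<in> {W. \<exists>k. ((\<lambda>Y. T Y - smul 1 Y) ^^ k) W = 0}"
      using fX0 by (auto simp: TA intro!: exI[of _ 1])
    obtain X1 where X1: "{W. \<exists>k. ((\<lambda>Y. T Y - smul 1 Y) ^^ k) W = 0} = {smul c X1 | c. True}"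
      using nd unfolding nondegenerate_eigenvalue_def r1 by blast
    obtain c d where cd: "Y ** X0 = smul c X1" "X0 = smul d X1" using * unfolding X1 by blast
    have "d \<noteq> 0" using cd(2) pos_def_nonzero[OF pd] by auto
    then have "(Y - smul (c / d) (mat 1)) ** X0 = 0" by (simp add: mat_distribs cd(1)) (simp add: cd(2))
    then have "Y - smul (c / d) (mat 1) = 0" by (rule tp.mult_X0_eq_0)
    then show ?thesis by auto
  qed
  interpret tp_irr r A X0 by unfold_locales (rule fixE)
  have sg: "spec_group r A = {z. z ^ m = 1}"
    using spec_group_roots[OF _ m] card peripheral_spectrum_eq TA by metis
  then have "beta m \<in> spec_group r A" using beta_power_m[OF m] by simp
  then obtain V where V: "unitary V" "intertwines r A (beta m) V" by (auto simp: spec_group_def)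
  obtain d where d: "unitary (smul d V)" "mpow (smul d V) m = mat 1" "intertwines r A (beta m) (smul d V)"
    using cyclic_unitary[OF m V] by blast
  obtain N where N: "spans r N m (dag A)" using eventually_spans_dag[of m] sg m by auto
  show thesis
  proof (rule that)
    show "tp_irr r A X0" by (rule tp_irr_axioms)
    show "kindep r A" using kr unfolding TA by (rule kraus_rank_eq_imp_kindep)
    show "spans r N m A" by (rule spans_dag_imp[OF N])
  qed (use TA d in auto)
qed

text \<open>A fixed point of the dual commutes with every Kraus operator, hence with every word, and
  the words span.\<close>

lemma spans_fixed_scalar:
  assumes "tp_kraus r A X0" and sp: "irr r A" and Y: "kmap r (dag A) Y = Y"
  shows "\<exists>c. Y = smul c (mat 1)"
proof (rule scalar_of_commute)
  interpret tp_kraus r A X0 by fact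
  have "intertwines r A 1 Y" unfolding intertwines_def using eigen_intertwine[of Y 1] Y by simp
  then have w: "Y ** wprod A w = wprod A w ** Y" if "set w \<subseteq> {..<r}" for w
    using intertwines_wprod[OF _ that] by fastforce
  fix M
  have "trace ((Y ** M - M ** Y) ** wprod A w) = 0" if "set w \<subseteq> {..<r}" for w
  proof -
    have "trace (Y ** M ** wprod A w) = trace (M ** (wprod A w ** Y))"
      by (metis mat_assoc trace_rotate)
    then show ?thesis by (simp add: mat_distribs trace_sub mat_assoc w[OF that])
  qed
  then have "Y ** M - M ** Y = 0" using sp unfolding irr_def by blast
  then show "Y ** M = M ** Y" by simp
qed

text \<open>From algebra to spectrum. The powers of \<open>U\<close> provide all \<open>m\<close>-th
  roots of unity, and words of nonzero trace exclude any further peripheral eigenvalue.\<close>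

lemma kraus_imp_I_TP:
  assumes m: "0 < m" and g: "gram r A = mat 1" and ki: "kindep r A" and U: "unitary U" "intertwines r A (beta m) U"
    and sp: "spans r N m A"
  shows "kmap r A \<in> I_TP r m"
proof -
  let ?T = "kmap r A"
  have irr: "irr r A" by (rule spans_imp_irr[OF sp])
  obtain X0 where X0: "pos_def X0" "trace X0 = 1" "?T X0 = X0" using tp_fixed_point[OF irr g] by blast
  interpret tpk: tp_kraus r A X0 by unfold_locales (use g X0 in auto)
  interpret tp_irr r A X0 by unfold_locales (rule spans_fixed_scalar[OF tpk.tp_kraus_axioms irr])
  have sg: "spec_group r A = {z. z ^ m = 1}"
  proof
    show "{z. z ^ m = 1} \<subseteq> spec_group r A"
    proof
      fix z :: complex assume "z \<in> {z. z ^ m = 1}"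
      then obtain j where z: "z = beta m ^ j" unfolding roots_unity_beta[OF m] by blast
      then show "z \<in> spec_group r A"
        unfolding spec_group_def using unitary_mpow[OF U(1), of j] intertwines_mpow[OF U(2), of j]
        by (auto simp: norm_power norm_beta)
    qed
    show "spec_group r A \<subseteq> {z. z ^ m = 1}"
    proof
      fix l assume "l \<in> spec_group r A"
      then obtain V where V: "unitary V" "intertwines r A l V" by (auto simp: spec_group_def)
      \<comment> \<open>Conjugation by a unitary intertwiner keeps the trace of a word and
        multiplies it by the power of the factor, so a word of nonzero trace forces that power to be
        1.\<close>
      have trw: "k ^ length w * trace (wprod A w) = trace (wprod A w)"
        if "unitary W" "intertwines r A k W" "set w \<subseteq> {..<r}" for k W w
      proof -
        have "trace (wprod A w) = trace ((W ** wprod A w) ** adj W)"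
          using \<open>unitary W\<close> unfolding unitary_def by (metis mat_assoc matrix_mul_lid trace_mul_sym)
        also have "\<dots> = trace (smul (k ^ length w) (wprod A w ** (W ** adj W)))"
          unfolding intertwines_wprod[OF that(2,3)] by (simp add: mat_distribs mat_assoc)
        also have "\<dots> = k ^ length w * trace (wprod A w)"
          using \<open>unitary W\<close> by (simp add: unitary_def trace_smul)
        finally show ?thesis by simp
      qed
      \<comment> \<open>Spanning gives a word of nonzero trace in the window starting at
        \<open>m * N'\<close>. By \<open>U\<close> its length is a multiple of \<open>m\<close>, and
        \<open>m * N'\<close> is the only one in the window. Two consecutive \<open>N'\<close> then
        give \<open>l^m = 1\<close>.\<close>
      have pw: "l ^ (m * N') = 1" if "N \<le> N'" for N'
      proof -
        have "N \<le> m * N'" using that m by (metis le_trans mult_le_mono1 nat_mult_1 Suc_leI One_nat_def)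
        then have "spans r (m * N') m A" using spans_mono[OF sp g] by blast
        then obtain w where w: "set w \<subseteq> {..<r}" "m * N' \<le> length w" "length w < m * N' + m" "trace (wprod A w) \<noteq> 0"
          unfolding spans_def using mat1_neq_0 matrix_mul_lid by metis
        have "beta m ^ length w = 1" using trw[OF U w(1)] w(4) by simp
        then have "m dvd length w" by (simp add: beta_power_eq_1[OF m])
        then have "length w = m * N'"
          using w(2,3) m by (auto elim!: dvdE) (metis Suc_leI le_antisym less_Suc_eq_le mult_Suc_right mult_less_cancel1 nat_mult_le_cancel1 add.commute)
        then show ?thesis using trw[OF V w(1)] w(4) by simp
      qed
      have "l ^ (m * N) * l ^ m = 1" using pw[of "Suc N"] by (simp add: power_add mult.commute)
      then show "l \<in> {z. z ^ m = 1}" using pw[of N] by simp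
    qed
  qed
  have card: "card (peripheral_spectrum ?T) = m"
    using card_roots_unity_eq[of m] m by (simp add: peripheral_spectrum_eq sg)
  have nd: "nondegenerate_eigenvalue ?T 1"
    unfolding nondegenerate_eigenvalue_def
  proof (intro exI conjI)
    show "X0 \<noteq> 0" by (rule pos_def_nonzero[OF X0(1)])
    define G where "G = (\<lambda>Y. ?T Y - smul 1 Y)"
    \<comment> \<open>A Jordan chain would need \<open>G X\<close> to be a nonzero multiple of
      \<open>X0\<close>, but \<open>G X\<close> has trace 0 and \<open>X0\<close> has trace
      1.\<close>
    have "\<exists>c. X = smul c X0" if "(G ^^ k) X = 0" for k X
      using that
    proof (induction k arbitrary: X)
      case 0
      then show ?case by (intro exI[of _ 0]) simp
    next
      case (Suc k)
      have "(G ^^ k) (G X) = 0" using Suc.prems by (simp add: funpow_swap1)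
      then obtain c where c: "G X = smul c X0" using Suc.IH by blast
      have "trace (G X) = 0" by (simp add: G_def trace_sub trace_kmap g)
      then have "c = 0" by (simp add: c trace_smul X0)
      then have "?T X = X" using c by (simp add: G_def)
      then show ?case by (rule tp_fixed_unique[OF irr g X0])
    qed
    moreover have "(G ^^ 1) (smul c X0) = 0" for c by (simp add: G_def kmap_smul X0)
    ultimately have "{X. \<exists>k. (G ^^ k) X = 0} = {smul c X0 | c. True}" by blast
    then show "{X. \<exists>k. ((\<lambda>Y. ?T Y - smul 1 Y) ^^ k) X = 0} = {smul c X0 | c. True}" by (simp only: G_def)
  qed
  have "\<exists>X. pos_def X \<and> ?T X = smul 1 X"
    by (rule exI[of _ X0]) (simp add: X0)
  moreover have "\<exists>Y. pos_def Y \<and> kmap r (dag A) Y = smul (cnj 1) Y"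
    by (rule exI[of _ "mat 1"]) (simp add: pos_def_one kmap_dag_one g)
  ultimately have "irreducible_map ?T"
    unfolding irreducible_map_def Let_def spectral_radius_one dual_map_kmap of_real_1
    using one_in_spectrum nd by blast
  then show ?thesis
    unfolding I_TP_def irreducible_deg_def
    using is_CP_kmap trace_preserving_kmap g kindep_imp_kraus_rank[OF ki] card by auto
qed

subsection \<open>Genericity via determinants\<close>

lemma det_neq_0_iff_ker:
  fixes M :: "complex^'N::finite^'N"
  shows "det M \<noteq> 0 \<longleftrightarrow> (\<forall>z. M *v z = 0 \<longrightarrow> z = 0)"
  by (metis invertible_det_nz invertible_left_inverse matrix_left_invertible_ker)

text \<open>An independent set is listed along the index type and padded with 0, so that it can form
  the rows of a square matrix.\<close>

lemma enumerate_independent: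
  fixes B :: "(complex^'N::finite) set"
  assumes "vec.independent B"
  obtains g :: "'N \<Rightarrow> complex^'N" where "B \<subseteq> range g" "range g \<subseteq> insert 0 B"
proof -
  have fin: "finite B" by (rule vec.finiteI_independent[OF assms])
  have "card B \<le> vec.dim (UNIV :: (complex^'N) set)"
    by (rule vec.independent_card_le_dim[OF _ assms]) simp
  then have "card B \<le> CARD('N)" by (simp only: vec_dim_card)
  then obtain e :: "complex^'N \<Rightarrow> 'N" where e: "inj_on e B"
    using card_le_inj[OF fin, of "UNIV :: 'N set"] by auto
  show thesis
  proof (rule that[of "\<lambda>a. if a \<in> e ` B then inv_into B e a else 0"])
    show "B \<subseteq> range (\<lambda>a. if a \<in> e ` B then inv_into B e a else 0)"
    proof
      fix b assume "b \<in> B"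
      then have "b = (if e b \<in> e ` B then inv_into B e (e b) else 0)" using e by simp
      then show "b \<in> range (\<lambda>a. if a \<in> e ` B then inv_into B e a else 0)" by blast
    qed
  qed (auto simp: inv_into_into)
qed

lemma det_rows_nonzero:
  fixes g :: "'N::finite \<Rightarrow> complex^'N"
  assumes B: "B \<subseteq> range g" and ann: "\<And>z. (\<And>b. b \<in> B \<Longrightarrow> (\<Sum>p\<in>UNIV. z $ p * b $ p) = 0) \<Longrightarrow> z = 0"
  shows "det (\<chi> a. g a) \<noteq> 0"
  unfolding det_neq_0_iff_ker
proof (intro allI impI)
  fix z assume z: "(\<chi> a. g a) *v z = 0"
  show "z = 0"
  proof (rule ann)
    fix b assume "b \<in> B"
    then obtain a where a: "b = g a" using B by blast
    have "((\<chi> a. g a) *v z) $ a = 0" by (simp add: z)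
    then show "(\<Sum>p\<in>UNIV. z $ p * b $ p) = 0"
      by (simp add: a matrix_vector_mult_def mult.commute)
  qed
qed

lemma annihilates_span:
  fixes z :: "complex^'N::finite"
  assumes "\<And>b. b \<in> B \<Longrightarrow> (\<Sum>p\<in>UNIV. z $ p * b $ p) = 0" "x \<in> vec.span B"
  shows "(\<Sum>p\<in>UNIV. z $ p * x $ p) = 0"
proof -
  define V where "V = {x. (\<Sum>p\<in>UNIV. z $ p * x $ p) = 0}"
  have "vec.subspace V"
    unfolding vec.subspace_def V_def
    by (auto simp: algebra_simps sum.distrib sum_distrib_left[symmetric])
  moreover have "B \<subseteq> V" using assms(1) by (auto simp: V_def)
  ultimately have "vec.span B \<subseteq> V" by (simp add: vec.span_minimal)
  then show ?thesis using assms(2) by (auto simp: V_def)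
qed

text \<open>The choice \<open>f\<close> of words stays fixed while the tuple varies. The determinant
  is a polynomial in the entries of the tuple, which makes spanning an open and generic
  condition.\<close>

definition word_det :: "('n \<times> 'n \<Rightarrow> nat list) \<Rightarrow> (nat \<Rightarrow> 'n::finite cmat) \<Rightarrow> complex" where
  "word_det f A = det (\<chi> p. flat (wprod A (f p)))"

definition window :: "nat \<Rightarrow> nat \<Rightarrow> nat \<Rightarrow> nat list set" where
  "window r N m = {w. set w \<subseteq> {..<r} \<and> N \<le> length w \<and> length w < N + m}"

lemma spans_alt:
  "spans r N m A \<longleftrightarrow> (\<forall>z. (\<forall>w\<in>window r N m. (\<Sum>p\<in>UNIV. z $ p * flat (wprod A w) $ p) = 0) \<longrightarrow> z = 0)"
proof -
  have "trace (Z ** M) = (\<Sum>p\<in>UNIV. flat (transpose Z) $ p * flat M $ p)" for Z M :: "'a cmat"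
    using trace_transpose_mult[of "transpose Z" M] by simp
  then have "spans r N m A \<longleftrightarrow> (\<forall>Z. (\<forall>w\<in>window r N m. (\<Sum>p\<in>UNIV. flat (transpose Z) $ p * flat (wprod A w) $ p) = 0) \<longrightarrow> Z = 0)"
    unfolding spans_def window_def by auto
  also have "\<dots> \<longleftrightarrow> (\<forall>z. (\<forall>w\<in>window r N m. (\<Sum>p\<in>UNIV. z $ p * flat (wprod A w) $ p) = 0) \<longrightarrow> z = 0)"
  proof (intro iffI allI impI)
    fix z assume *: "\<forall>Z. (\<forall>w\<in>window r N m. (\<Sum>p\<in>UNIV. flat (transpose Z) $ p * flat (wprod A w) $ p) = 0) \<longrightarrow> Z = 0"
      and "\<forall>w\<in>window r N m. (\<Sum>p\<in>UNIV. z $ p * flat (wprod A w) $ p) = 0"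
    then have "transpose (unflat z) = 0" by simp
    then have "unflat z = 0" by (metis transpose_transpose transpose_mat mat_0)
    then show "z = 0" by (metis flat_eq_0_iff flat_unflat)
  next
    fix Z assume "\<forall>z. (\<forall>w\<in>window r N m. (\<Sum>p\<in>UNIV. z $ p * flat (wprod A w) $ p) = 0) \<longrightarrow> z = 0"
      "\<forall>w\<in>window r N m. (\<Sum>p\<in>UNIV. flat (transpose Z) $ p * flat (wprod A w) $ p) = 0"
    then have "flat (transpose Z) = 0" by blast
    then have "transpose Z = 0" by simp
    then show "Z = 0" by (metis transpose_transpose transpose_mat mat_0)
  qed
  finally show ?thesis .
qed

lemma spans_word_det:
  fixes A :: "nat \<Rightarrow> 'n::finite cmat"
  assumes "spans r N m A"
  obtains f where "\<And>p. f p \<in> window r N m" "word_det f A \<noteq> 0"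
proof -
  define S where "S = (\<lambda>w. flat (wprod A w)) ` window r N m"
  obtain B where B: "B \<subseteq> S" "vec.independent B" "S \<subseteq> vec.span B"
    by (rule vec.maximal_independent_subset)
  obtain g :: "'n \<times> 'n \<Rightarrow> complex^('n \<times> 'n)" where g: "B \<subseteq> range g" "range g \<subseteq> insert 0 B"
    by (rule enumerate_independent[OF B(2)])
  have det: "det (\<chi> a. g a) \<noteq> 0"
  proof (rule det_rows_nonzero[OF g(1)])
    fix z assume z: "\<And>b. b \<in> B \<Longrightarrow> (\<Sum>p\<in>UNIV. z $ p * b $ p) = 0"
    have "(\<Sum>p\<in>UNIV. z $ p * flat (wprod A w) $ p) = 0" if "w \<in> window r N m" for w
      by (rule annihilates_span[OF z]) (use that B(3) in \<open>auto simp: S_def\<close>)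
    then show "z = 0" using assms unfolding spans_alt by blast
  qed
  \<comment> \<open>A zero row would make the determinant vanish, so no row is padding and each one
    is a word.\<close>
  have "g a \<noteq> 0" for a
  proof
    assume "g a = 0"
    then have "row a (\<chi> a. g a) = 0" by (simp add: row_def vec_eq_iff)
    then show False using det det_zero_row(2) by blast
  qed
  then have "g a \<in> S" for a using g(2) B(1) by (metis insert_iff range_subsetD subsetD)
  then have "\<forall>a. \<exists>w\<in>window r N m. g a = flat (wprod A w)" by (auto simp: S_def)
  then obtain f where f: "\<And>a. f a \<in> window r N m" "\<And>a. g a = flat (wprod A (f a))" by metis
  show thesis by (rule that[of f]) (use f det in \<open>simp_all add: word_det_def\<close>)
qed

lemma word_det_spans:
  assumes "\<And>p. f p \<in> window r N m" "word_det f A \<noteq> 0" shows "spans r N m A"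
  unfolding spans_alt
proof (intro allI impI)
  fix z assume z: "\<forall>w\<in>window r N m. (\<Sum>p\<in>UNIV. z $ p * flat (wprod A w) $ p) = 0"
  have "(\<chi> p. flat (wprod A (f p))) *v z = 0"
    using z assms(1) by (simp add: vec_eq_iff matrix_vector_mult_def mult.commute)
  then show "z = 0" using assms(2) unfolding word_det_def det_neq_0_iff_ker by blast
qed

text \<open>Completion by constant rows \<open>C\<close> turns independence of fewer than
  \<open>D^2\<close> matrices into a single determinant. An index \<open>h p\<close> of at least
  \<open>r\<close> marks a row taken from \<open>C\<close>.\<close>

definition indep_det :: "nat \<Rightarrow> ('n \<times> 'n \<Rightarrow> nat) \<Rightarrow> ('n \<times> 'n \<Rightarrow> complex^('n \<times> 'n)) \<Rightarrow> (nat \<Rightarrow> 'n::finite cmat) \<Rightarrow> complex" where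
  "indep_det r h C A = det (\<chi> p. if h p < r then flat (A (h p)) else C p)"

lemma kindep_indep_det:
  fixes A :: "nat \<Rightarrow> 'n::finite cmat"
  assumes "kindep r A"
  obtains h C where "{..<r} \<subseteq> range h" "indep_det r h C A \<noteq> 0"
proof -
  let ?S = "(\<lambda>i. flat (A i)) ` {..<r}"
  obtain B where B: "?S \<subseteq> B" "vec.independent B" "UNIV \<subseteq> vec.span B"
    using vec.maximal_independent_subset_extend[OF _ kindep_flat(2)[OF assms], of UNIV] by auto
  obtain g :: "'n \<times> 'n \<Rightarrow> complex^('n \<times> 'n)" where g: "B \<subseteq> range g" "range g \<subseteq> insert 0 B"
    by (rule enumerate_independent[OF B(2)])
  have det: "det (\<chi> a. g a) \<noteq> 0"
  proof (rule det_rows_nonzero[OF g(1)])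
    fix z :: "complex^('n \<times> 'n)" assume z: "\<And>b. b \<in> B \<Longrightarrow> (\<Sum>p\<in>UNIV. z $ p * b $ p) = 0"
    have "(\<Sum>p\<in>UNIV. z $ p * x $ p) = 0" for x
      by (rule annihilates_span[OF z]) (use B(3) in auto)
    from this[of "\<chi> p. cnj (z $ p)"] have "cip z z = 0"
      by (simp add: cip_def mult.commute)
    then show "z = 0" by (simp only: cip_self_eq_0)
  qed
  \<comment> \<open>The value \<open>r\<close> marks the rows of the completion.\<close>
  define h where "h p = (if g p \<in> ?S then (SOME i. i < r \<and> flat (A i) = g p) else r)" for p
  have h: "h p < r \<and> flat (A (h p)) = g p" if "g p \<in> ?S" for p
  proof -
    have "\<exists>i. i < r \<and> flat (A i) = g p" using that by (metis imageE lessThan_iff)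
    then obtain i where "i < r \<and> flat (A i) = g p" by blast
    then have "(SOME i. i < r \<and> flat (A i) = g p) < r \<and> flat (A (SOME i. i < r \<and> flat (A i) = g p)) = g p"
      by (rule someI)
    then show ?thesis using that by (simp only: h_def if_True simp_thms)
  qed
  have h': "h p < r \<longleftrightarrow> g p \<in> ?S" for p using h[of p] by (auto simp: h_def)
  show thesis
  proof (rule that[of h g])
    show "{..<r} \<subseteq> range h"
    proof
      fix i assume i: "i \<in> {..<r}"
      then have "flat (A i) \<in> B" using B(1) by auto
      then obtain p where p: "g p = flat (A i)" using g(1) by (metis imageE subsetD)
      have "h p < r \<and> flat (A (h p)) = flat (A i)" using h[of p] p i by auto
      then have "h p = i" using kindep_flat(1)[OF assms] i by (auto simp: inj_on_def)
      then show "i \<in> range h" by blast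
    qed
    have "(\<chi> p. if h p < r then flat (A (h p)) else g p) = (\<chi> p. g p)"
      using h h' by (auto simp: vec_eq_iff)
    then show "indep_det r h g A \<noteq> 0" using det by (simp add: indep_det_def)
  qed
qed

lemma indep_det_kindep:
  fixes A :: "nat \<Rightarrow> 'n::finite cmat"
  assumes h: "{..<r} \<subseteq> range h" and det: "indep_det r h C A \<noteq> 0" shows "kindep r A"
  unfolding kindep_def
proof (intro allI impI)
  fix c i assume c: "(\<Sum>i<r. smul (c i) (A i)) = 0" and i: "i < r"
  define M where "M = (\<chi> p. if h p < r then flat (A (h p)) else C p)"
  \<comment> \<open>\<open>e\<close> picks one row for each Kraus operator; a linear dependency
    becomes a kernel vector \<open>x\<close> of the transpose supported on these rows.\<close>
  define e where "e i = (SOME p. h p = i)" for i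
  have he: "h (e i) = i" if "i < r" for i
    unfolding e_def by (rule someI_ex) (use h that in force)
  define x where "x = (\<chi> p. if h p < r \<and> e (h p) = p then c (h p) else 0)"
  have xz: "x $ p = 0" if "p \<notin> e ` {..<r}" for p
  proof -
    have "\<not> (h p < r \<and> e (h p) = p)" using that by (metis imageI lessThan_iff)
    then show ?thesis unfolding x_def by auto
  qed
  have "transpose M *v x = 0"
  proof -
    have "(transpose M *v x) $ q = 0" for q
    proof -
      have "(transpose M *v x) $ q = (\<Sum>p\<in>UNIV. M $ p $ q * x $ p)"
        by (simp add: matrix_vector_mult_def transpose_def)
      also have "\<dots> = (\<Sum>p\<in>e ` {..<r}. M $ p $ q * x $ p)"
        by (rule sum.mono_neutral_right) (use xz in auto)
      also have "\<dots> = (\<Sum>i<r. M $ e i $ q * x $ e i)"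
        by (subst sum.reindex) (auto intro!: inj_onI, metis he)
      also have "\<dots> = (\<Sum>i<r. c i * flat (A i) $ q)"
        by (intro sum.cong refl) (simp add: M_def x_def he)
      also have "\<dots> = flat (\<Sum>i<r. smul (c i) (A i)) $ q"
        by (simp add: flat_sum flat_smul)
      finally show ?thesis by (simp add: c flat_def)
    qed
    then show ?thesis by (simp add: vec_eq_iff)
  qed
  moreover have "det (transpose M) \<noteq> 0" using det by (simp add: det_transpose M_def indep_det_def)
  ultimately have "x = 0" unfolding det_neq_0_iff_ker by blast
  then have "x $ e i = 0" by simp
  then show "c i = 0" using i by (simp add: x_def he)
qed

lemma tendsto_wprod:
  assumes "\<And>i. i < r \<Longrightarrow> ((\<lambda>n. B n i) \<longlongrightarrow> A i) F" "set w \<subseteq> {..<r}"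
  shows "((\<lambda>n. wprod (B n) w) \<longlongrightarrow> wprod A w) F"
  using assms(2) by (induction w) (auto intro!: tendsto_intros assms(1))

lemma tendsto_det:
  fixes M :: "_ \<Rightarrow> complex^'N::finite^'N"
  assumes "\<And>i j. ((\<lambda>n. M n $ i $ j) \<longlongrightarrow> L $ i $ j) F" shows "((\<lambda>n. det (M n)) \<longlongrightarrow> det L) F"
  unfolding det_def by (intro tendsto_intros assms)

lemma eventually_spans:
  assumes "spans r N m A" and lim: "\<And>i. i < r \<Longrightarrow> ((\<lambda>n. B n i) \<longlongrightarrow> A i) F"
  shows "\<forall>\<^sub>F n in F. spans r N m (B n)"
proof -
  obtain f where f: "\<And>p. f p \<in> window r N m" "word_det f A \<noteq> 0" using spans_word_det[OF assms(1)] by blast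
  have "((\<lambda>n. word_det f (B n)) \<longlongrightarrow> word_det f A) F"
    unfolding word_det_def
    by (rule tendsto_det) (use f(1) in \<open>auto simp: flat_def window_def intro!: tendsto_cmat_nth tendsto_wprod[OF lim]\<close>)
  then have "\<forall>\<^sub>F n in F. word_det f (B n) \<noteq> 0" using f(2) by (rule tendsto_imp_eventually_ne)
  then show ?thesis by eventually_elim (rule word_det_spans[OF f(1)])
qed

lemma eventually_kindep:
  assumes "kindep r A" and lim: "\<And>i. i < r \<Longrightarrow> ((\<lambda>n. B n i) \<longlongrightarrow> A i) F"
  shows "\<forall>\<^sub>F n in F. kindep r (B n)"
proof -
  obtain h C where h: "{..<r} \<subseteq> range h" "indep_det r h C A \<noteq> 0" using kindep_indep_det[OF assms(1)] by blast
  have "((\<lambda>n. indep_det r h C (B n)) \<longlongrightarrow> indep_det r h C A) F"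
    unfolding indep_det_def
    by (rule tendsto_det) (auto simp: flat_def intro!: tendsto_cmat_nth lim)
  then have "\<forall>\<^sub>F n in F. indep_det r h C (B n) \<noteq> 0" using h(2) by (rule tendsto_imp_eventually_ne)
  then show ?thesis by eventually_elim (rule indep_det_kindep[OF h(1)])
qed

section \<open>Polynomial conditions on complex lines\<close>

definition is_poly :: "(complex \<Rightarrow> complex) \<Rightarrow> bool" where
  "is_poly f \<longleftrightarrow> (\<exists>p. f = poly p)"

lemma is_poly_const: "is_poly (\<lambda>z. c)"
  unfolding is_poly_def by (rule exI[of _ "[:c:]"]) auto
lemma is_poly_ident: "is_poly (\<lambda>z. z)"
  unfolding is_poly_def by (rule exI[of _ "[:0, 1:]"]) auto
lemma is_poly_add: assumes "is_poly f" "is_poly g" shows "is_poly (\<lambda>z. f z + g z)"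
proof -
  obtain p q where "f = poly p" "g = poly q" using assms by (auto simp: is_poly_def)
  then have "(\<lambda>z. f z + g z) = poly (p + q)" by auto
  then show ?thesis unfolding is_poly_def by blast
qed
lemma is_poly_mult: assumes "is_poly f" "is_poly g" shows "is_poly (\<lambda>z. f z * g z)"
proof -
  obtain p q where "f = poly p" "g = poly q" using assms by (auto simp: is_poly_def)
  then have "(\<lambda>z. f z * g z) = poly (p * q)" by auto
  then show ?thesis unfolding is_poly_def by blast
qed
lemma is_poly_sum: "(\<And>i. i \<in> S \<Longrightarrow> is_poly (f i)) \<Longrightarrow> is_poly (\<lambda>z. \<Sum>i\<in>S. f i z)"
  by (induction S rule: infinite_finite_induct) (auto intro: is_poly_const is_poly_add)
lemma is_poly_prod: "(\<And>i. i \<in> S \<Longrightarrow> is_poly (f i)) \<Longrightarrow> is_poly (\<lambda>z. \<Prod>i\<in>S. f i z)"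
  by (induction S rule: infinite_finite_induct) (auto intro: is_poly_const is_poly_mult)

lemma is_poly_det: "(\<And>i j. is_poly (\<lambda>z. M z $ i $ j)) \<Longrightarrow> is_poly (\<lambda>z. det (M z))"
  unfolding det_def by (intro is_poly_sum is_poly_mult is_poly_const is_poly_prod)

lemma is_poly_finite_zeros:
  assumes "is_poly f" "f z0 \<noteq> 0" shows "finite {z. f z = 0}"
proof -
  obtain p where p: "f = poly p" using assms(1) by (auto simp: is_poly_def)
  then have "p \<noteq> 0" using assms(2) by auto
  then show ?thesis using poly_roots_finite p by blast
qed

lemma is_poly_wprod:
  "(\<And>i j k. is_poly (\<lambda>z. A z i $ j $ k)) \<Longrightarrow> is_poly (\<lambda>z. wprod (A z) w $ j $ k)"
  by (induction w arbitrary: j k)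
     (auto simp: matrix_mult_nth intro!: is_poly_const is_poly_sum is_poly_mult)

definition cline :: "'n::finite cmat \<Rightarrow> 'n cmat \<Rightarrow> complex \<Rightarrow> 'n cmat" where
  "cline A B z = A + smul z (B - A)"

lemma cline_ends [simp]: "cline A B 0 = A" "cline A B 1 = B"
  by (simp_all add: cline_def)

lemma is_poly_cline: "is_poly (\<lambda>z. cline A B z $ i $ j)"
  unfolding cline_def by (simp) (intro is_poly_add is_poly_mult is_poly_const is_poly_ident)

lemma avoiding_path:
  assumes "finite (F :: complex set)" "0 \<notin> F" "1 \<notin> F"
  obtains g where "path g" "g 0 = 0" "g 1 = (1::complex)" "\<And>t. t \<in> {0..1} \<Longrightarrow> g t \<notin> F"
proof -
  have "path_connected (- F)"
    using path_connected_complement_countable[of F] assms(1) by (simp add: uncountable_infinite countable_finite)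
  then obtain g where "path g" "path_image g \<subseteq> - F" "pathstart g = 0" "pathfinish g = 1"
    using assms(2,3) unfolding path_connected_def by (metis ComplI)
  then show thesis using that[of g] by (auto simp: pathstart_def pathfinish_def path_image_def image_subset_iff)
qed

text \<open>A polynomial condition that holds at both end points of a complex line fails only
  at finitely many points, so the end points can be joined within the line.\<close>
lemma generic_line_path:
  fixes A0 A1 :: "nat \<Rightarrow> 'n::finite cmat"
  assumes k0: "kindep r A0" and k1: "kindep r A1" and s0: "spans r N m A0" and s1: "spans r N m A1"
  obtains g where "path g" "g 0 = 0" "g 1 = (1::complex)"
    "\<And>t. t \<in> {0..1} \<Longrightarrow> kindep r (\<lambda>i. cline (A0 i) (A1 i) (g t)) \<and> spans r N m (\<lambda>i. cline (A0 i) (A1 i) (g t))"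
proof -
  define A where "A z i = cline (A0 i) (A1 i) z" for z i
  have A01: "A 0 = A0" "A 1 = A1" by (simp_all add: A_def fun_eq_iff)
  have pA: "is_poly (\<lambda>z. A z i $ j $ k)" for i j k unfolding A_def by (rule is_poly_cline)
  have pW: "is_poly (\<lambda>z. word_det f (A z))" for f
    unfolding word_det_def by (rule is_poly_det) (simp add: flat_def is_poly_wprod pA)
  have pI: "is_poly (\<lambda>z. indep_det r h C (A z))" for h C
    unfolding indep_det_def
  proof (rule is_poly_det)
    fix i j show "is_poly (\<lambda>z. (\<chi> p. if h p < r then flat (A z (h p)) else C p) $ i $ j)"
      by (cases "h i < r") (simp_all add: flat_def pA is_poly_const)
  qed
  obtain f0 f1 where f0: "\<And>p. f0 p \<in> window r N m" "word_det f0 A0 \<noteq> 0"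
    and f1: "\<And>p. f1 p \<in> window r N m" "word_det f1 A1 \<noteq> 0"
    using spans_word_det[OF s0] spans_word_det[OF s1] by metis
  obtain h0 C0 h1 C1 where h0: "{..<r} \<subseteq> range h0" "indep_det r h0 C0 A0 \<noteq> 0"
    and h1: "{..<r} \<subseteq> range h1" "indep_det r h1 C1 A1 \<noteq> 0"
    using kindep_indep_det[OF k0] kindep_indep_det[OF k1] by metis
  \<comment> \<open>Each property has one determinant certifying it at 0 and another certifying it
    at 1. A point is bad only if both vanish, so neither end point is bad, and the zeros of the
    first determinant alone are already finite in number.\<close>
  define F where "F = ({z. word_det f0 (A z) = 0} \<inter> {z. word_det f1 (A z) = 0})
     \<union> ({z. indep_det r h0 C0 (A z) = 0} \<inter> {z. indep_det r h1 C1 (A z) = 0})"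
  have "finite {z. word_det f0 (A z) = 0}" "finite {z. indep_det r h0 C0 (A z) = 0}"
    using is_poly_finite_zeros[OF pW, of f0 0] is_poly_finite_zeros[OF pI, of h0 C0 0] f0 h0 by (simp_all add: A01)
  then have "finite F" by (simp add: F_def)
  moreover have "0 \<notin> F" "1 \<notin> F" using f0 f1 h0 h1 by (simp_all add: F_def A01)
  ultimately obtain g where g: "path g" "g 0 = 0" "g 1 = 1" "\<And>t. t \<in> {0..1} \<Longrightarrow> g t \<notin> F"
    using avoiding_path by blast
  show thesis
  proof (rule that[OF g(1-3)])
    fix t :: real assume "t \<in> {0..1}"
    then have "g t \<notin> F" by (rule g(4))
    then have "word_det f0 (A (g t)) \<noteq> 0 \<or> word_det f1 (A (g t)) \<noteq> 0"
      "indep_det r h0 C0 (A (g t)) \<noteq> 0 \<or> indep_det r h1 C1 (A (g t)) \<noteq> 0"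
      by (auto simp: F_def)
    then have "kindep r (A (g t)) \<and> spans r N m (A (g t))"
      using word_det_spans[of f0 r N m "A (g t)", OF f0(1)] word_det_spans[of f1 r N m "A (g t)", OF f1(1)]
        indep_det_kindep[OF h0(1), of C0 "A (g t)"] indep_det_kindep[OF h1(1), of C1 "A (g t)"]
      by argo
    then show "kindep r (\<lambda>i. cline (A0 i) (A1 i) (g t)) \<and> spans r N m (\<lambda>i. cline (A0 i) (A1 i) (g t))"
      by (simp add: A_def[abs_def])
  qed
qed

subsection \<open>Trace-preserving normalisation\<close>

text \<open>By compactness the forms on unit vectors lie between constants \<open>e > 0\<close> and
  \<open>M\<close> along the whole path. Dividing by \<open>M\<close> puts the matrices within
  \<open>1 - e / M < 1\<close> of the identity, with one scale for all \<open>t\<close>, so that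
  continuity is not lost.\<close>

lemma pos_def_path_scale:
  fixes \<sigma> :: "real \<Rightarrow> 'n::finite cmat"
  assumes cont: "continuous_on {0..1} \<sigma>" and pd: "\<And>t. t \<in> {0..1} \<Longrightarrow> pos_def (\<sigma> t)"
  obtains c q where "0 < c" "0 \<le> q" "q < 1" "\<And>t. t \<in> {0..1} \<Longrightarrow> opn q (mat 1 - c *\<^sub>R \<sigma> t)"
proof -
  define K where "K = {0..1::real} \<times> sphere (0::complex^'n) 1"
  define f where "f x = Re (cip (snd x) (\<sigma> (fst x) *v snd x))" for x
  have K: "compact K" "K \<noteq> {}" by (auto simp: K_def intro!: compact_Times)
  have "continuous_on K (\<lambda>x. \<sigma> (fst x))"
    by (rule continuous_on_compose2[OF cont]) (auto simp: K_def intro!: continuous_intros)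
  then have cf: "continuous_on K f"
    unfolding f_def by (intro continuous_intros)
  obtain x0 where x0: "x0 \<in> K" "\<And>x. x \<in> K \<Longrightarrow> f x0 \<le> f x"
    using continuous_attains_inf[OF K cf] by blast
  obtain x1 where x1: "x1 \<in> K" "\<And>x. x \<in> K \<Longrightarrow> f x \<le> f x1"
    using continuous_attains_sup[OF K cf] by blast
  have pos: "f x > 0" if "x \<in> K" for x
    using that pd[of "fst x"] unfolding f_def K_def pos_def_cip by (cases "snd x = 0") auto
  define e M where "e = f x0" and "M = f x1"
  have eM: "0 < e" "e \<le> M" "0 < M" using x0 x1 pos by (auto simp: e_def M_def)
  show thesis
  proof (rule that[of "1 / M" "1 - e / M"])
    fix t :: real assume t: "t \<in> {0..1}"
    have sa: "adj (\<sigma> t) = \<sigma> t" using pd[OF t] by (simp add: pos_def_cip)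
    show "opn (1 - e / M) (mat 1 - (1 / M) *\<^sub>R \<sigma> t)"
    proof (rule opn_herm)
      fix v :: "complex^'n"
      define g where "g = Re (cip v (\<sigma> t *v v))"
      have g: "e * (norm v)\<^sup>2 \<le> g \<and> g \<le> M * (norm v)\<^sup>2"
      proof (cases "v = 0")
        case False
        define y where "y = complex_of_real (1 / norm v) *s v"
        have "norm y = 1" using False by (simp add: y_def norm_vsmult norm_divide)
        then have "(t, y) \<in> K" using t by (simp add: K_def)
        then have "e \<le> f (t, y)" "f (t, y) \<le> M" using x0(2) x1(2) by (auto simp: e_def M_def)
        moreover have "f (t, y) = g / (norm v)\<^sup>2"
          unfolding f_def y_def g_def fst_conv snd_conv mv_smult cip_smult_left cip_smult_right
          by (simp add: power2_eq_square)
        ultimately show ?thesis using False by (simp add: field_simps)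
      qed (simp add: g_def)
      have "Re (cip v ((mat 1 - (1 / M) *\<^sub>R \<sigma> t) *v v)) = (norm v)\<^sup>2 - g / M"
        by (simp add: matrix_vector_mult_diff_rdistrib scaleR_mv cip_diff_right cip_scaleR_right cip_self g_def
            del: of_real_power)
      moreover have "g / M \<le> (norm v)\<^sup>2" "e / M * (norm v)\<^sup>2 \<le> g / M"
        using g eM by (auto simp: field_simps)
      ultimately show "\<bar>Re (cip v ((mat 1 - (1 / M) *\<^sub>R \<sigma> t) *v v))\<bar> \<le> (1 - e / M) * (norm v)\<^sup>2"
        by (simp add: algebra_simps)
    qed (use eM sa in \<open>auto simp: adj_distribs\<close>)
  qed (use eM in auto)
qed

lemma isq_props:
  assumes S: "adj S = S" and q: "opn q (mat 1 - S)" "0 \<le> q" "q < 1"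
  defines "X \<equiv> isq (mat 1 - S)"
  shows "adj X = X" "X ** S = S ** X" "S ** X ** X = mat 1" "X ** X ** S = mat 1"
    "\<And>C. C ** S = S ** C \<Longrightarrow> C ** X = X ** C"
proof -
  show "adj X = X" unfolding X_def by (rule adj_isq[OF q]) (simp add: adj_distribs S)
  show C: "C ** X = X ** C" if "C ** S = S ** C" for C
    unfolding X_def by (rule isq_commute[OF q]) (simp add: mat_distribs that)
  show XS: "X ** S = S ** X" using C[of S] by simp
  show a: "S ** X ** X = mat 1" using isq_square[OF q] by (simp add: X_def)
  show "X ** X ** S = mat 1" using a XS by (metis mat_assoc)
qed

lemma continuous_on_isq_path:
  assumes "continuous_on T S" "0 \<le> q" "q < 1" "\<And>t. t \<in> T \<Longrightarrow> opn q (mat 1 - S t)"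
  shows "continuous_on T (\<lambda>t. isq (mat 1 - S t))"
  by (rule continuous_on_compose2[OF continuous_on_isq[OF assms(2,3)]])
     (use assms in \<open>auto intro!: continuous_intros\<close>)

text \<open>In the intended use \<open>X\<close> is the inverse square root of \<open>S\<close>, so
  \<open>S ** X\<close> is its square root and \<open>B i\<close> is a scaled similarity of
  \<open>A i\<close>. All words undergo the same similarity, which keeps independence and spanning,
  and also the relation with \<open>U\<close> when \<open>U\<close> commutes with \<open>S\<close>
  and \<open>X\<close>.\<close>

locale normalisation =
  fixes r :: nat and A B :: "nat \<Rightarrow> 'n::finite cmat" and S X :: "'n cmat" and k :: complex
  assumes XS: "X ** S = S ** X" and SXX: "S ** X ** X = mat 1"
    and k: "k \<noteq> 0" and B: "\<And>i. i < r \<Longrightarrow> B i = smul k (S ** X ** A i ** X)"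
begin

lemma XSX: "X ** S ** X = mat 1" using XS SXX by metis

lemma cancel: "X ** (S ** (X ** Y)) = Y" "S ** (X ** (X ** Y)) = Y"
  using XSX SXX by (metis matrix_mul_lid mat_assoc)+

lemma wprod_B: "set w \<subseteq> {..<r} \<Longrightarrow> wprod B w = smul (k ^ length w) (S ** X ** wprod A w ** X)"
proof (induction w)
  case Nil
  then show ?case by (simp add: SXX)
next
  case (Cons i w)
  then show ?case by (simp add: B mat_distribs mat_assoc cancel mult.commute)
qed

lemma kindep_B: assumes "kindep r A" shows "kindep r B"
  unfolding kindep_def
proof (intro allI impI)
  fix c i assume c: "(\<Sum>i<r. smul (c i) (B i)) = 0" and i: "i < r"
  have "(\<Sum>i<r. smul (c i) (B i)) = smul k (S ** (X ** ((\<Sum>i<r. smul (c i) (A i)) ** X)))"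
    by (simp add: B mat_distribs smul_sum_right mat_assoc mult.commute)
  then have "S ** (X ** ((\<Sum>i<r. smul (c i) (A i)) ** X)) = 0" using c k by (simp add: smul_eq_0_iff)
  then have "X ** (S ** (X ** ((\<Sum>i<r. smul (c i) (A i)) ** X))) = 0" by simp
  then have "(\<Sum>i<r. smul (c i) (A i)) ** X ** (X ** S) = 0" by (simp add: cancel)
  moreover have "X ** (X ** S) = mat 1" using XS SXX by (metis mat_assoc)
  ultimately have "(\<Sum>i<r. smul (c i) (A i)) = 0" by (metis mat_assoc matrix_mul_rid)
  then show "c i = 0" using assms i unfolding kindep_def by blast
qed

lemma spans_B: assumes "spans r N m A" shows "spans r N m B"
  unfolding spans_def
proof (intro allI impI)
  fix Z assume Z: "\<forall>w. set w \<subseteq> {..<r} \<and> N \<le> length w \<and> length w < N + m \<longrightarrow> trace (Z ** wprod B w) = 0"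
  have "trace ((X ** Z ** S ** X) ** wprod A w) = 0"
    if w: "set w \<subseteq> {..<r}" "N \<le> length w" "length w < N + m" for w
  proof -
    have "trace (Z ** wprod B w) = k ^ length w * trace (Z ** (S ** X ** wprod A w ** X))"
      by (simp add: wprod_B w mat_distribs trace_smul)
    also have "trace (Z ** (S ** X ** wprod A w ** X)) = trace ((X ** Z ** S ** X) ** wprod A w)"
      by (metis mat_assoc trace_mul_sym)
    finally show ?thesis using Z w k by simp
  qed
  then have 0: "X ** Z ** S ** X = 0" using assms unfolding spans_def by blast
  have "Z = S ** X ** (X ** Z ** S ** X) ** X"
    using XS SXX by (simp add: mat_assoc cancel)
  then show "Z = 0" unfolding 0 by simp
qed

lemma intertwines_B:
  assumes "intertwines r A l U" "U ** S = S ** U" "U ** X = X ** U" shows "intertwines r B l U"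
  unfolding intertwines_def
proof (intro allI impI)
  fix i assume i: "i < r"
  have "U ** (S ** X ** A i ** X) = S ** X ** (U ** A i) ** X" using assms(2,3) by (metis mat_assoc)
  also have "\<dots> = smul l (S ** X ** A i ** X ** U)"
    using assms(1) i unfolding intertwines_def by (simp add: mat_distribs mat_assoc assms(3))
  finally show "U ** B i = smul l (B i ** U)"
    by (simp add: B i mat_distribs mult.commute)
qed

end

text \<open>Conjugating by \<open>U\<close> gives another density matrix that is an eigenvector of
  the dual for the same eigenvalue; Perron uniqueness identifies the two.\<close>

lemma intertwines_conj_dens:
  assumes U: "unitary U" "intertwines r A l U" "cmod l = 1" and irr: "irr r A"
    and \<sigma>: "\<sigma> \<in> dens_mats" "kmap r (dag A) \<sigma> = smul \<rho> \<sigma>"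
  shows "U ** \<sigma> = \<sigma> ** U"
proof -
  define \<tau> where "\<tau> = adj U ** \<sigma> ** U"
  have "psd \<tau>" using psd_conj[of \<sigma> "adj U"] \<sigma>(1) by (simp add: \<tau>_def dens_mats_def)
  moreover have "trace \<tau> = 1"
  proof -
    have "trace \<tau> = trace (\<sigma> ** (U ** adj U))" unfolding \<tau>_def by (metis mat_assoc trace_rotate)
    then show ?thesis using U(1) \<sigma>(1) by (simp add: unitary_def dens_mats_def)
  qed
  moreover have "kmap r (dag A) \<tau> = smul \<rho> \<tau>"
  proof -
    have "adj (A i) ** \<tau> ** A i = adj U ** (adj (A i) ** \<sigma> ** A i) ** U" if "i < r" for i
    proof -
      have "adj (A i) ** \<tau> ** A i = adj (U ** A i) ** \<sigma> ** (U ** A i)"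
        by (simp add: \<tau>_def adj_mult mat_assoc)
      also have "U ** A i = smul l (A i ** U)" using U(2) that by (simp add: intertwines_def)
      finally show ?thesis
        by (simp add: adj_distribs mat_distribs cnj_mult_self U(3) mat_assoc)
           (simp add: mult.commute[of l] cnj_mult_self U(3))
    qed
    then have "kmap r (dag A) \<tau> = adj U ** kmap r (dag A) \<sigma> ** U"
      unfolding kmap_dag_eq by (simp add: matrix_mult_sum_left matrix_mult_sum_right)
    then show ?thesis by (simp add: \<sigma>(2) mat_distribs \<tau>_def)
  qed
  ultimately have "\<tau> = \<sigma>"
    using perron_unique[OF irr_dag[OF irr], of \<tau> \<rho> \<sigma> \<rho>] \<sigma> by (simp add: dens_mats_def)
  then have "U ** (adj U ** \<sigma> ** U) = U ** \<sigma>" by (simp add: \<tau>_def)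
  then show ?thesis using U(1) by (metis mat_assoc matrix_mul_lid unitary_def)
qed

text \<open>The algebraic side of the characterisation with \<open>N\<close> and \<open>U\<close>
  held fixed, so that it can be carried along a path.\<close>

definition good :: "nat \<Rightarrow> nat \<Rightarrow> nat \<Rightarrow> 'n::finite cmat \<Rightarrow> (nat \<Rightarrow> 'n cmat) \<Rightarrow> bool" where
  "good r N m U A \<longleftrightarrow> gram r A = mat 1 \<and> kindep r A \<and> spans r N m A \<and> intertwines r A (beta m) U"

text \<open>A positive \<open>N\<close> keeps the empty word out of the window, and a zero tuple
  then spans nothing.\<close>

lemma spans_nz:
  fixes A :: "nat \<Rightarrow> 'n::finite cmat"
  assumes "spans r N m A" "0 < N" shows "\<exists>i<r. A i \<noteq> 0"
proof (rule ccontr)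
  assume "\<not> ?thesis"
  then have "wprod A w = 0" if "set w \<subseteq> {..<r}" "0 < length w" for w
    using that by (cases w) auto
  then have "\<forall>w. set w \<subseteq> {..<r} \<and> N \<le> length w \<and> length w < N + m \<longrightarrow> trace (mat 1 ** wprod A w) = 0"
    using assms(2) by force
  then have "(mat 1 :: 'n cmat) = 0" using assms(1) unfolding spans_def by blast
  then show False using mat1_neq_0 by blast
qed

text \<open>The dual Perron eigenvector is continuous along the path by the closed graph theorem,
  being unique in a compact set.\<close>
lemma continuous_perron_path:
  fixes A :: "real \<Rightarrow> nat \<Rightarrow> 'n::finite cmat"
  assumes cont: "\<And>i. i < r \<Longrightarrow> continuous_on {0..1} (\<lambda>t. A t i)"
    and irr: "\<And>t. t \<in> {0..1} \<Longrightarrow> irr r (A t)" and nz: "\<And>t. t \<in> {0..1} \<Longrightarrow> \<exists>i<r. A t i \<noteq> 0"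
  obtains \<sigma> where "continuous_on {0..1} \<sigma>"
    "\<And>t. t \<in> {0..1} \<Longrightarrow> \<sigma> t \<in> dens_mats"
    "\<And>t. t \<in> {0..1} \<Longrightarrow> kmap r (dag (A t)) (\<sigma> t) = smul (trace (kmap r (dag (A t)) (\<sigma> t))) (\<sigma> t)"
proof -
  let ?E = "\<lambda>t. kmap r (dag (A t))"
  have nz': "\<exists>i<r. dag (A t) i \<noteq> 0" if "t \<in> {0..1}" for t
    using nz[OF that] by (simp add: dag_def)
  have "\<exists>X. t \<in> {0..1} \<longrightarrow> X \<in> dens_mats \<and> ?E t X = smul (trace (?E t X)) X" for t
    using perron_exists[OF irr_dag[OF irr] nz'] by metis
  then obtain \<sigma> where \<sigma>: "\<And>t. t \<in> {0..1} \<Longrightarrow> \<sigma> t \<in> dens_mats"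
    "\<And>t. t \<in> {0..1} \<Longrightarrow> ?E t (\<sigma> t) = smul (trace (?E t (\<sigma> t))) (\<sigma> t)" by metis
  define K where "K = {0..1::real} \<times> (dens_mats :: 'n cmat set)"
  define f where "f x = ?E (fst x) (snd x) - smul (trace (?E (fst x) (snd x))) (snd x)" for x
  have "closed K" unfolding K_def by (intro closed_Times) (auto intro: compact_imp_closed compact_dens_mats)
  moreover have "continuous_on K f"
  proof -
    have "continuous_on K (\<lambda>x. A (fst x) i)" if "i < r" for i
      by (rule continuous_on_compose2[OF cont[OF that]]) (auto simp: K_def intro!: continuous_intros)
    then have "continuous_on K (\<lambda>x. ?E (fst x) (snd x))"
      unfolding kmap_dag_eq by (intro continuous_intros) auto
    then show ?thesis unfolding f_def by (intro continuous_intros)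
  qed
  ultimately have "closed {x \<in> K. f x = 0}" by (rule continuous_closed_preimage_constant[rotated])
  moreover have "{x \<in> K. f x = 0} = (\<lambda>t. (t, \<sigma> t)) ` {0..1}"
  proof
    show "(\<lambda>t. (t, \<sigma> t)) ` {0..1} \<subseteq> {x \<in> K. f x = 0}" using \<sigma> by (auto simp: K_def f_def)
    show "{x \<in> K. f x = 0} \<subseteq> (\<lambda>t. (t, \<sigma> t)) ` {0..1}"
    proof
      fix x assume x: "x \<in> {x \<in> K. f x = 0}"
      obtain t X where tX: "x = (t, X)" by (cases x)
      have t: "t \<in> {0..1}" and X: "X \<in> dens_mats" "?E t X = smul (trace (?E t X)) X"
        using x by (auto simp: K_def f_def tX)
      have "X = \<sigma> t"
        by (rule perron_unique[OF irr_dag[OF irr[OF t]] _ _ X(2) _ _ \<sigma>(2)[OF t]])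
           (use X \<sigma>(1)[OF t] in \<open>auto simp: dens_mats_def\<close>)
      then show "x \<in> (\<lambda>t. (t, \<sigma> t)) ` {0..1}" using t tX by blast
    qed
  qed
  ultimately have "continuous_on {0..1} \<sigma>"
    using continuous_from_closed_graph[OF compact_dens_mats, of \<sigma> "{0..1}"] \<sigma>(1) by auto
  then show thesis using that \<sigma> by blast
qed

text \<open>If the dual sends \<sigma> to \<rho> times \<sigma>, then the similarity with the square
  root of \<sigma>, divided by the square root of \<rho>, has Gram matrix 1. Since \<sigma> commutes
  with \<open>U\<close>, the relation with \<open>U\<close> survives.\<close>

lemma good_path:
  fixes A0 A1 :: "nat \<Rightarrow> 'n::finite cmat"
  assumes m: "0 < m" and U: "unitary U" and N: "0 < N" and g0: "good r N m U A0" and g1: "good r N m U A1"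
  obtains B where "\<And>i. i < r \<Longrightarrow> continuous_on {0..1} (\<lambda>t::real. B t i)"
    "\<And>t. t \<in> {0..1} \<Longrightarrow> good r N m U (B t)" "\<And>i. i < r \<Longrightarrow> B 0 i = A0 i" "\<And>i. i < r \<Longrightarrow> B 1 i = A1 i"
proof -
  obtain g where g: "path g" "g 0 = 0" "g 1 = (1::complex)"
    and gg: "\<And>t. t \<in> {0..1} \<Longrightarrow> kindep r (\<lambda>i. cline (A0 i) (A1 i) (g t)) \<and> spans r N m (\<lambda>i. cline (A0 i) (A1 i) (g t))"
    using generic_line_path[of r A0 A1 N m] g0 g1 by (auto simp: good_def)
  define A where "A t i = cline (A0 i) (A1 i) (g t)" for t i
  have Ak: "kindep r (A t)" and As: "spans r N m (A t)" if "t \<in> {0..1}" for t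
    using gg[OF that] by (simp_all add: A_def[abs_def])
  have A01: "A 0 = A0" "A 1 = A1" by (simp_all add: A_def fun_eq_iff g)
  have Acont: "continuous_on {0..1} (\<lambda>t. A t i)" for i
    unfolding A_def cline_def using g(1) by (auto simp: path_def intro!: continuous_intros)
  have AU: "intertwines r (A t) (beta m) U" for t
    using g0 g1 unfolding good_def intertwines_def A_def cline_def
    by (simp add: mat_distribs smul_add_right smul_diff_right mult.commute)
  have irr: "irr r (A t)" if "t \<in> {0..1}" for t by (rule spans_imp_irr[OF As[OF that]])
  let ?E = "\<lambda>t. kmap r (dag (A t))"
  obtain \<sigma> where \<sigma>: "continuous_on {0..1} \<sigma>" "\<And>t. t \<in> {0..1} \<Longrightarrow> \<sigma> t \<in> dens_mats"
    "\<And>t. t \<in> {0..1} \<Longrightarrow> ?E t (\<sigma> t) = smul (trace (?E t (\<sigma> t))) (\<sigma> t)"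
    using continuous_perron_path[OF Acont irr spans_nz[OF As N]] by metis
  have psd: "psd (\<sigma> t)" and nz: "\<sigma> t \<noteq> 0" if "t \<in> {0..1}" for t
    using \<sigma>(2)[OF that] by (auto simp: dens_mats_def)
  have pd: "pos_def (\<sigma> t)" if "t \<in> {0..1}" for t
    by (rule psd_eigen_pos_def[OF irr_dag[OF irr[OF that]] psd[OF that] nz[OF that] \<sigma>(3)[OF that]])
  define \<rho> where "\<rho> t = Re (trace (?E t (\<sigma> t)))" for t
  have tr\<rho>: "trace (?E t (\<sigma> t)) = of_real (\<rho> t)" and \<rho>0: "\<rho> t > 0" if t: "t \<in> {0..1}" for t
  proof -
    have nz': "\<exists>i<r. dag (A t) i \<noteq> 0" using spans_nz[OF As[OF t] N] by (simp add: dag_def)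
    show tr: "trace (?E t (\<sigma> t)) = of_real (\<rho> t)"
      unfolding \<rho>_def by (rule trace_psd(1)[OF psd_kmap[OF psd[OF t]]])
    have "\<rho> t \<noteq> 0" using trace_kmap_nonzero[OF irr_dag[OF irr[OF t]] nz' psd[OF t] nz[OF t]] tr by auto
    moreover have "\<rho> t \<ge> 0" unfolding \<rho>_def by (rule trace_psd(2)[OF psd_kmap[OF psd[OF t]]])
    ultimately show "\<rho> t > 0" by simp
  qed
  obtain c q where c: "0 < c" and q: "0 \<le> q" "q < 1" and op: "\<And>t. t \<in> {0..1} \<Longrightarrow> opn q (mat 1 - c *\<^sub>R \<sigma> t)"
    using pos_def_path_scale[OF \<sigma>(1) pd] by metis
  \<comment> \<open>The factor \<open>c\<close> brings \<sigma> into the range of the Newton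
    iteration; it cancels in the similarity \<open>S ** X ** A ** X\<close>.\<close>
  define S where "S t = c *\<^sub>R \<sigma> t" for t
  define X where "X t = isq (mat 1 - S t)" for t
  define k where "k t = complex_of_real (1 / sqrt (\<rho> t))" for t
  define B where "B t i = smul (k t) (S t ** X t ** A t i ** X t)" for t i
  have Sadj: "adj (S t) = S t" if "t \<in> {0..1}" for t
    using psd[OF that] by (simp add: S_def adj_scaleR psdD(1))
  note X = isq_props[OF Sadj op[folded S_def] q, folded X_def]
  have norm: "normalisation r (A t) (B t) (S t) (X t) (k t)" if t: "t \<in> {0..1}" for t
    by unfold_locales (use X(2,3)[OF t t] \<rho>0[OF t] in \<open>auto simp: B_def k_def\<close>)
  have Bgram: "gram r (B t) = mat 1" if t: "t \<in> {0..1}" for t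
  proof -
    have kk: "k t * k t * of_real (\<rho> t) = 1"
      unfolding k_def using \<rho>0[OF t] by (simp flip: of_real_mult)
    have "adj (B t i) ** B t i = smul (k t * k t) (X t ** (adj (A t i) ** S t ** A t i) ** X t)" for i
    proof -
      have "adj (B t i) ** B t i = smul (k t * k t) (X t ** adj (A t i) ** (X t ** (S t ** (S t ** X t))) ** A t i ** X t)"
        by (simp add: B_def adj_distribs mat_distribs mat_assoc X(1)[OF t t] Sadj[OF t] k_def)
      also have "X t ** (S t ** (S t ** X t)) = S t" using X(2,3)[OF t t] by (metis mat_assoc matrix_mul_rid)
      finally show ?thesis by (simp add: mat_assoc)
    qed
    then have "gram r (B t) = smul (k t * k t) (X t ** ?E t (S t) ** X t)"
      unfolding gram_def kmap_dag_eq by (simp add: smul_sum_right matrix_mult_sum_left matrix_mult_sum_right)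
    also have "?E t (S t) = smul (of_real (\<rho> t)) (S t)"
      unfolding S_def kmap_scaleR by (subst \<sigma>(3)[OF t]) (simp add: tr\<rho>[OF t] smul_of_real[symmetric] mult.commute)
    also have "smul (k t * k t) (X t ** smul (of_real (\<rho> t)) (S t) ** X t) = smul (k t * k t * of_real (\<rho> t)) (X t ** S t ** X t)"
      by (simp add: mat_distribs)
    also have "\<dots> = mat 1" using X(2,3)[OF t t] by (simp add: kk)
    finally show ?thesis .
  qed
  have US: "U ** S t = S t ** U" if t: "t \<in> {0..1}" for t
    using intertwines_conj_dens[OF U AU norm_beta irr[OF t] \<sigma>(2)[OF t] \<sigma>(3)[OF t]]
    by (simp add: S_def scaleR_mm_left scaleR_mm_right)
  have good: "good r N m U (B t)" if t: "t \<in> {0..1}" for t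
  proof -
    interpret normalisation r "A t" "B t" "S t" "X t" "k t" by (rule norm[OF t])
    show ?thesis
      unfolding good_def
      using Bgram[OF t] kindep_B[OF Ak[OF t]] spans_B[OF As[OF t]]
        intertwines_B[OF AU US[OF t] X(5)[OF t t US[OF t]]] by blast
  qed
  \<comment> \<open>For a trace-preserving tuple the dual Perron density is the multiple of the
    identity with trace 1, so the similarity is trivial there.\<close>
  have ends: "B t i = A t i" if t: "t \<in> {0..1}" and gr: "gram r (A t) = mat 1" for t i
  proof -
    define \<sigma>0 where "\<sigma>0 = (1 / real CARD('n)) *\<^sub>R (mat 1 :: 'n cmat)"
    have s0: "psd \<sigma>0" "trace \<sigma>0 = 1" by (simp_all add: \<sigma>0_def psd_scaleR trace_scaleR_of_real trace_I)
    have k0: "?E t \<sigma>0 = smul 1 \<sigma>0" by (simp add: \<sigma>0_def kmap_scaleR kmap_dag_one gr)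
    have "\<sigma> t = \<sigma>0"
      by (rule perron_unique[OF irr_dag[OF irr[OF t]] _ _ \<sigma>(3)[OF t] s0 k0])
         (use \<sigma>(2)[OF t] in \<open>auto simp: dens_mats_def\<close>)
    then have rho: "\<rho> t = 1" using s0 k0 by (simp add: \<rho>_def)
    have "A t i ** S t = S t ** A t i"
      by (simp add: S_def \<open>\<sigma> t = \<sigma>0\<close> \<sigma>0_def scaleR_mm_left scaleR_mm_right)
    then have "A t i ** X t = X t ** A t i" by (rule X(5)[OF t t])
    then have "S t ** X t ** A t i ** X t = S t ** X t ** X t ** A t i" by (metis mat_assoc)
    then show ?thesis by (simp add: B_def k_def rho X(3)[OF t t])
  qed
  have Scont: "continuous_on {0..1} S" unfolding S_def by (intro continuous_intros \<sigma>(1))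
  have Xcont: "continuous_on {0..1} X"
    unfolding X_def by (rule continuous_on_isq_path[OF Scont q op[folded S_def]])
  have Econt: "continuous_on {0..1} (\<lambda>t. ?E t (\<sigma> t))"
    unfolding kmap_dag_eq by (intro continuous_intros Acont \<sigma>(1))
  have kcont: "continuous_on {0..1} k"
    unfolding k_def \<rho>_def using \<rho>0 by (auto simp: \<rho>_def intro!: continuous_intros Econt) (force simp: \<rho>_def)
  show thesis
  proof (rule that[of B])
    fix i assume "i < r"
    show "continuous_on {0..1} (\<lambda>t. B t i)"
      unfolding B_def by (intro continuous_intros kcont Scont Xcont Acont)
    show "B 0 i = A0 i" "B 1 i = A1 i"
      using ends[of 0 i] ends[of 1 i] g0 g1 by (simp_all add: A01 good_def)
  qed (rule good)
qed

subsection \<open>Unitary matrices and spectral projections\<close>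

lemma det_nonzero_gram_pos_def:
  assumes "det G \<noteq> 0" shows "pos_def (adj G ** (G::'n::finite cmat))"
  unfolding pos_def_cip
proof (intro conjI allI impI)
  show "adj (adj G ** G) = adj G ** G" by (simp add: adj_mult)
  fix v :: "complex^'n" assume "v \<noteq> 0"
  then have "G *v v \<noteq> 0" using assms unfolding det_neq_0_iff_ker by blast
  moreover have "cip v ((adj G ** G) *v v) = of_real ((norm (G *v v))\<^sup>2)"
    unfolding matrix_vector_mul_assoc[symmetric] cip_adj[of v "adj G"] by (simp add: cip_self)
  ultimately show "0 < Re (cip v ((adj G ** G) *v v))" by (simp del: of_real_power)
qed

text \<open>The unitary factor of the polar decomposition; \<open>sqrt c\<close> undoes the scaling
  of the Gram matrix. The commutation clause lets relations satisfied by \<open>G\<close> pass to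
  this factor.\<close>

lemma polar_path:
  fixes G :: "real \<Rightarrow> 'n::finite cmat"
  assumes cont: "continuous_on {0..1} G" and det: "\<And>t. t \<in> {0..1} \<Longrightarrow> det (G t) \<noteq> 0"
  shows "\<exists>c. continuous_on {0..1} (\<lambda>t. smul (of_real (sqrt c)) (G t ** isq (mat 1 - c *\<^sub>R (adj (G t) ** G t)))) \<and>
    (\<forall>t\<in>{0..1}. unitary (smul (of_real (sqrt c)) (G t ** isq (mat 1 - c *\<^sub>R (adj (G t) ** G t))))) \<and>
    (\<forall>t\<in>{0..1}. \<forall>C. C ** (adj (G t) ** G t) = (adj (G t) ** G t) ** C \<longrightarrow>
      C ** isq (mat 1 - c *\<^sub>R (adj (G t) ** G t)) = isq (mat 1 - c *\<^sub>R (adj (G t) ** G t)) ** C)"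
proof -
  have \<sigma>: "continuous_on {0..1} (\<lambda>t. adj (G t) ** G t)" by (intro continuous_intros cont)
  obtain c q where c: "0 < c" and q: "0 \<le> q" "q < 1"
    and op: "\<And>t. t \<in> {0..1} \<Longrightarrow> opn q (mat 1 - c *\<^sub>R (adj (G t) ** G t))"
    using pos_def_path_scale[OF \<sigma> det_nonzero_gram_pos_def[OF det]] by metis
  define S where "S t = c *\<^sub>R (adj (G t) ** G t)" for t
  define X where "X t = isq (mat 1 - S t)" for t
  have Sadj: "adj (S t) = S t" for t by (simp add: S_def adj_distribs)
  note X = isq_props[OF Sadj op[folded S_def] q, folded X_def]
  show ?thesis
  proof (intro exI[of _ c] conjI ballI allI impI, unfold S_def[symmetric], unfold X_def[symmetric])
    show "continuous_on {0..1} (\<lambda>t. smul (of_real (sqrt c)) (G t ** X t))"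
      unfolding X_def
      by (intro continuous_intros cont continuous_on_isq_path[OF _ q op[folded S_def]])
         (auto simp: S_def intro!: continuous_intros cont)
    fix t :: real assume t: "t \<in> {0..1}"
    have "adj (smul (of_real (sqrt c)) (G t ** X t)) ** smul (of_real (sqrt c)) (G t ** X t) = X t ** S t ** X t"
      unfolding S_def using c
      by (simp add: adj_distribs mat_distribs X(1)[OF t] mat_assoc scaleR_mm_left scaleR_mm_right
          smul_of_real[symmetric] flip: of_real_mult)
    also have "\<dots> = mat 1" using X(2,3)[OF t] by simp
    finally show "unitary (smul (of_real (sqrt c)) (G t ** X t))" by (rule unitaryI)
    fix C assume "C ** (adj (G t) ** G t) = (adj (G t) ** G t) ** C"
    then show "C ** X t = X t ** C"
      by (intro X(5)[OF t]) (simp add: S_def scaleR_mm_left scaleR_mm_right)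
  qed
qed

lemma unitary_det: "unitary W \<Longrightarrow> det W \<noteq> 0"
  unfolding unitary_def by (metis invertible_def invertible_det_nz)

text \<open>The complex line from the identity to \<open>W\<close> meets the singular matrices in
  finitely many points. A detour around them, followed by the polar factor, stays in the unitary
  group.\<close>

lemma unitary_path:
  fixes W :: "'n::finite cmat"
  assumes W: "unitary W"
  obtains V where "continuous_on {0..1::real} V" "\<And>t. t \<in> {0..1} \<Longrightarrow> unitary (V t)" "V 0 = mat 1" "V 1 = W"
proof -
  have p: "is_poly (\<lambda>z. det (cline (mat 1) W z))" by (rule is_poly_det) (rule is_poly_cline)
  define F where "F = {z. det (cline (mat 1) W z) = 0}"
  have "finite F" unfolding F_def by (rule is_poly_finite_zeros[OF p, of 0]) simp
  moreover have "0 \<notin> F" "1 \<notin> F" using unitary_det[OF W] by (simp_all add: F_def)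
  ultimately obtain g where g: "path g" "g 0 = 0" "g 1 = (1::complex)" "\<And>t. t \<in> {0..1} \<Longrightarrow> g t \<notin> F"
    using avoiding_path by blast
  define G where "G t = cline (mat 1) W (g t)" for t
  have Gc: "continuous_on {0..1} G"
    unfolding G_def cline_def using g(1) by (auto simp: path_def intro!: continuous_intros)
  have Gd: "det (G t) \<noteq> 0" if "t \<in> {0..1}" for t using g(4)[OF that] by (simp add: G_def F_def)
  obtain c where
    c: "continuous_on {0..1} (\<lambda>t. smul (of_real (sqrt c)) (G t ** isq (mat 1 - c *\<^sub>R (adj (G t) ** G t))))"
    "\<forall>t\<in>{0..1}. unitary (smul (of_real (sqrt c)) (G t ** isq (mat 1 - c *\<^sub>R (adj (G t) ** G t))))"
    using polar_path[OF Gc Gd] by blast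
  define V where "V t = smul (of_real (sqrt c)) (G t ** isq (mat 1 - c *\<^sub>R (adj (G t) ** G t)))" for t
  have Vc: "continuous_on {0..1} V" using c(1) by (simp add: V_def[abs_def])
  \<comment> \<open>\<open>G\<close> is unitary at both ends, so the polar correction there is the
    same matrix \<open>Y\<close>, which is divided out at the end.\<close>
  define Y where "Y = smul (of_real (sqrt c)) (isq (mat 1 - c *\<^sub>R mat 1 :: 'n cmat))"
  have V0: "V 0 = Y" by (simp add: V_def Y_def G_def g mat_distribs)
  have V1: "V 1 = W ** Y" using W by (simp add: V_def Y_def G_def g unitary_def mat_distribs)
  have uV: "unitary (V t)" if "t \<in> {0..1}" for t using c(2) that by (simp add: V_def)
  have uY: "unitary Y" using uV[of 0] V0 by simp
  show thesis
  proof (rule that[of "\<lambda>t. V t ** adj Y"])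
    show "continuous_on {0..1} (\<lambda>t. V t ** adj Y)" by (intro continuous_intros Vc)
    show "unitary (V t ** adj Y)" if "t \<in> {0..1}" for t by (rule unitary_mult[OF uV[OF that] unitary_adj[OF uY]])
    show "V 0 ** adj Y = mat 1" "V 1 ** adj Y = W"
      using uY by (simp_all add: V0 V1 unitary_def mat_assoc)
  qed
qed

text \<open>The rows of the matrix are common eigenvectors of the projections.\<close>
lemma resolution_basis:
  fixes P :: "'k \<Rightarrow> 'n::finite cmat"
  assumes K: "finite K" and id: "\<And>k. k \<in> K \<Longrightarrow> P k ** P k = P k" and sum1: "sum P K = mat 1"
  obtains g \<kappa> where "det (\<chi> a. (g a :: complex^'n)) \<noteq> 0" "\<And>a. \<kappa> a \<in> K" "\<And>a. P (\<kappa> a) *v g a = g a"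
proof -
  define S where "S = (\<Union>k\<in>K. {P k *v x | x. True})"
  obtain B where B: "B \<subseteq> S" "vec.independent B" "S \<subseteq> vec.span B"
    by (rule vec.maximal_independent_subset)
  obtain g :: "'n \<Rightarrow> complex^'n" where g: "B \<subseteq> range g" "range g \<subseteq> insert 0 B"
    by (rule enumerate_independent[OF B(2)])
  have det: "det (\<chi> a. g a) \<noteq> 0"
  proof (rule det_rows_nonzero[OF g(1)])
    fix z assume z: "\<And>b. b \<in> B \<Longrightarrow> (\<Sum>p\<in>UNIV. z $ p * b $ p) = 0"
    have "(\<Sum>p\<in>UNIV. z $ p * x $ p) = 0" for x
    proof (rule annihilates_span[OF z])
      have "x = sum P K *v x" by (simp add: sum1)
      also have "\<dots> = (\<Sum>k\<in>K. P k *v x)" by (rule sum_mv)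
      also have "\<dots> \<in> vec.span B"
        by (rule vec.span_sum) (use B(3) in \<open>auto simp: S_def\<close>)
      finally show "x \<in> vec.span B" .
    qed
    from this[of "\<chi> p. cnj (z $ p)"] have "cip z z = 0"
      by (simp add: cip_def mult.commute)
    then show "z = 0" by (simp only: cip_self_eq_0)
  qed
  have "g a \<noteq> 0" for a
  proof
    assume "g a = 0"
    then have "row a (\<chi> a. g a) = 0" by (simp add: row_def vec_eq_iff)
    then show False using det det_zero_row(2) by blast
  qed
  then have "g a \<in> S" for a using g(2) B(1) by (metis insert_iff range_subsetD subsetD)
  then have "\<exists>k\<in>K. P k *v g a = g a" for a
  proof -
    obtain k x where k: "k \<in> K" "g a = P k *v x" using \<open>g a \<in> S\<close> by (auto simp: S_def)
    then have "P k *v g a = g a" by (simp add: matrix_vector_mul_assoc id)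
    then show ?thesis using k by blast
  qed
  then obtain \<kappa> where "\<And>a. \<kappa> a \<in> K" "\<And>a. P (\<kappa> a) *v g a = g a" by metis
  then show thesis using that det by blast
qed

lemma column_mult: "column a (A ** (B::'n::finite cmat)) = A *v column a B"
  by (simp add: vec_eq_iff column_def matrix_vector_mult_def matrix_mult_nth)

lemma cmat_column_eqI: "(\<And>a. column a A = column a (B::'n::finite cmat)) \<Longrightarrow> A = B"
  by (simp add: column_def vec_eq_iff)

lemma resolution_diag:
  assumes orth: "\<And>j k. j \<in> K \<Longrightarrow> k \<in> K \<Longrightarrow> j \<noteq> k \<Longrightarrow> P j ** P k = (0::'n::finite cmat)"
    and l: "l \<in> K" "P l *v x = x" and k: "k \<in> K"
  shows "P k *v x = (if l = k then x else 0)"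
proof (cases "l = k")
  case False
  then have "P k *v (P l *v x) = 0"
    using orth[OF k l(1)] by (simp add: matrix_vector_mul_assoc)
  then show ?thesis using False l(2) by simp
qed (use l in auto)

lemma det_transpose_inverse:
  assumes "det (M::'n::finite cmat) \<noteq> 0" obtains L where "transpose M ** L = mat 1" "L ** transpose M = mat 1"
  using assms by (metis det_transpose invertible_def invertible_det_nz)

text \<open>In the basis \<open>g\<close> the projection \<open>P k\<close> is diagonal with entries
  0 and 1, so its trace counts the labels equal to \<open>k\<close>.\<close>

lemma trace_resolution:
  fixes P :: "'k \<Rightarrow> 'n::finite cmat"
  assumes orth: "\<And>j k. j \<in> K \<Longrightarrow> k \<in> K \<Longrightarrow> j \<noteq> k \<Longrightarrow> P j ** P k = 0"
    and g: "det (\<chi> a. (g a :: complex^'n)) \<noteq> 0" and \<kappa>: "\<And>a. \<kappa> a \<in> K" "\<And>a. P (\<kappa> a) *v g a = g a" and k: "k \<in> K"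
  shows "trace (P k) = of_nat (card {a. \<kappa> a = k})"
proof -
  define F where "F = transpose (\<chi> a. g a)"
  define D :: "'n cmat" where "D = (\<chi> a b. if a = b \<and> \<kappa> a = k then 1 else 0)"
  obtain L where L: "F ** L = mat 1" "L ** F = mat 1" using det_transpose_inverse[OF g] F_def by metis
  have colF: "column a F = g a" for a by (simp add: F_def column_def transpose_def vec_eq_iff)
  have "P k ** F = F ** D"
  proof (rule cmat_column_eqI)
    fix a
    have "column a (P k ** F) = (if \<kappa> a = k then g a else 0)"
      unfolding column_mult colF by (rule resolution_diag[where P = P and K = K]) (use orth \<kappa> k in auto)
    also have "\<dots> = F *v column a D"
    proof -
      have "(F *v column a D) $ i = (if \<kappa> a = k then g a else 0) $ i" for i
      proof -
        have "(F *v column a D) $ i = (\<Sum>b\<in>UNIV. if b = a then (if \<kappa> a = k then F $ i $ a else 0) else 0)"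
          unfolding matrix_vector_mult_def column_def D_def vec_lambda_beta by (intro sum.cong) auto
        also have "\<dots> = (if \<kappa> a = k then column a F $ i else 0)" by (simp add: column_def)
        finally show ?thesis by (simp add: colF)
      qed
      then show ?thesis by (simp add: vec_eq_iff)
    qed
    finally show "column a (P k ** F) = column a (F ** D)" by (simp add: column_mult)
  qed
  then have "P k = F ** (D ** L)" using L by (metis mat_assoc matrix_mul_rid)
  then have "trace (P k) = trace D" using L trace_mul_sym[of F "D ** L"] by (simp add: mat_assoc)
  also have "\<dots> = (\<Sum>a\<in>{a. \<kappa> a = k}. 1)"
    unfolding trace_def D_def by (simp add: sum.If_cases)
  finally show ?thesis by simp
qed

text \<open>Send an eigenbasis of the first resolution to one of the second, label by label; equal
  traces mean equally many labels. The resulting \<open>G\<close> is invertible and intertwines. The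
  projections are Hermitian, so they commute with \<open>adj G ** G\<close>, and the unitary polar
  factor of \<open>G\<close> intertwines too.\<close>

lemma unitary_between_resolutions:
  fixes P Q :: "'k \<Rightarrow> 'n::finite cmat"
  assumes K: "finite K"
    and P: "\<And>k. k \<in> K \<Longrightarrow> P k ** P k = P k" "\<And>k. k \<in> K \<Longrightarrow> adj (P k) = P k"
      "\<And>j k. j \<in> K \<Longrightarrow> k \<in> K \<Longrightarrow> j \<noteq> k \<Longrightarrow> P j ** P k = 0" "sum P K = mat 1"
    and Q: "\<And>k. k \<in> K \<Longrightarrow> Q k ** Q k = Q k" "\<And>k. k \<in> K \<Longrightarrow> adj (Q k) = Q k"
      "\<And>j k. j \<in> K \<Longrightarrow> k \<in> K \<Longrightarrow> j \<noteq> k \<Longrightarrow> Q j ** Q k = 0" "sum Q K = mat 1"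
    and tr: "\<And>k. k \<in> K \<Longrightarrow> trace (P k) = trace (Q k)"
  obtains W where "unitary W" "\<And>k. k \<in> K \<Longrightarrow> W ** P k = Q k ** W"
proof -
  obtain g \<kappa> where g: "det (\<chi> a. (g a :: complex^'n)) \<noteq> 0" "\<And>a. \<kappa> a \<in> K" "\<And>a. P (\<kappa> a) *v g a = g a"
    using resolution_basis[OF K P(1) P(4)] by metis
  obtain h \<mu> where h: "det (\<chi> a. (h a :: complex^'n)) \<noteq> 0" "\<And>a. \<mu> a \<in> K" "\<And>a. Q (\<mu> a) *v h a = h a"
    using resolution_basis[OF K Q(1) Q(4)] by metis
  have card: "card {a. \<kappa> a = k} = card {a. \<mu> a = k}" if "k \<in> K" for k
    using tr[OF that] trace_resolution[OF P(3) g that] trace_resolution[OF Q(3) h that] by simp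
  have "\<exists>f. bij_betw f {a. \<kappa> a = k} {a. \<mu> a = k}" if "k \<in> K" for k
    using card[OF that] by (intro finite_same_card_bij) auto
  then obtain f where f: "\<And>k. k \<in> K \<Longrightarrow> bij_betw (f k) {a. \<kappa> a = k} {a. \<mu> a = k}" by metis
  \<comment> \<open>A permutation of the index set that carries the labels \<kappa> to the labels
    \<mu>.\<close>
  define \<pi> where "\<pi> a = f (\<kappa> a) a" for a
  have mu\<pi>: "\<mu> (\<pi> a) = \<kappa> a" for a
    using f[OF g(2)[of a]] by (auto simp: \<pi>_def bij_betw_def)
  have "inj \<pi>"
  proof (rule injI)
    fix a b assume ab: "\<pi> a = \<pi> b"
    then have "\<kappa> a = \<kappa> b" by (metis mu\<pi>)
    then show "a = b" using f[OF g(2)[of a]] ab by (auto simp: \<pi>_def bij_betw_def inj_on_def)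
  qed
  then have "surj \<pi>" by (simp add: finite_UNIV_inj_surj)
  define F H where "F = transpose (\<chi> a. g a)" and "H = transpose (\<chi> a. h (\<pi> a))"
  have colF: "column a F = g a" and colH: "column a H = h (\<pi> a)" for a
    by (simp_all add: F_def H_def column_def transpose_def vec_eq_iff)
  have detH: "det (\<chi> a. h (\<pi> a)) \<noteq> 0"
    unfolding det_neq_0_iff_ker
  proof (intro allI impI)
    fix z assume z: "(\<chi> a. h (\<pi> a)) *v z = 0"
    have "((\<chi> a. h a) *v z) $ b = 0" for b
    proof -
      obtain a where a: "b = \<pi> a" using \<open>surj \<pi>\<close> by (metis surjD)
      have "((\<chi> a. h (\<pi> a)) *v z) $ a = 0" using z by simp
      then show ?thesis by (simp add: a matrix_vector_mult_def)
    qed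
    then have "(\<chi> a. h a) *v z = 0" by (simp add: vec_eq_iff)
    then show "z = 0" using h(1) unfolding det_neq_0_iff_ker by blast
  qed
  obtain L where L: "F ** L = mat 1" "L ** F = mat 1" using det_transpose_inverse[OF g(1)] F_def by metis
  define G where "G = H ** L"
  have GF: "G ** F = H" by (simp add: G_def mat_assoc L)
  have "det F \<noteq> 0" "det H \<noteq> 0" using g(1) detH by (simp_all add: F_def H_def det_transpose)
  then have detG: "det G \<noteq> 0" using GF by (metis det_mul mult_zero_left)
  have GP: "G ** P k = Q k ** G" if k: "k \<in> K" for k
  proof -
    have "G ** P k ** F = Q k ** G ** F"
    proof (rule cmat_column_eqI)
      fix a
      have Gg: "G *v g a = h (\<pi> a)" using GF colF colH column_mult by metis
      have "column a (G ** P k ** F) = G *v (P k *v g a)"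
        by (simp add: column_mult colF matrix_vector_mul_assoc)
      also have "\<dots> = (if \<kappa> a = k then h (\<pi> a) else 0)"
        using resolution_diag[of K P, OF P(3) g(2)[of a] g(3)[of a] k] Gg by simp
      also have "\<dots> = Q k *v h (\<pi> a)"
        using resolution_diag[of K Q, OF Q(3) h(2)[of "\<pi> a"] h(3)[of "\<pi> a"] k] mu\<pi> by simp
      also have "\<dots> = column a (Q k ** G ** F)"
        by (simp add: mat_assoc GF column_mult colH)
      finally show "column a (G ** P k ** F) = column a (Q k ** G ** F)" .
    qed
    then have "G ** P k ** F ** L = Q k ** G ** F ** L" by simp
    then show ?thesis by (simp add: mat_assoc L)
  qed
  obtain c where
    c: "unitary (smul (of_real (sqrt c)) (G ** isq (mat 1 - c *\<^sub>R (adj G ** G))))"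
    "\<And>C. C ** (adj G ** G) = (adj G ** G) ** C \<Longrightarrow>
      C ** isq (mat 1 - c *\<^sub>R (adj G ** G)) = isq (mat 1 - c *\<^sub>R (adj G ** G)) ** C"
    using polar_path[of "\<lambda>_. G", OF continuous_on_const detG] by (auto dest!: bspec[of _ _ "0::real"])
  define X where "X = isq (mat 1 - c *\<^sub>R (adj G ** G))"
  show thesis
  proof (rule that)
    show "unitary (smul (of_real (sqrt c)) (G ** X))" using c(1) by (simp add: X_def)
    fix k assume k: "k \<in> K"
    have "P k ** adj G = adj G ** Q k"
      using arg_cong[OF GP[OF k], of adj] P(2)[OF k] Q(2)[OF k] by (simp add: adj_mult)
    then have "P k ** (adj G ** G) = (adj G ** G) ** P k" by (metis GP[OF k] mat_assoc)
    then have PX: "P k ** X = X ** P k" unfolding X_def by (rule c(2))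
    have "G ** X ** P k = Q k ** (G ** X)" by (metis PX GP[OF k] mat_assoc)
    then show "smul (of_real (sqrt c)) (G ** X) ** P k = Q k ** smul (of_real (sqrt c)) (G ** X)"
      by (simp add: mat_distribs)
  qed
qed

text \<open>Discrete Fourier transform of the powers of \<open>U\<close>: for unitary
  \<open>U\<close> with \<open>U^m = 1\<close> this projects onto the eigenspace of
  \<open>beta^k\<close>. Being a polynomial in \<open>U\<close> it is continuous in
  \<open>U\<close>, and it is periodic in \<open>k\<close>.\<close>

definition specproj :: "nat \<Rightarrow> 'n::finite cmat \<Rightarrow> nat \<Rightarrow> 'n cmat" where
  "specproj m U k = smul (1 / of_nat m) (\<Sum>l<m. smul (cnj (beta m) ^ (k * l)) (mpow U l))"

lemma cnj_beta_mult: "cnj (beta m) * beta m = 1"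
  by (simp add: cnj_mult_self norm_beta)

lemma cnj_beta_power_m: "0 < m \<Longrightarrow> cnj (beta m) ^ m = 1"
  by (metis beta_power_m complex_cnj_one complex_cnj_power)

text \<open>Orthogonality of the characters of the cyclic group of order \<open>m\<close>.\<close>

lemma root_sum:
  assumes m: "0 < m"
  shows "(\<Sum>l<m. cnj (beta m) ^ (j * l) * beta m ^ (k * l)) = (if j mod m = k mod m then of_nat m else 0)"
proof -
  define x where "x = cnj (beta m) ^ j * beta m ^ k"
  have "(\<Sum>l<m. cnj (beta m) ^ (j * l) * beta m ^ (k * l)) = (\<Sum>l<m. x ^ l)"
    by (simp add: x_def power_mult power_mult_distrib)
  also have "\<dots> = (if j mod m = k mod m then of_nat m else 0)"
  proof -
    have "beta m ^ j * x = (cnj (beta m) * beta m) ^ j * beta m ^ k"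
      by (simp add: x_def power_mult_distrib)
    then have bx: "beta m ^ j * x = beta m ^ k" by (simp add: cnj_beta_mult)
    have b0: "beta m ^ j \<noteq> 0" by (metis norm_beta norm_power norm_zero power_one zero_neq_one)
    have x1: "x = 1 \<longleftrightarrow> j mod m = k mod m"
    proof -
      have "x = 1 \<longleftrightarrow> beta m ^ j * x = beta m ^ j * 1" using b0 by (simp only: mult_cancel_left) simp
      then show ?thesis unfolding bx using beta_power_eq_iff[OF m, of k j] by auto
    qed
    have xm: "x ^ m = 1"
      using m by (simp add: x_def power_mult_distrib power_mult[symmetric] mult.commute[of _ m])
        (simp add: power_mult cnj_beta_power_m beta_power_m)
    show ?thesis
    proof (cases "x = 1")
      case False
      then have "(\<Sum>l<m. x ^ l) = 0" using xm by (simp add: sum_gp_strict)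
      then show ?thesis using False x1 by simp
    qed (use x1 in auto)
  qed
  finally show ?thesis .
qed

lemma specproj_smul: "specproj m (smul (cnj (beta m) ^ j) U) k = specproj m U (k + j)"
  unfolding specproj_def by (simp add: mpow_smul power_mult[symmetric] power_add[symmetric] algebra_simps)

lemma specproj_period: assumes "0 < m" "j mod m = k mod m" shows "specproj m U j = specproj m U k"
proof -
  have "cnj (beta m) ^ (j * l) = cnj (beta m) ^ (k * l)" for l
  proof -
    have "beta m ^ (j * l) = beta m ^ (k * l)"
      unfolding beta_power_eq_iff[OF assms(1)] by (metis assms(2) mod_mult_left_eq)
    then show ?thesis by (metis complex_cnj_power)
  qed
  then show ?thesis by (simp add: specproj_def)
qed

lemma specproj_eigen:
  assumes m: "0 < m" and U: "mpow U m = mat 1"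
  shows "U ** specproj m U k = smul (beta m ^ k) (specproj m U k)"
proof -
  let ?c = "cnj (beta m)"
  define f where "f l = smul (?c ^ (k * l)) (mpow U l)" for l
  have fm: "f m = f 0" using m by (simp add: f_def U mult.commute[of k] power_mult cnj_beta_power_m)
  have "(\<Sum>l<m. f (Suc l)) + f 0 = (\<Sum>l<Suc m. f l)" by (simp only: sum.lessThan_Suc_shift add.commute)
  then have sh: "(\<Sum>l<m. f (Suc l)) = (\<Sum>l<m. f l)" by (simp add: fm)
  have "U ** mpow U l = mpow U (Suc l)" for l by simp
  then have "U ** f l = smul (beta m ^ k) (f (Suc l))" for l
  proof -
    have "beta m ^ k * ?c ^ (k * Suc l) = (?c * beta m) ^ k * ?c ^ (k * l)"
      by (simp add: power_add power_mult_distrib mult_ac)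
    then show ?thesis by (simp add: f_def mat_distribs cnj_beta_mult)
  qed
  then have "U ** (\<Sum>l<m. f l) = smul (beta m ^ k) (\<Sum>l<m. f l)"
    by (simp add: matrix_mult_sum_right smul_sum_right[symmetric] sh)
  then show ?thesis
    unfolding specproj_def f_def[symmetric] by (simp add: mat_distribs mult.commute)
qed

lemma mpow_eigen: "U ** Y = smul b Y \<Longrightarrow> mpow U l ** Y = smul (b ^ l) Y"
  by (induction l) (simp_all add: mat_assoc mat_distribs mult.commute)

lemma specproj_mult_eigen:
  assumes m: "0 < m" and Y: "U ** Y = smul (beta m ^ k) Y"
  shows "specproj m U j ** Y = (if j mod m = k mod m then Y else 0)"
proof -
  have "specproj m U j ** Y = smul (1 / of_nat m) (smul (\<Sum>l<m. cnj (beta m) ^ (j * l) * beta m ^ (k * l)) Y)"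
    unfolding specproj_def
    by (simp add: mat_distribs mpow_eigen[OF Y] power_mult[symmetric] smul_sum_left)
  then show ?thesis unfolding root_sum[OF m] using m by simp
qed

lemma specproj_sum:
  assumes m: "0 < m" shows "(\<Sum>k=1..m. specproj m U k) = mat 1"
proof -
  have inner: "(\<Sum>k=1..m. cnj (beta m) ^ (k * l)) = (if l = 0 then of_nat m else 0)" if l: "l < m" for l
  proof -
    \<comment> \<open>The summand has period \<open>m\<close>, so the range 1 to \<open>m\<close>
      may be replaced by 0 to \<open>m - 1\<close>.\<close>
    have "(\<Sum>k=1..m. cnj (beta m) ^ (k * l)) = (\<Sum>k<m. cnj (beta m) ^ (l * k))"
    proof -
      have "(\<Sum>k<m. cnj (beta m) ^ (l * k)) + cnj (beta m) ^ (l * m) = (\<Sum>k<Suc m. cnj (beta m) ^ (l * k))" by simp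
      also have "\<dots> = 1 + (\<Sum>k<m. cnj (beta m) ^ (l * Suc k))" by (simp only: sum.lessThan_Suc_shift) simp
      also have "(\<Sum>k<m. cnj (beta m) ^ (l * Suc k)) = (\<Sum>k=1..m. cnj (beta m) ^ (l * k))"
        by (rule sum.reindex_bij_witness[of _ "\<lambda>k. k - 1" Suc]) auto
      also have "cnj (beta m) ^ (l * m) = 1" by (metis cnj_beta_power_m m mult.commute power_mult power_one)
      finally show ?thesis by (simp add: mult.commute)
    qed
    also have "\<dots> = (if l = 0 then of_nat m else 0)"
      using root_sum[OF m, of l 0] l by simp
    finally show ?thesis .
  qed
  have "(\<Sum>k=1..m. specproj m U k) = smul (1 / of_nat m) (\<Sum>l<m. smul (\<Sum>k=1..m. cnj (beta m) ^ (k * l)) (mpow U l))"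
    unfolding specproj_def smul_sum_right[symmetric] smul_sum_left by (subst sum.swap) simp
  also have "(\<Sum>l<m. smul (\<Sum>k=1..m. cnj (beta m) ^ (k * l)) (mpow U l)) = (\<Sum>l<m. if l = 0 then smul (of_nat m) (mat 1) else 0)"
    by (intro sum.cong refl) (simp only: lessThan_iff inner, simp)
  also have "\<dots> = smul (of_nat m) (mat 1)" using m by simp
  finally show ?thesis using m by simp
qed

lemma mod_eq_range: "j \<in> {1..m} \<Longrightarrow> k \<in> {1..m} \<Longrightarrow> j mod m = k mod m \<Longrightarrow> j = (k::nat)"
  by (metis atLeastAtMost_iff le_neq_implies_less mod_less mod_self not_one_le_zero)

lemma specproj_decomp:
  assumes m: "0 < m" and U: "unitary U" "mpow U m = mat 1"
  shows "spectral_decomp m U (specproj m U)"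
proof -
  let ?P = "specproj m U"
  note eig = specproj_eigen[OF m U(2)]
  \<comment> \<open>On the range of the projection \<open>adj U\<close> acts as the conjugate of
    \<open>beta^k\<close>, whence \<open>adj P ** P = P\<close>; the left side is Hermitian.\<close>
  have herm: "adj (?P k) = ?P k" for k
  proof -
    have "smul (beta m ^ k) (adj U ** ?P k) = adj U ** (U ** ?P k)"
      by (simp only: eig smul_mult_right)
    also have "\<dots> = ?P k" using U(1) by (simp add: unitary_def matrix_mul_assoc)
    finally have "smul (cnj (beta m) ^ k * beta m ^ k) (adj U ** ?P k) = smul (cnj (beta m) ^ k) (?P k)"
      by (metis smul_smul)
    then have aU: "adj U ** ?P k = smul (cnj (beta m) ^ k) (?P k)"
      by (simp add: power_mult_distrib[symmetric] cnj_beta_mult)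
    have mp: "adj (mpow U l) = mpow (adj U) l" for l
      by (induction l) (simp_all add: adj_mult mpow_commute)
    have "adj (?P k) ** ?P k = smul (1 / of_nat m) (\<Sum>l<m. smul (beta m ^ (k * l) * cnj (beta m) ^ (k * l)) (?P k))"
      by (subst (1) specproj_def)
         (simp add: adj_distribs mat_distribs mp mpow_eigen[OF aU] power_mult[symmetric])
    also have "\<dots> = smul (1 / of_nat m) (smul (\<Sum>l<m. 1) (?P k))"
      unfolding power_mult_distrib[symmetric] mult.commute[of "beta m"] cnj_beta_mult power_one smul_sum_left
      by (rule refl)
    finally have "adj (?P k) ** ?P k = ?P k" using m by simp
    then show ?thesis by (metis adj_adj adj_mult)
  qed
  have "?P j ** ?P k = (if j mod m = k mod m then ?P k else 0)" for j k
    by (rule specproj_mult_eigen[OF m eig])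
  moreover have "U = (\<Sum>k=1..m. smul (beta m ^ k) (?P k))"
  proof -
    have "U = U ** (\<Sum>k=1..m. ?P k)" by (simp only: specproj_sum[OF m] matrix_mul_rid)
    also have "\<dots> = (\<Sum>k=1..m. smul (beta m ^ k) (?P k))" by (simp only: matrix_mult_sum_right eig)
    finally show ?thesis .
  qed
  ultimately show ?thesis
    unfolding spectral_decomp_def using herm specproj_sum[OF m, of U] mod_eq_range[of _ m] by auto
qed

text \<open>In any decomposition each \<open>P k\<close> consists of eigenvectors for
  \<open>beta^k\<close>, so the Fourier polynomial in \<open>U\<close> acts on the given resolution
  as the expected projection and recovers \<open>P k\<close>.\<close>

lemma spectral_decomp_unique:
  assumes m: "0 < m" and sd: "spectral_decomp m U P"
  shows "mpow U m = mat 1" "\<And>k. k \<in> {1..m} \<Longrightarrow> P k = specproj m U k"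
proof -
  have P: "\<And>k. k \<in> {1..m} \<Longrightarrow> P k ** P k = P k" "\<And>j k. j \<in> {1..m} \<Longrightarrow> k \<in> {1..m} \<Longrightarrow> j \<noteq> k \<Longrightarrow> P j ** P k = 0"
    and sum: "(\<Sum>k=1..m. P k) = mat 1" and U: "U = (\<Sum>k=1..m. smul (beta m ^ k) (P k))"
    using sd unfolding spectral_decomp_def by blast+
  have eig: "U ** P k = smul (beta m ^ k) (P k)" if k: "k \<in> {1..m}" for k
  proof -
    have "U ** P k = (\<Sum>j\<in>{1..m}. smul (beta m ^ j) (P j ** P k))"
      by (subst U) (simp add: mat_distribs)
    also have "\<dots> = (\<Sum>j\<in>{1..m}. if j = k then smul (beta m ^ k) (P k) else 0)"
      by (intro sum.cong refl) (use P k in auto)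
    finally show ?thesis using k by simp
  qed
  have "mpow U m = mpow U m ** (\<Sum>k=1..m. P k)" by (simp only: sum matrix_mul_rid)
  also have "\<dots> = (\<Sum>k=1..m. P k)"
    unfolding matrix_mult_sum_right
    by (intro sum.cong refl)
       (simp add: mpow_eigen[OF eig] power_mult[symmetric] mult.commute[of _ m] power_mult beta_power_m[OF m])
  finally show "mpow U m = mat 1" by (simp only: sum)
  fix k assume k: "k \<in> {1..m}"
  have "specproj m U k = specproj m U k ** (\<Sum>j=1..m. P j)" by (simp only: sum matrix_mul_rid)
  also have "\<dots> = (\<Sum>j=1..m. if j = k then P k else 0)"
    unfolding matrix_mult_sum_right
  proof (intro sum.cong refl)
    fix j assume j: "j \<in> {1..m}"
    show "specproj m U k ** P j = (if j = k then P k else 0)"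
      unfolding specproj_mult_eigen[OF m eig[OF j]] using mod_eq_range[OF j k] by auto
  qed
  also have "\<dots> = P k" using k by simp
  finally show "P k = specproj m U k" by simp
qed

definition dvec :: "nat \<Rightarrow> 'n::finite cmat \<Rightarrow> complex list" where
  "dvec m U = map (\<lambda>k. trace (specproj m U k)) [1..<m+1]"

text \<open>The quantifier over decompositions disappears: \<open>P\<close> is determined by
  \<open>U\<close>, and for unitary \<open>U\<close> it exists exactly when
  \<open>U^m = 1\<close>.\<close>

lemma mult_index_alt:
  assumes m: "0 < m"
  shows "mult_index m T = {rotate j (dvec m U) | j U. unitary U \<and> mpow U m = mat 1 \<and> dual_map T U = smul (beta m) U}"
proof -
  have eq: "map (\<lambda>k. trace (P k)) [1..<m+1] = dvec m U" if "spectral_decomp m U P" for U P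
    unfolding dvec_def using spectral_decomp_unique(2)[OF m that] by (intro map_cong) auto
  show ?thesis
  proof (intro equalityI subsetI)
    fix x assume "x \<in> mult_index m T"
    then obtain j U P where x: "x = rotate j (map (\<lambda>k. trace (P k)) [1..<m+1])" "unitary U"
      "dual_map T U = smul (beta m) U" "spectral_decomp m U P" unfolding mult_index_def by blast
    then show "x \<in> {rotate j (dvec m U) | j U. unitary U \<and> mpow U m = mat 1 \<and> dual_map T U = smul (beta m) U}"
      using eq[OF x(4)] spectral_decomp_unique(1)[OF m x(4)] by auto
  next
    fix x assume "x \<in> {rotate j (dvec m U) | j U. unitary U \<and> mpow U m = mat 1 \<and> dual_map T U = smul (beta m) U}"
    then obtain j U where x: "x = rotate j (dvec m U)" "unitary U" "mpow U m = mat 1"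
      "dual_map T U = smul (beta m) U" by blast
    then show "x \<in> mult_index m T"
      unfolding mult_index_def dvec_def using specproj_decomp[OF m x(2,3)] by blast
  qed
qed

text \<open>Multiplying \<open>U\<close> by a power of the conjugate of \<open>beta\<close> relabels
  its eigenvalues, so the projections are shifted cyclically.\<close>

lemma rotate_dvec:
  assumes m: "0 < m" shows "rotate j (dvec m U) = dvec m (smul (cnj (beta m) ^ j) U)"
proof (rule nth_equalityI)
  fix i assume "i < length (rotate j (dvec m U))"
  then have i: "i < m" using m by (simp add: dvec_def)
  \<comment> \<open>List positions start at 0 but projection indices at 1; the wrap-around happens
    in the positions, and the two indices agree modulo \<open>m\<close>.\<close>
  have "specproj m U (Suc ((i + j) mod m)) = specproj m U (Suc i + j)"
    by (rule specproj_period[OF m]) (simp add: mod_Suc_eq)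
  then show "rotate j (dvec m U) ! i = dvec m (smul (cnj (beta m) ^ j) U) ! i"
    using i m by (simp add: nth_rotate dvec_def specproj_smul add.commute del: upt_Suc)
qed (simp add: dvec_def)

subsection \<open>Analytic approximation of isometric paths\<close>

text \<open>Analyticity is handled through local holomorphic extensions, which are stable under
  products and \<open>isq\<close> and yield power series. Conjugation is not holomorphic, so an
  extension of the adjoint is always carried separately. The real neighbourhood is two-sided even at
  the ends of the unit interval.\<close>

definition hol_ext :: "(real \<Rightarrow> 'n::finite cmat) \<Rightarrow> real \<Rightarrow> bool" where
  "hol_ext M t0 \<longleftrightarrow> (\<exists>r>0. \<exists>g. (\<forall>i j. (\<lambda>z. g z $ i $ j) holomorphic_on ball (of_real t0) r) \<and>
     (\<forall>t. \<bar>t - t0\<bar> < r \<longrightarrow> M t = g (of_real t)))"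

lemma hol_extI:
  assumes "r > 0" "\<And>i j. (\<lambda>z. g z $ i $ j) holomorphic_on ball (of_real t0) r"
    "\<And>t. \<bar>t - t0\<bar> < r \<Longrightarrow> M t = g (of_real t)"
  shows "hol_ext M t0"
  using assms unfolding hol_ext_def by blast

lemma of_real_in_ball: "\<bar>t - t0\<bar> < r \<Longrightarrow> complex_of_real t \<in> ball (of_real t0) r"
  by (simp add: dist_norm norm_minus_commute flip: of_real_diff)

lemma hol_ext_real_analytic:
  assumes "\<And>t0. t0 \<in> S \<Longrightarrow> hol_ext M t0"
  shows "real_analytic_on S (\<lambda>t. M t $ k $ l)"
  unfolding real_analytic_on_def
proof
  fix t0 assume "t0 \<in> S"
  then obtain r g where r: "r > 0" and g: "\<And>i j. (\<lambda>z. g z $ i $ j) holomorphic_on ball (of_real t0) r"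
    "\<And>t. \<bar>t - t0\<bar> < r \<Longrightarrow> M t = g (of_real t)"
    using assms unfolding hol_ext_def by metis
  show "\<exists>r>0. \<exists>c. \<forall>t\<in>S. \<bar>t - t0\<bar> < r \<longrightarrow> (\<lambda>n. c n * complex_of_real (t - t0) ^ n) sums (M t $ k $ l)"
  proof (intro exI conjI ballI impI)
    fix t assume t: "\<bar>t - t0\<bar> < r"
    show "(\<lambda>n. (deriv ^^ n) (\<lambda>z. g z $ k $ l) (of_real t0) / fact n * complex_of_real (t - t0) ^ n) sums (M t $ k $ l)"
      using holomorphic_power_series[OF g(1) of_real_in_ball[OF t]] g(2)[OF t] by simp
  qed (rule r)
qed

lemma hol_ext_isCont: assumes "hol_ext M t0" shows "isCont M t0"
proof -
  obtain r g where r: "r > 0" and g: "\<And>i j. (\<lambda>z. g z $ i $ j) holomorphic_on ball (of_real t0) r"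
    "\<And>t. \<bar>t - t0\<bar> < r \<Longrightarrow> M t = g (of_real t)"
    using assms unfolding hol_ext_def by metis
  have "continuous_on (ball (of_real t0) r) g"
    by (rule continuous_on_cmatI) (rule holomorphic_on_imp_continuous_on[OF g(1)])
  then have "continuous_on (ball t0 r) (\<lambda>t. g (complex_of_real t))"
    by (rule continuous_on_compose2) (auto intro!: continuous_intros simp: dist_norm simp flip: of_real_diff)
  moreover have "M t = g (of_real t)" if "t \<in> ball t0 r" for t
    using g(2)[of t] that by (simp add: dist_real_def abs_minus_commute)
  ultimately have "continuous_on (ball t0 r) M" by (metis (no_types, lifting) continuous_on_cong)
  then show ?thesis using r by (simp add: continuous_on_eq_continuous_at)
qed

lemma hol_ext_const: "hol_ext (\<lambda>t. A) t0"
  unfolding hol_ext_def by (intro exI[of _ 1] exI[of _ "\<lambda>z. A"] conjI) (auto intro!: holomorphic_intros)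

lemma hol_ext_common:
  fixes M N :: "real \<Rightarrow> 'n::finite cmat"
  assumes "hol_ext M t0" "hol_ext N t0"
  obtains r g h where "r > 0" "\<And>i j. (\<lambda>z. g z $ i $ j) holomorphic_on ball (of_real t0) r"
    "\<And>i j. (\<lambda>z. h z $ i $ j) holomorphic_on ball (of_real t0) r"
    "\<And>t. \<bar>t - t0\<bar> < r \<Longrightarrow> M t = g (of_real t)" "\<And>t. \<bar>t - t0\<bar> < r \<Longrightarrow> N t = h (of_real t)"
proof -
  obtain r1 g where r1: "r1 > 0" "\<And>i j. (\<lambda>z. g z $ i $ j) holomorphic_on ball (of_real t0) r1"
    "\<And>t. \<bar>t - t0\<bar> < r1 \<Longrightarrow> M t = g (of_real t)"
    using assms(1) unfolding hol_ext_def by metis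
  obtain r2 h where r2: "r2 > 0" "\<And>i j. (\<lambda>z. h z $ i $ j) holomorphic_on ball (of_real t0) r2"
    "\<And>t. \<bar>t - t0\<bar> < r2 \<Longrightarrow> N t = h (of_real t)"
    using assms(2) unfolding hol_ext_def by metis
  have "(\<lambda>z. g z $ i $ j) holomorphic_on ball (of_real t0) (min r1 r2)" for i j
    by (rule holomorphic_on_subset[OF r1(2)]) auto
  moreover have "(\<lambda>z. h z $ i $ j) holomorphic_on ball (of_real t0) (min r1 r2)" for i j
    by (rule holomorphic_on_subset[OF r2(2)]) auto
  ultimately show thesis
    by (intro that[of "min r1 r2" g h]) (use r1 r2 in simp_all)
qed

lemma hol_ext_mult:
  assumes "hol_ext M t0" "hol_ext N t0" shows "hol_ext (\<lambda>t. M t ** N t) t0"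
proof -
  obtain r g h where r: "r > 0" and g: "\<And>i j. (\<lambda>z. g z $ i $ j) holomorphic_on ball (of_real t0) r"
    and h: "\<And>i j. (\<lambda>z. h z $ i $ j) holomorphic_on ball (of_real t0) r"
    and e: "\<And>t. \<bar>t - t0\<bar> < r \<Longrightarrow> M t = g (of_real t)" "\<And>t. \<bar>t - t0\<bar> < r \<Longrightarrow> N t = h (of_real t)"
    by (rule hol_ext_common[OF assms]) blast
  show ?thesis
    unfolding hol_ext_def
    by (intro exI[of _ r] exI[of _ "\<lambda>z. g z ** h z"] conjI allI impI r)
       (auto simp: e matrix_mult_nth intro!: holomorphic_intros holomorphic_on_sum g h)
qed

lemma hol_ext_add:
  assumes "hol_ext M t0" "hol_ext N t0" shows "hol_ext (\<lambda>t. M t + N t) t0"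
proof -
  obtain r g h where r: "r > 0" and g: "\<And>i j. (\<lambda>z. g z $ i $ j) holomorphic_on ball (of_real t0) r"
    and h: "\<And>i j. (\<lambda>z. h z $ i $ j) holomorphic_on ball (of_real t0) r"
    and e: "\<And>t. \<bar>t - t0\<bar> < r \<Longrightarrow> M t = g (of_real t)" "\<And>t. \<bar>t - t0\<bar> < r \<Longrightarrow> N t = h (of_real t)"
    by (rule hol_ext_common[OF assms]) blast
  show ?thesis
    unfolding hol_ext_def
    by (intro exI[of _ r] exI[of _ "\<lambda>z. g z + h z"] conjI allI impI r)
       (auto simp: e intro!: holomorphic_intros g h)
qed

lemma hol_ext_smul: assumes "hol_ext M t0" shows "hol_ext (\<lambda>t. smul c (M t)) t0"
proof -
  have "hol_ext (\<lambda>t. smul c (mat 1) ** M t) t0" by (intro hol_ext_mult hol_ext_const assms)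
  then show ?thesis by (simp add: mat_distribs)
qed

lemma hol_ext_diff: assumes "hol_ext M t0" "hol_ext N t0" shows "hol_ext (\<lambda>t. M t - N t) t0"
proof -
  have "hol_ext (\<lambda>t. M t + smul (-1) (N t)) t0" by (intro hol_ext_add hol_ext_smul assms)
  then show ?thesis by (simp add: smul_minus_left)
qed

lemma hol_ext_sum: "(\<And>i. i \<in> S \<Longrightarrow> hol_ext (M i) t0) \<Longrightarrow> hol_ext (\<lambda>t. \<Sum>i\<in>S. M i t) t0"
  by (induction S rule: infinite_finite_induct) (auto intro: hol_ext_const hol_ext_add)

text \<open>The bound is known at the real point only. By continuity it extends to a complex disc at
  the price of replacing \<open>q\<close> by \<open>(1 + q) / 2\<close>, which is still below
  1.\<close>

lemma hol_ext_isq: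
  assumes E: "hol_ext E t0" and q: "opn q (E t0)" "0 \<le> q" "q < 1" shows "hol_ext (\<lambda>t. isq (E t)) t0"
proof -
  obtain r g where r: "r > 0" and g: "\<And>i j. (\<lambda>z. g z $ i $ j) holomorphic_on ball (of_real t0) r"
    "\<And>t. \<bar>t - t0\<bar> < r \<Longrightarrow> E t = g (of_real t)"
    using E unfolding hol_ext_def by metis
  have "continuous_on (ball (of_real t0) r) g"
    by (rule continuous_on_cmatI) (rule holomorphic_on_imp_continuous_on[OF g(1)])
  then have "(g \<longlongrightarrow> g (of_real t0)) (nhds (of_real t0))"
    using r by (simp add: continuous_on_eq_continuous_at isCont_def tendsto_nhds_iff)
  moreover have "g (of_real t0) = E t0" using g(2)[of t0] r by simp
  ultimately have "((\<lambda>z. g z - E t0) \<longlongrightarrow> E t0 - E t0) (nhds (of_real t0))"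
    by (intro tendsto_diff tendsto_const) simp
  then have "((\<lambda>z. g z - E t0) \<longlongrightarrow> 0) (nhds (of_real t0))" by simp
  then have "eventually (\<lambda>z. opn ((1 - q) / 2) (g z - E t0)) (nhds (of_real t0))"
    using q by (intro eventually_opn) auto
  then obtain d where d: "d > 0" "\<And>z. dist z (of_real t0) < d \<Longrightarrow> opn ((1 - q) / 2) (g z - E t0)"
    unfolding eventually_nhds_metric by blast
  define s where "s = min r d"
  have op: "opn ((1 + q) / 2) (g z)" if "z \<in> ball (of_real t0) s" for z
  proof -
    have "opn (q + (1 - q) / 2) (E t0 + (g z - E t0))"
      by (intro opn_add q d) (use that in \<open>simp add: s_def dist_commute\<close>)
    then show ?thesis by (simp add: field_simps)
  qed
  have "(\<lambda>z. isq (g z) $ i $ j) holomorphic_on ball (of_real t0) s" for i j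
    by (rule holomorphic_isq[OF open_ball _ _ _ op])
       (use q in \<open>auto intro: holomorphic_on_subset[OF g(1)] simp: s_def\<close>)
  then show ?thesis
    by (rule hol_extI[rotated]) (use g(2) r d(1) in \<open>auto simp: s_def\<close>)
qed

lemma real_poly_entire:
  assumes "real_polynomial_function f"
  shows "\<exists>h. h holomorphic_on UNIV \<and> (\<forall>t. complex_of_real (f t) = h (of_real t))"
proof -
  obtain a n where f: "f = (\<lambda>x. \<Sum>i\<le>n. a i * x ^ i)"
    using assms unfolding real_polynomial_function_iff_sum by blast
  show ?thesis
    by (rule exI[of _ "\<lambda>z. \<Sum>i\<le>n. of_real (a i) * z ^ i"])
       (auto simp: f intro!: holomorphic_intros holomorphic_on_sum)
qed

text \<open>Real and imaginary parts of the entries are real polynomials and extend separately to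
  entire functions; the conjugate is then extended by changing the sign of the imaginary
  part.\<close>

lemma hol_ext_poly:
  fixes p :: "real \<Rightarrow> 'n::finite cmat"
  assumes "polynomial_function p" shows "hol_ext p t0" "hol_ext (\<lambda>t. adj (p t)) t0"
proof -
  have bl: "bounded_linear (\<lambda>M::'n cmat. M $ i $ j)" for i j
    using bounded_linear_compose[OF bounded_linear_vec_nth bounded_linear_vec_nth] by blast
  have "real_polynomial_function (\<lambda>t. Re (p t $ i $ j))" "real_polynomial_function (\<lambda>t. Im (p t $ i $ j))" for i j
    using assms bounded_linear_compose[OF bounded_linear_Re bl] bounded_linear_compose[OF bounded_linear_Im bl]
    unfolding polynomial_function_def o_def by blast+
  then have "\<forall>i j. \<exists>h. h holomorphic_on UNIV \<and> (\<forall>t. complex_of_real (Re (p t $ i $ j)) = h (of_real t))"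
    "\<forall>i j. \<exists>h. h holomorphic_on UNIV \<and> (\<forall>t. complex_of_real (Im (p t $ i $ j)) = h (of_real t))"
    using real_poly_entire[of "\<lambda>t. Re (p t $ _ $ _)"] real_poly_entire[of "\<lambda>t. Im (p t $ _ $ _)"] by blast+
  then obtain h k where h: "\<And>i j. h i j holomorphic_on UNIV" "\<And>i j t. complex_of_real (Re (p t $ i $ j)) = h i j (of_real t)"
    and k: "\<And>i j. k i j holomorphic_on UNIV" "\<And>i j t. complex_of_real (Im (p t $ i $ j)) = k i j (of_real t)"
    by metis
  have hb: "h i j holomorphic_on B" "k i j holomorphic_on B" for i j B
    using h k holomorphic_on_subset by blast+
  show "hol_ext p t0"
    unfolding hol_ext_def
    by (intro exI[of _ 1] exI[of _ "\<lambda>z. \<chi> i j. h i j z + \<i> * k i j z"] conjI)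
       (auto simp: cmat_eq_iff complex_eq_iff h(2)[symmetric] k(2)[symmetric] intro!: holomorphic_intros hb)
  show "hol_ext (\<lambda>t. adj (p t)) t0"
    unfolding hol_ext_def
    by (intro exI[of _ 1] exI[of _ "\<lambda>z. \<chi> i j. h j i z - \<i> * k j i z"] conjI)
       (auto simp: cmat_eq_iff complex_eq_iff h(2)[symmetric] k(2)[symmetric] intro!: holomorphic_intros hb)
qed

text \<open>Projection onto the matrices of degree one for the grading defined by \<open>U\<close>.\<close>
definition deg_proj :: "nat \<Rightarrow> 'n::finite cmat \<Rightarrow> 'n cmat \<Rightarrow> 'n cmat" where
  "deg_proj m U M = smul (1 / of_nat m) (\<Sum>l<m. smul (cnj (beta m) ^ l) (mpow U l ** M ** adj (mpow U l)))"

text \<open>Multiplication by \<open>U\<close> shifts the average by one place, and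
  \<open>U^m = 1\<close> closes the cycle.\<close>

lemma deg_proj_intertwines:
  assumes m: "0 < m" and U: "unitary U" "mpow U m = mat 1"
  shows "U ** deg_proj m U M = smul (beta m) (deg_proj m U M ** U)"
proof -
  define f where "f l = smul (cnj (beta m) ^ l) (mpow U l ** M ** adj (mpow U l))" for l
  have fm: "f m = f 0" using m U by (simp add: f_def cnj_beta_power_m)
  have "(\<Sum>l<m. f (Suc l)) + f 0 = (\<Sum>l<Suc m. f l)" by (simp only: sum.lessThan_Suc_shift add.commute)
  then have sh: "(\<Sum>l<m. f (Suc l)) = (\<Sum>l<m. f l)" by (simp add: fm)
  have step: "U ** f l = smul (beta m) (f (Suc l) ** U)" for l
  proof -
    have "beta m * cnj (beta m) ^ Suc l = cnj (beta m) ^ l"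
      using cnj_beta_mult[of m] by (simp add: mult.assoc[symmetric] mult.commute[of "beta m"])
    moreover have "adj (mpow U (Suc l)) ** U = adj (mpow U l)"
      using U(1) by (simp add: adj_mult mat_assoc unitary_def)
    ultimately show ?thesis
      by (simp add: f_def mat_distribs mat_assoc del: mpow.simps power_Suc) (simp add: mat_assoc)
  qed
  have "U ** (\<Sum>l<m. f l) = smul (beta m) ((\<Sum>l<m. f l) ** U)"
    by (simp add: matrix_mult_sum_right step smul_sum_right[symmetric] matrix_mult_sum_left[symmetric] sh)
  then show ?thesis
    unfolding deg_proj_def f_def[symmetric] by (simp add: mat_distribs mult.commute)
qed

lemma deg_proj_id:
  assumes m: "0 < m" and U: "unitary U" and M: "U ** M = smul (beta m) (M ** U)"
  shows "deg_proj m U M = M"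
proof -
  have "mpow U l ** M = smul (beta m ^ l) (M ** mpow U l)" for l
    by (induction l) (simp_all add: mat_assoc mat_distribs, simp add: matrix_mul_assoc M mat_distribs mult.commute)
  then have "smul (cnj (beta m) ^ l) (mpow U l ** M ** adj (mpow U l)) = M" for l
    using unitary_mpow[OF U, of l]
    by (simp add: mat_distribs mat_assoc unitary_def power_mult_distrib[symmetric] cnj_beta_mult)
  then have "deg_proj m U M = smul (1 / of_nat m) (\<Sum>l<m. smul 1 M)" by (simp add: deg_proj_def)
  also have "\<dots> = M" unfolding smul_sum_left[symmetric] using m by simp
  finally show ?thesis .
qed

lemma adj_deg_proj:
  "adj (deg_proj m U M) = smul (1 / of_nat m) (\<Sum>l<m. smul (beta m ^ l) (mpow U l ** adj M ** adj (mpow U l)))"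
  by (simp add: deg_proj_def adj_distribs mat_assoc)

lemma tendsto_deg_proj: "(f \<longlongrightarrow> M) F \<Longrightarrow> ((\<lambda>x. deg_proj m U (f x)) \<longlongrightarrow> deg_proj m U M) F"
  unfolding deg_proj_def by (intro tendsto_intros)

lemma hol_ext_deg_proj:
  assumes "hol_ext p t0" "hol_ext (\<lambda>t. adj (p t)) t0"
  shows "hol_ext (\<lambda>t. deg_proj m U (p t)) t0" "hol_ext (\<lambda>t. adj (deg_proj m U (p t))) t0"
  unfolding adj_deg_proj unfolding deg_proj_def
  by (intro hol_ext_smul hol_ext_sum hol_ext_mult hol_ext_const assms)+

text \<open>In the grading by \<open>U\<close> each \<open>A i\<close> raises the degree by one and
  its adjoint lowers it, so the Gram matrix has degree zero.\<close>

lemma gram_commute: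
  assumes "intertwines r A l U" "unitary U" "cmod l = 1" shows "U ** gram r A = gram r A ** U"
proof -
  have "U ** (adj (A i) ** A i) = (adj (A i) ** A i) ** U" if "i < r" for i
  proof -
    have UA: "U ** A i = smul l (A i ** U)" using assms(1) that by (simp add: intertwines_def)
    have "adj (A i) ** adj U = smul (cnj l) (adj U ** adj (A i))"
      using arg_cong[OF UA, of adj] by (simp add: adj_distribs)
    then have "U ** (adj (A i) ** adj U) ** U = smul (cnj l) (U ** (adj U ** adj (A i)) ** U)"
      by (simp add: mat_distribs)
    then have Uad: "U ** adj (A i) = smul (cnj l) (adj (A i) ** U)"
      using assms(2) by (simp add: unitary_def mat_assoc) (simp add: matrix_mul_assoc)
    have "U ** adj (A i) ** A i = smul (cnj l) (adj (A i) ** (U ** A i))"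
      unfolding Uad by (simp add: mat_distribs mat_assoc)
    also have "\<dots> = smul (cnj l * l) (adj (A i) ** A i ** U)" by (simp add: UA mat_distribs mat_assoc)
    finally show ?thesis by (simp add: cnj_mult_self assms(3) mat_assoc)
  qed
  then show ?thesis by (simp add: gram_def matrix_mult_sum_left matrix_mult_sum_right)
qed

lemma gram_adj: "adj (gram r A) = gram r A"
  by (simp add: gram_def adj_distribs)

lemma tendsto_gram:
  "(\<And>i. i < r \<Longrightarrow> ((\<lambda>n. B n i) \<longlongrightarrow> A i) F) \<Longrightarrow> ((\<lambda>n. gram r (B n)) \<longlongrightarrow> gram r A) F"
  unfolding gram_def by (intro tendsto_intros) auto

text \<open>Approximate by polynomials and restore isometry by right multiplication with the inverse
  square root of the Gram matrix; open conditions survive.\<close>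
lemma analytic_approx:
  fixes B :: "real \<Rightarrow> nat \<Rightarrow> 'n::finite cmat"
  assumes m: "0 < m" and U: "unitary U" "mpow U m = mat 1"
    and cont: "\<And>i. i < r \<Longrightarrow> continuous_on {0..1} (\<lambda>t. B t i)"
    and g: "\<And>t. t \<in> {0..1} \<Longrightarrow> gram r (B t) = mat 1"
    and tw: "\<And>t. t \<in> {0..1} \<Longrightarrow> intertwines r (B t) (beta m) U"
    and op: "\<And>t s. t \<in> {0..1} \<Longrightarrow> (\<And>i. i < r \<Longrightarrow> (\<lambda>n. s n i) \<longlonglongrightarrow> B t i) \<Longrightarrow>
      eventually (\<lambda>n. Q (s n)) sequentially"
  obtains C where "\<And>i. i < r \<Longrightarrow> C 0 i = B 0 i" "\<And>i. i < r \<Longrightarrow> C 1 i = B 1 i"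
    "\<And>t. t \<in> {0..1} \<Longrightarrow> gram r (C t) = mat 1 \<and> intertwines r (C t) (beta m) U \<and> Q (C t)"
    "\<And>t i. t \<in> {0..1} \<Longrightarrow> i < r \<Longrightarrow> hol_ext (\<lambda>t. C t i) t \<and> hol_ext (\<lambda>t. adj (C t i)) t"
proof -
  have "\<exists>p. polynomial_function p \<and> p 0 = B 0 i \<and> p 1 = B 1 i \<and>
      (\<forall>t\<in>{0..1}. norm (p t - B t i) < 1 / real (Suc n))" if i: "i < r" for n i
  proof -
    have path: "path (\<lambda>t. B t i)" using cont[OF i] by (simp add: path_def)
    have "0 < 1 / real (Suc n)" by simp
    then obtain q where "polynomial_function q" "pathstart q = pathstart (\<lambda>t. B t i)"
      "pathfinish q = pathfinish (\<lambda>t. B t i)" "\<forall>t\<in>{0..1}. norm (q t - B t i) < 1 / real (Suc n)"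
      using path_approx_polynomial_function[OF path] by metis
    then show ?thesis by (intro exI[of _ q]) (simp add: pathstart_def pathfinish_def)
  qed
  then have "\<forall>n i. \<exists>p. i < r \<longrightarrow> polynomial_function p \<and> p 0 = B 0 i \<and> p 1 = B 1 i \<and>
      (\<forall>t\<in>{0..1}. norm (p t - B t i) < 1 / real (Suc n))" by blast
  from this[unfolded choice_iff] obtain p where p0: "\<forall>n i. i < r \<longrightarrow> polynomial_function (p n i) \<and>
      p n i 0 = B 0 i \<and> p n i 1 = B 1 i \<and> (\<forall>t\<in>{0..1}. norm (p n i t - B t i) < 1 / real (Suc n))"
    by blast
  have p: "\<And>n i. i < r \<Longrightarrow> polynomial_function (p n i)" "\<And>n i. i < r \<Longrightarrow> p n i 0 = B 0 i"
    "\<And>n i. i < r \<Longrightarrow> p n i 1 = B 1 i"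
    "\<And>n i t. i < r \<Longrightarrow> t \<in> {0..1} \<Longrightarrow> norm (p n i t - B t i) < 1 / real (Suc n)"
    using p0 by blast+
  define P where "P n t i = deg_proj m U (p n i t)" for n t i
  \<comment> \<open>The averaged polynomials satisfy the relation with \<open>U\<close> exactly, so
    their Gram matrix and its inverse square root commute with \<open>U\<close>; isometry can be
    restored without losing the relation.\<close>
  define X where "X n t = isq (mat 1 - gram r (P n t))" for n t
  define C where "C n t i = P n t i ** X n t" for n t i
  have BU: "deg_proj m U (B t i) = B t i" if "t \<in> {0..1}" "i < r" for t i
    using tw[OF that(1)] that(2) by (intro deg_proj_id[OF m U(1)]) (simp add: intertwines_def)
  \<comment> \<open>Openness of \<open>Q\<close> is sequential. If no \<open>n\<close> served all
    \<open>t\<close>, the failing parameters would accumulate at some \<open>tt\<close>, where the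
    tuples converge to \<open>B tt\<close>, against openness there.\<close>
  have "\<exists>n. \<forall>t\<in>{0..1}. opn (1/2) (mat 1 - gram r (P n t)) \<and> Q (C n t)"
  proof (rule ccontr)
    assume "\<not> ?thesis"
    then have "\<forall>n. \<exists>t. t \<in> {0..1} \<and> \<not> (opn (1/2) (mat 1 - gram r (P n t)) \<and> Q (C n t))" by blast
    then obtain t where t: "\<And>n. t n \<in> {0..1::real}"
      "\<And>n. \<not> (opn (1/2) (mat 1 - gram r (P n (t n))) \<and> Q (C n (t n)))" by metis
    obtain tt h where tt: "tt \<in> {0..1}" and h: "strict_mono h" "(t \<circ> h) \<longlonglongrightarrow> tt"
      using compact_imp_seq_compact[OF compact_Icc, of 0 1] t(1) unfolding seq_compact_def by blast
    have pl: "(\<lambda>n. p (h n) i (t (h n))) \<longlonglongrightarrow> B tt i" if i: "i < r" for i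
    proof -
      have "(\<lambda>n. B (t (h n)) i) \<longlonglongrightarrow> B tt i"
        by (rule continuous_on_tendsto_compose[OF cont[OF i] h(2)[unfolded o_def] tt]) (use t(1) in auto)
      moreover have "(\<lambda>n. p (h n) i (t (h n)) - B (t (h n)) i) \<longlonglongrightarrow> 0"
      proof (rule Lim_null_comparison)
        show "\<forall>\<^sub>F n in sequentially. norm (p (h n) i (t (h n)) - B (t (h n)) i) \<le> 1 / real (Suc (h n))"
          using p(4)[OF i t(1)] by (auto intro!: always_eventually less_imp_le)
        show "(\<lambda>n. 1 / real (Suc (h n))) \<longlonglongrightarrow> 0"
          using LIMSEQ_subseq_LIMSEQ[OF LIMSEQ_inverse_real_of_nat h(1)] by (simp add: o_def inverse_eq_divide)
      qed
      ultimately show ?thesis using tendsto_add[of "\<lambda>n. B (t (h n)) i"] by force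
    qed
    have Pl: "(\<lambda>n. P (h n) (t (h n)) i) \<longlonglongrightarrow> B tt i" if i: "i < r" for i
      using tendsto_deg_proj[OF pl[OF i], of m U] by (simp add: P_def BU[OF tt i])
    have "(\<lambda>n. gram r (P (h n) (t (h n)))) \<longlonglongrightarrow> mat 1"
      using tendsto_gram[of r "\<lambda>n. P (h n) (t (h n))", OF Pl] g[OF tt] by simp
    then have E: "(\<lambda>n. mat 1 - gram r (P (h n) (t (h n)))) \<longlonglongrightarrow> 0"
      using tendsto_diff[OF tendsto_const[of "mat 1"], of _ "mat 1"] by simp
    have "(\<lambda>n. C (h n) (t (h n)) i) \<longlonglongrightarrow> B tt i" if i: "i < r" for i
      using tendsto_matrix_mult[OF Pl[OF i] isq_tendsto_one[OF E]] by (simp add: C_def X_def)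
    then have "eventually (\<lambda>n. Q (C (h n) (t (h n)))) sequentially" by (rule op[OF tt])
    moreover have "eventually (\<lambda>n. opn (1/2) (mat 1 - gram r (P (h n) (t (h n))))) sequentially"
      by (rule eventually_opn[OF E]) simp
    ultimately have "eventually (\<lambda>n. False) sequentially" by eventually_elim (use t(2) in blast)
    then show False by simp
  qed
  then obtain n where n: "\<And>t. t \<in> {0..1} \<Longrightarrow> opn (1/2) (mat 1 - gram r (P n t))" "\<And>t. t \<in> {0..1} \<Longrightarrow> Q (C n t)"
    by blast
  have Pint: "intertwines r (P n t) (beta m) U" for t
    unfolding intertwines_def P_def using deg_proj_intertwines[OF m U] by blast
  have half: "(0::real) \<le> 1/2" "(1/2::real) < 1" by auto
  note X = isq_props[OF gram_adj n(1) half, folded X_def]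
  \<comment> \<open>Where the polynomials meet the path the Gram matrix is 1 and the correcting
    factor is \<open>isq 0 = mat 1\<close>; hence the end points are kept.\<close>
  have ends: "C n t i = B t i" if t: "t \<in> {0..1}" "\<And>i. i < r \<Longrightarrow> p n i t = B t i" and i: "i < r" for t i
  proof -
    have PB: "P n t i = B t i" if "i < r" for i using t(2)[OF that] BU[OF t(1) that] by (simp add: P_def)
    then have "gram r (P n t) = gram r (B t)" by (simp add: gram_def)
    then show ?thesis using PB[OF i] g[OF t(1)] by (simp add: C_def X_def isq_zero)
  qed
  show thesis
  proof (rule that[of "C n"])
    show "C n 0 i = B 0 i" "C n 1 i = B 1 i" if "i < r" for i
      using ends[of 0 i] ends[of 1 i] p(2,3) that by auto
    fix t :: real assume t: "t \<in> {0..1}"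
    have "gram r (C n t) = X n t ** gram r (P n t) ** X n t"
      unfolding gram_def C_def by (simp add: adj_mult X(1)[OF t] mat_assoc matrix_mult_sum_left matrix_mult_sum_right)
    then have "gram r (C n t) = mat 1" using X(2,3)[OF t] by simp
    moreover have "intertwines r (C n t) (beta m) U"
    proof -
      have "U ** X n t = X n t ** U"
        by (rule X(5)[OF t gram_commute[OF Pint U(1) norm_beta]])
      then show ?thesis using Pint[of t] unfolding intertwines_def C_def
        by (simp add: matrix_mul_assoc mat_distribs) (simp add: mat_assoc)
    qed
    ultimately show "gram r (C n t) = mat 1 \<and> intertwines r (C n t) (beta m) U \<and> Q (C n t)" using n(2)[OF t] by blast
    have hP: "hol_ext (\<lambda>t. P n t i) t" "hol_ext (\<lambda>t. adj (P n t i)) t" if "i < r" for i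
      unfolding P_def using hol_ext_deg_proj[OF hol_ext_poly[OF p(1)[OF that]]] by blast+
    have hX: "hol_ext (X n) t"
      unfolding X_def
    proof (rule hol_ext_isq[where q = "1/2"])
      show "hol_ext (\<lambda>t. mat 1 - gram r (P n t)) t"
        unfolding gram_def by (intro hol_ext_diff hol_ext_const hol_ext_sum hol_ext_mult hP) auto
    qed (use n(1)[OF t] in auto)
    \<comment> \<open>For real \<open>s\<close> near \<open>t\<close> the matrix
      \<open>X n s\<close> is Hermitian, so its own extension serves for the adjoint. The bound 1/2
      at \<open>t\<close> plus 1/4 by continuity stays below 1, which also covers \<open>s\<close>
      outside the unit interval.\<close>
    have hXa: "hol_ext (\<lambda>t. adj (X n t)) t"
    proof -
      obtain d where d: "d > 0" "\<And>s. \<bar>s - t\<bar> < d \<Longrightarrow> adj (X n s) = X n s"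
      proof -
        have "hol_ext (\<lambda>t. mat 1 - gram r (P n t)) t"
          unfolding gram_def by (intro hol_ext_diff hol_ext_const hol_ext_sum hol_ext_mult hP) auto
        then have "isCont (\<lambda>t. mat 1 - gram r (P n t)) t" by (rule hol_ext_isCont)
        then have "((\<lambda>s. (mat 1 - gram r (P n s)) - (mat 1 - gram r (P n t))) \<longlongrightarrow> 0) (nhds t)"
          using tendsto_diff[OF _ tendsto_const[of "mat 1 - gram r (P n t)"]]
          by (simp only: isCont_def tendsto_nhds_iff) fastforce
        then have "eventually (\<lambda>s. opn (1/4) ((mat 1 - gram r (P n s)) - (mat 1 - gram r (P n t)))) (nhds t)"
          by (rule eventually_opn) simp
        then obtain d where d: "d > 0" "\<And>s. dist s t < d \<Longrightarrow> opn (1/4) ((mat 1 - gram r (P n s)) - (mat 1 - gram r (P n t)))"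
          unfolding eventually_nhds_metric by blast
        have "adj (X n s) = X n s" if "\<bar>s - t\<bar> < d" for s
        proof -
          have "opn (1/2 + 1/4) ((mat 1 - gram r (P n t)) + ((mat 1 - gram r (P n s)) - (mat 1 - gram r (P n t))))"
            by (intro opn_add n(1)[OF t] d(2)) (use that in \<open>simp add: dist_real_def\<close>)
          then have "opn (3/4) (mat 1 - gram r (P n s))" by simp
          then show ?thesis unfolding X_def by (rule adj_isq) (simp_all add: adj_distribs gram_adj)
        qed
        then show thesis using that d(1) by blast
      qed
      obtain r' g' where r': "r' > 0" "\<And>i j. (\<lambda>z. g' z $ i $ j) holomorphic_on ball (of_real t) r'"
        "\<And>s. \<bar>s - t\<bar> < r' \<Longrightarrow> X n s = g' (of_real s)"
        using hX unfolding hol_ext_def by metis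
      have "(\<lambda>z. g' z $ i $ j) holomorphic_on ball (of_real t) (min d r')" for i j
        by (rule holomorphic_on_subset[OF r'(2)]) auto
      moreover have "adj (X n s) = g' (of_real s)" if "\<bar>s - t\<bar> < min d r'" for s
        using d(2)[of s] r'(3)[of s] that by simp
      ultimately show ?thesis
        by (intro hol_extI[of "min d r'" g']) (use d(1) r'(1) in simp_all)
    qed
    show "hol_ext (\<lambda>t. C n t i) t \<and> hol_ext (\<lambda>t. adj (C n t i)) t" if "i < r" for i
      unfolding C_def adj_mult using hP[OF that] hX hXa by (auto intro!: hol_ext_mult)
  qed
qed

subsection \<open>Connecting maps with equal multiplicity index\<close>

lemma good_conj:
  assumes A: "good r N m U A" and V: "unitary V"
  shows "good r N m (V ** U ** adj V) (\<lambda>i. V ** A i ** adj V)"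
proof -
  have VV: "adj V ** V = mat 1" "V ** adj V = mat 1" using V by (simp_all add: unitary_def)
  have c: "adj V ** (V ** Y) = Y" "V ** (adj V ** Y) = Y" for Y by (simp_all add: matrix_mul_assoc VV)
  \<comment> \<open>Unitary conjugation as a case of the similarity: with \<open>S = V ** V\<close>
    and \<open>X = adj V\<close> the product \<open>S ** X\<close> is \<open>V\<close>.\<close>
  interpret normalisation r A "\<lambda>i. V ** A i ** adj V" "V ** V" "adj V" 1
    by unfold_locales (simp_all add: mat_assoc c VV)
  have "adj (V ** A i ** adj V) ** (V ** A i ** adj V) = V ** (adj (A i) ** A i) ** adj V" for i
    by (simp add: adj_mult mat_assoc c)
  then have "gram r (\<lambda>i. V ** A i ** adj V) = V ** gram r A ** adj V"
    by (simp add: gram_def matrix_mult_sum_left matrix_mult_sum_right)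
  moreover have "intertwines r (\<lambda>i. V ** A i ** adj V) (beta m) (V ** U ** adj V)"
    unfolding intertwines_def
  proof (intro allI impI)
    fix i assume "i < r"
    then have UA: "U ** A i = smul (beta m) (A i ** U)" using A by (simp add: good_def intertwines_def)
    have "V ** U ** adj V ** (V ** A i ** adj V) = V ** (U ** A i) ** adj V" by (simp add: mat_assoc c)
    also have "\<dots> = smul (beta m) (V ** A i ** adj V ** (V ** U ** adj V))"
      unfolding UA by (simp add: mat_distribs mat_assoc c)
    finally show "V ** U ** adj V ** (V ** A i ** adj V) = smul (beta m) (V ** A i ** adj V ** (V ** U ** adj V))" .
  qed
  ultimately show ?thesis
    using A kindep_B spans_B VV by (simp add: good_def)
qed

lemma good_imp_I_TP: "0 < m \<Longrightarrow> unitary U \<Longrightarrow> good r N m U A \<Longrightarrow> kmap r A \<in> I_TP r m"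
  unfolding good_def by (blast intro: kraus_imp_I_TP)

lemma spectral_decompD:
  assumes "0 < m" "unitary U" "mpow U m = mat 1"
  shows "\<And>k. k \<in> {1..m} \<Longrightarrow> specproj m U k ** specproj m U k = specproj m U k"
    "\<And>k. k \<in> {1..m} \<Longrightarrow> adj (specproj m U k) = specproj m U k"
    "\<And>j k. j \<in> {1..m} \<Longrightarrow> k \<in> {1..m} \<Longrightarrow> j \<noteq> k \<Longrightarrow> specproj m U j ** specproj m U k = 0"
    "sum (specproj m U) {1..m} = mat 1" "U = (\<Sum>k=1..m. smul (beta m ^ k) (specproj m U k))"
  using specproj_decomp[OF assms] unfolding spectral_decomp_def by blast+

lemma dvec_eq_imp_unitary:
  assumes m: "0 < m" and U: "unitary U" "mpow U m = mat 1" and V: "unitary V" "mpow V m = mat 1"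
    and eq: "dvec m U = dvec m V"
  obtains W where "unitary W" "W ** U = V ** W"
proof -
  have tr: "trace (specproj m U k) = trace (specproj m V k)" if "k \<in> {1..m}" for k
  proof -
    have "dvec m U ! (k - 1) = dvec m V ! (k - 1)" using eq by simp
    moreover have "k - 1 < m" "Suc (k - 1) = k" using that by auto
    ultimately show ?thesis by (simp add: dvec_def del: upt_Suc)
  qed
  obtain W where W: "unitary W" "\<And>k. k \<in> {1..m} \<Longrightarrow> W ** specproj m U k = specproj m V k ** W"
    using unitary_between_resolutions[of "{1..m}" "specproj m U" "specproj m V", OF _
        spectral_decompD(1-4)[OF m U] spectral_decompD(1-4)[OF m V] tr] by auto
  have "W ** U = (\<Sum>k=1..m. smul (beta m ^ k) (W ** specproj m U k))"
    by (subst spectral_decompD(5)[OF m U]) (simp add: mat_distribs)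
  also have "\<dots> = (\<Sum>k=1..m. smul (beta m ^ k) (specproj m V k ** W))"
    by (intro sum.cong refl) (simp add: W(2))
  also have "\<dots> = V ** W"
    by (subst (2) spectral_decompD(5)[OF m V]) (simp add: mat_distribs)
  finally show thesis using that W(1) by blast
qed

lemma I_TP_dual_unitary:
  assumes T: "T \<in> I_TP r m" and m: "0 < m"
  obtains U where "unitary U" "mpow U m = mat 1" "dual_map T U = smul (beta m) U"
proof -
  obtain A X0 U N where *: "T = kmap r A" "tp_irr r A X0" "unitary U" "mpow U m = mat 1" "intertwines r A (beta m) U"
    using I_TP_imp_kraus[OF T m] by metis
  then show thesis using that tp_irr.intertwines_eigen dual_map_kmap by metis
qed

lemma analytic_connection:
  fixes T0 T1 :: "'n::finite cmat \<Rightarrow> 'n cmat"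
  assumes m: "0 < m" and T0: "T0 \<in> I_TP r m" and T1: "T1 \<in> I_TP r m"
    and eq: "mult_index m T0 = mult_index m T1"
  shows "\<exists>\<gamma>::real \<Rightarrow> ('n cmat \<Rightarrow> 'n cmat). path \<gamma> \<and> path_image \<gamma> \<subseteq> I_TP r m \<and>
           pathstart \<gamma> = T0 \<and> pathfinish \<gamma> = T1 \<and>
           (\<forall>i j k l. real_analytic_on {0..1} (\<lambda>t. \<gamma> t (munit i j) $ k $ l))"
proof -
  obtain A0 X0 U N0 where T0A: "T0 = kmap r A0" and tp0: "tp_irr r A0 X0" and k0: "kindep r A0"
    and U: "unitary U" "mpow U m = mat 1" "intertwines r A0 (beta m) U" and s0: "spans r N0 m A0"
    using I_TP_imp_kraus[OF T0 m] by metis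
  obtain A1 X1 N1 where T1A: "T1 = kmap r A1" and tp1: "tp_irr r A1 X1" and k1: "kindep r A1"
    and s1: "spans r N1 m A1"
    using I_TP_imp_kraus[OF T1 m] by metis
  interpret t0: tp_irr r A0 X0 by (rule tp0)
  interpret t1: tp_irr r A1 X1 by (rule tp1)
  have "dual_map T0 U = smul (beta m) U"
    using t0.intertwines_eigen[OF U(3)] by (simp add: T0A dual_map_kmap)
  then have "rotate 0 (dvec m U) \<in> mult_index m T0"
    unfolding mult_index_alt[OF m] using U by blast
  then have "dvec m U \<in> mult_index m T1" by (simp add: eq)
  then obtain j U' where U': "dvec m U = rotate j (dvec m U')" "unitary U'" "mpow U' m = mat 1"
    "dual_map T1 U' = smul (beta m) U'"
    unfolding mult_index_alt[OF m] by blast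
  \<comment> \<open>The dimension vectors agree only up to rotation; this root of unity turns
    \<open>U'\<close> into an eigenvector whose vector coincides with that of
    \<open>U\<close>.\<close>
  define V where "V = smul (cnj (beta m) ^ j) U'"
  have uV: "unitary V" unfolding V_def by (rule unitary_smul) (simp_all add: norm_power norm_beta U')
  have "(cnj (beta m) ^ j) ^ m = 1"
    by (metis cnj_beta_power_m m mult.commute power_mult power_one)
  then have mV: "mpow V m = mat 1" by (simp add: V_def mpow_smul U')
  have iV: "intertwines r A1 (beta m) V"
    unfolding V_def
  proof (rule intertwines_smul)
    show "intertwines r A1 (beta m) U'"
      unfolding intertwines_def using t1.eigen_intertwine[of U' "beta m"] U'(4) norm_beta
      by (simp add: T1A dual_map_kmap)
  qed
  have "dvec m U = dvec m V" using U'(1) by (simp add: rotate_dvec[OF m] V_def)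
  then obtain W where W: "unitary W" "W ** U = V ** W" using dvec_eq_imp_unitary[OF m U(1,2) uV mV] by blast
  \<comment> \<open>A common window for both tuples; the successor makes it positive, as
    \<open>good_path\<close> requires.\<close>
  define N where "N = Suc (max N0 N1)"
  have g0: "good r N m U A0"
    using t0.gram k0 U(3) spans_mono[OF s0 t0.gram] by (simp add: good_def N_def)
  have g1: "good r N m V A1"
    using t1.gram k1 iV spans_mono[OF s1 t1.gram] by (simp add: good_def N_def)
  have "adj W ** V ** W = U" using W by (metis mat_assoc matrix_mul_lid unitary_def)
  then have g2: "good r N m U (\<lambda>i. adj W ** A1 i ** W)"
    using good_conj[OF g1 unitary_adj[OF W(1)]] by simp
  obtain B where B: "\<And>i. i < r \<Longrightarrow> continuous_on {0..1} (\<lambda>t::real. B t i)"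
    "\<And>t. t \<in> {0..1} \<Longrightarrow> good r N m U (B t)" "\<And>i. i < r \<Longrightarrow> B 0 i = A0 i" "\<And>i. i < r \<Longrightarrow> B 1 i = adj W ** A1 i ** W"
    by (rule good_path[OF m U(1) _ g0 g2]) (auto simp: N_def)
  have "\<exists>C. (\<forall>i<r. C 0 i = B 0 i) \<and> (\<forall>i<r. C 1 i = B 1 i) \<and>
    (\<forall>t\<in>{0..1}. gram r (C t) = mat 1 \<and> intertwines r (C t) (beta m) U \<and> kindep r (C t) \<and> spans r N m (C t)) \<and>
    (\<forall>t\<in>{0..1}. \<forall>i<r. hol_ext (\<lambda>t. C t i) t \<and> hol_ext (\<lambda>t. adj (C t i)) t)"
  proof (rule analytic_approx[OF m U(1,2) B(1), where Q = "\<lambda>A. kindep r A \<and> spans r N m A"])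
    fix t :: real and s assume t: "t \<in> {0..1}" and s: "\<And>i. i < r \<Longrightarrow> (\<lambda>n. s n i) \<longlonglongrightarrow> B t i"
    show "eventually (\<lambda>n. kindep r (s n) \<and> spans r N m (s n)) sequentially"
      using eventually_kindep[of r "B t" s, OF _ s] eventually_spans[of r N m "B t" s, OF _ s] B(2)[OF t]
      by (simp add: good_def eventually_conj)
  next
    fix t :: real assume "t \<in> {0..1}"
    from B(2)[OF this] show "gram r (B t) = mat 1" "intertwines r (B t) (beta m) U"
      by (simp_all add: good_def)
  next
    fix C :: "real \<Rightarrow> nat \<Rightarrow> 'n cmat"
    assume "\<And>i. i < r \<Longrightarrow> C 0 i = B 0 i" "\<And>i. i < r \<Longrightarrow> C 1 i = B 1 i"
      "\<And>t. t \<in> {0..1} \<Longrightarrow> gram r (C t) = mat 1 \<and> intertwines r (C t) (beta m) U \<and> kindep r (C t) \<and> spans r N m (C t)"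
      "\<And>t i. t \<in> {0..1} \<Longrightarrow> i < r \<Longrightarrow> hol_ext (\<lambda>t. C t i) t \<and> hol_ext (\<lambda>t. adj (C t i)) t"
    then show ?thesis by (intro exI[of _ C]) blast
  qed
  then obtain C where C: "\<And>i. i < r \<Longrightarrow> C 0 i = B 0 i" "\<And>i. i < r \<Longrightarrow> C 1 i = B 1 i"
    "\<And>t. t \<in> {0..1} \<Longrightarrow> good r N m U (C t)"
    "\<And>t i. t \<in> {0..1} \<Longrightarrow> i < r \<Longrightarrow> hol_ext (\<lambda>t. C t i) t \<and> hol_ext (\<lambda>t. adj (C t i)) t"
    unfolding good_def by blast
  obtain Y where Y: "continuous_on {0..1::real} Y" "\<And>t. t \<in> {0..1} \<Longrightarrow> unitary (Y t)" "Y 0 = mat 1" "Y 1 = W"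
    using unitary_path[OF W(1)] by blast
  \<comment> \<open>For \<open>m = 1\<close> and \<open>U = mat 1\<close> the relation with
    \<open>U\<close> is trivial because \<open>beta 1 = 1\<close>, and the Gram condition for a
    single operator says that it is unitary.\<close>
  have "\<exists>D. (\<forall>i<Suc 0. D 0 i = Y 0) \<and> (\<forall>i<Suc 0. D 1 i = Y 1) \<and>
    (\<forall>t\<in>{0..1}. gram (Suc 0) (D t) = mat 1) \<and>
    (\<forall>t\<in>{0..1}. \<forall>i<Suc 0. hol_ext (\<lambda>t. D t i) t \<and> hol_ext (\<lambda>t. adj (D t i)) t)"
    by (rule analytic_approx[of 1 "mat 1" "Suc 0" "\<lambda>t i. Y t" "\<lambda>A. True"])
       (use Y in \<open>auto simp: unitary_def gram_def intertwines_def beta_def\<close>)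
  then obtain D where D: "D 0 0 = mat 1" "D 1 0 = W"
    "\<And>t. t \<in> {0..1} \<Longrightarrow> gram (Suc 0) (D t) = mat 1"
    "\<And>t. t \<in> {0..1} \<Longrightarrow> hol_ext (\<lambda>t. D t 0) t \<and> hol_ext (\<lambda>t. adj (D t 0)) t"
    using Y(3,4) by auto
  define R where "R t = D t 0" for t
  have uR: "unitary (R t)" if "t \<in> {0..1}" for t
    using D(3)[OF that] by (intro unitaryI) (simp add: gram_def R_def)
  have hR: "hol_ext R t" "hol_ext (\<lambda>t. adj (R t)) t" if "t \<in> {0..1}" for t
    using D(4)[OF that] by (simp_all add: R_def[abs_def])
  \<comment> \<open>\<open>C\<close> ends at the conjugated tuple \<open>adj W ** A1 i ** W\<close>.
    Conjugation by \<open>R\<close>, which runs from the identity to \<open>W\<close>, moves this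
    end to \<open>A1\<close>; the matrix \<open>U\<close> is conjugated along with it.\<close>
  define G where "G t i = R t ** C t i ** adj (R t)" for t i
  define \<gamma> where "\<gamma> t = kmap r (G t)" for t
  have in_I: "\<gamma> t \<in> I_TP r m" if t: "t \<in> {0..1}" for t
  proof -
    have "unitary (R t ** U ** adj (R t))" by (intro unitary_mult unitary_adj uR[OF t] U(1))
    then show ?thesis
      using good_imp_I_TP[OF m _ good_conj[OF C(3)[OF t] uR[OF t]]] by (simp add: \<gamma>_def G_def[abs_def])
  qed
  have hol: "hol_ext (\<lambda>t. \<gamma> t X) t" if t: "t \<in> {0..1}" for t X
    unfolding \<gamma>_def kmap_def G_def adj_mult adj_adj
    by (intro hol_ext_sum hol_ext_mult hol_ext_const hR[OF t]) (use C(4)[OF t] in auto)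
  show ?thesis
  proof (intro exI[of _ \<gamma>] conjI allI)
    have "continuous_on {0..1} (\<lambda>t. \<gamma> t X)" for X
      using hol_ext_isCont[OF hol] by (intro continuous_at_imp_continuous_on) auto
    then show "path \<gamma>" unfolding path_def by (rule continuous_on_coordinatewise_then_product)
    show "path_image \<gamma> \<subseteq> I_TP r m" using in_I by (auto simp: path_image_def)
    show "pathstart \<gamma> = T0"
      unfolding pathstart_def \<gamma>_def T0A by (rule kmap_cong) (simp add: G_def R_def D C B)
    show "pathfinish \<gamma> = T1"
      unfolding pathfinish_def \<gamma>_def T1A
    proof (rule kmap_cong)
      fix i assume i: "i < r"
      have "G 1 i = W ** (adj W ** A1 i ** W) ** adj W" using i by (simp add: G_def R_def D C B)
      then show "G 1 i = A1 i" using W(1) by (metis mat_assoc matrix_mul_lid matrix_mul_rid unitary_def)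
    qed
    fix i j k l
    show "real_analytic_on {0..1} (\<lambda>t. \<gamma> t (munit i j) $ k $ l)"
      by (rule hol_ext_real_analytic) (rule hol)
  qed
qed

subsection \<open>The multiplicity index is locally constant\<close>

text \<open>Two unitary eigenvectors for \<open>beta\<close> differ by an intertwiner with factor 1,
  hence by a scalar. Both have \<open>m\<close>-th power 1, so the scalar is an \<open>m\<close>-th
  root of unity and merely rotates the dimension vector.\<close>

lemma mult_index_eq_rotations:
  assumes T: "T \<in> I_TP r m" and m: "0 < m"
    and U: "unitary U" "mpow U m = mat 1" "dual_map T U = smul (beta m) U"
  shows "mult_index m T = {rotate j (dvec m U) | j. True}"
proof -
  obtain A X0 where TA: "T = kmap r A" and tp: "tp_irr r A X0" using I_TP_imp_kraus[OF T m] by metis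
  interpret tp_irr r A X0 by (rule tp)
  have int: "intertwines r A (beta m) V" if "dual_map T V = smul (beta m) V" for V
    unfolding intertwines_def using eigen_intertwine[of V "beta m"] that norm_beta by (simp add: TA dual_map_kmap)
  have rot: "\<exists>i. dvec m V = rotate i (dvec m U)"
    if V: "unitary V" "mpow V m = mat 1" "dual_map T V = smul (beta m) V" for V
  proof -
    have "intertwines r A (cnj (beta m) * beta m) (adj U ** V)"
      by (intro intertwines_mult intertwines_adj int U V norm_beta)
    then obtain c where c: "adj U ** V = smul c (mat 1)" using intertwiner_scalar by (auto simp: cnj_beta_mult)
    have "V = U ** (adj U ** V)" using U(1) by (simp add: unitary_def matrix_mul_assoc)
    then have VU: "V = smul c U" by (simp add: c mat_distribs)
    then have "smul (c ^ m) (mat 1) = smul 1 (mat 1 :: 'a cmat)" using V(2) U(2) by (simp add: mpow_smul)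
    then have "c ^ m = 1" by (rule smul_mat1_inj)
    then have "cnj c ^ m = 1" by (metis complex_cnj_one complex_cnj_power)
    then obtain i where "cnj c = beta m ^ i" using roots_unity_beta[OF m] by blast
    then have "c = cnj (beta m) ^ i" by (metis complex_cnj_cnj complex_cnj_power)
    then show ?thesis using rotate_dvec[OF m, of i U] VU by metis
  qed
  show ?thesis
  proof (intro equalityI subsetI)
    fix x assume "x \<in> mult_index m T"
    then obtain j V where V: "x = rotate j (dvec m V)" "unitary V" "mpow V m = mat 1" "dual_map T V = smul (beta m) V"
      unfolding mult_index_alt[OF m] by blast
    then obtain i where "dvec m V = rotate i (dvec m U)" using rot by blast
    then show "x \<in> {rotate j (dvec m U) | j. True}" using V(1) by (auto simp: rotate_rotate)
  qed (use U in \<open>auto simp: mult_index_alt[OF m]\<close>)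
qed

lemma trace_specproj_nat:
  assumes "0 < m" "unitary U" "mpow U m = mat 1" "k \<in> {1..m}"
  shows "\<exists>d::nat. trace (specproj m U k) = of_nat d"
proof -
  note D = spectral_decompD(1-4)[OF assms(1-3)]
  obtain g :: "'a \<Rightarrow> complex^'a" and \<kappa> where g: "det (\<chi> a. g a) \<noteq> 0" "\<And>a. \<kappa> a \<in> {1..m}"
    "\<And>a. specproj m U (\<kappa> a) *v g a = g a"
    using resolution_basis[OF finite_atLeastAtMost D(1) D(4)] by metis
  show ?thesis using trace_resolution[of "{1..m}" "specproj m U", OF D(3) g assms(4)] by blast
qed

lemma tendsto_mpow: "(f \<longlongrightarrow> U) F \<Longrightarrow> ((\<lambda>x. mpow (f x) k) \<longlongrightarrow> mpow U k) F"
  by (induction k) (auto intro!: tendsto_intros)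

lemma eventually_dvec_eq:
  assumes m: "0 < m" and U: "\<And>n. unitary (U n)" "\<And>n. mpow (U n) m = mat 1"
    and L: "unitary L" "mpow L m = mat 1" and lim: "U \<longlonglongrightarrow> L"
  shows "eventually (\<lambda>n. dvec m (U n) = dvec m L) sequentially"
proof -
  have ev: "eventually (\<lambda>n. trace (specproj m (U n) k) = trace (specproj m L k)) sequentially"
    if k: "k \<in> {1..m}" for k
  proof -
    have "(\<lambda>n. trace (specproj m (U n) k)) \<longlonglongrightarrow> trace (specproj m L k)"
      unfolding specproj_def by (intro tendsto_intros tendsto_mpow lim)
    then have "eventually (\<lambda>n. dist (trace (specproj m (U n) k)) (trace (specproj m L k)) < 1) sequentially"
      by (rule tendstoD) simp
    then show ?thesis
    proof eventually_elim
      case (elim n)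
      obtain d e :: nat where de: "trace (specproj m (U n) k) = of_nat d" "trace (specproj m L k) = of_nat e"
        using trace_specproj_nat[OF m U k] trace_specproj_nat[OF m L k] by metis
      have "dist (complex_of_nat d) (of_nat e) = \<bar>real d - real e\<bar>"
        by (metis dist_norm norm_of_real of_real_diff of_real_of_nat_eq)
      then have "\<bar>real d - real e\<bar> < 1" using elim by (simp add: de)
      then have "d = e" by linarith
      then show ?case by (simp add: de)
    qed
  qed
  have "eventually (\<lambda>n. \<forall>k\<in>{1..m}. trace (specproj m (U n) k) = trace (specproj m L k)) sequentially"
    by (rule eventually_ball_finite) (use ev in auto)
  then show ?thesis
    by eventually_elim (auto simp: dvec_def intro!: map_cong)
qed

lemma unitary_norm_bound:
  assumes "unitary (U::'n::finite cmat)"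
  shows "norm U \<le> (\<Sum>i\<in>(UNIV::'n set). \<Sum>j\<in>(UNIV::'n set). 1 + real CARD('n))"
proof -
  have "complex_of_real (\<Sum>i\<in>UNIV. \<Sum>j\<in>UNIV. (cmod (U $ j $ i))\<^sup>2) = of_real (real CARD('n))"
    using trace_adj_mult_self[of U] assms by (simp add: unitary_def trace_I)
  then have s: "(\<Sum>i\<in>UNIV. \<Sum>j\<in>UNIV. (cmod (U $ j $ i))\<^sup>2) = real CARD('n)" by (simp only: of_real_eq_iff)
  have "cmod (U $ j $ i) \<le> 1 + real CARD('n)" for i j
  proof -
    have "(cmod (U $ j $ i))\<^sup>2 \<le> (\<Sum>j\<in>UNIV. (cmod (U $ j $ i))\<^sup>2)" by (rule member_le_sum) auto
    also have "\<dots> \<le> (\<Sum>i\<in>UNIV. \<Sum>j\<in>UNIV. (cmod (U $ j $ i))\<^sup>2)"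
      by (rule member_le_sum[of i UNIV "\<lambda>i. \<Sum>j\<in>UNIV. (cmod (U $ j $ i))\<^sup>2"]) (auto intro!: sum_nonneg)
    finally have "(cmod (U $ j $ i))\<^sup>2 \<le> real CARD('n)" by (simp add: s)
    moreover have "0 \<le> (cmod (U $ j $ i) - 1)\<^sup>2 + cmod (U $ j $ i)" by simp
    then have "cmod (U $ j $ i) \<le> 1 + (cmod (U $ j $ i))\<^sup>2" by (simp add: power2_eq_square algebra_simps)
    ultimately show ?thesis by linarith
  qed
  then show ?thesis by (intro order_trans[OF norm_cmat_le_sum] sum_mono)
qed

text \<open>A limit of unitary eigenvectors is a unitary eigenvector of the limit map, and the
  multiplicities are integers depending continuously on the eigenvector.\<close>
lemma mult_index_path_constant:
  assumes m: "0 < m" and \<gamma>: "continuous_on {0..1::real} \<gamma>" "\<And>t. t \<in> {0..1} \<Longrightarrow> \<gamma> t \<in> I_TP r m"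
  shows "mult_index m (\<gamma> 0) = mult_index m (\<gamma> 1 :: 'n::finite cmat \<Rightarrow> 'n cmat)"
proof (rule connected_local_const[of "{0..1::real}" 0 1 "\<lambda>t. mult_index m (\<gamma> t)"])
  show "\<forall>a\<in>{0..1}. \<forall>\<^sub>F b in at a within {0..1}. mult_index m (\<gamma> a) = mult_index m (\<gamma> b)"
  proof
    fix a :: real assume a: "a \<in> {0..1}"
    show "\<forall>\<^sub>F b in at a within {0..1}. mult_index m (\<gamma> a) = mult_index m (\<gamma> b)"
    proof (rule sequentially_imp_eventually_within, intro allI impI, rule ccontr)
      fix s assume s: "(\<forall>n. s n \<in> {0..1} \<and> s n \<noteq> a) \<and> s \<longlonglongrightarrow> a"
        and ne: "\<not> (\<forall>\<^sub>F n in sequentially. mult_index m (\<gamma> a) = mult_index m (\<gamma> (s n)))"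
      from not_eventually_sequentiallyD[OF ne]
      obtain h :: "nat \<Rightarrow> nat" where h: "strict_mono h" "\<And>n. mult_index m (\<gamma> a) \<noteq> mult_index m (\<gamma> (s (h n)))"
        by blast
      define T where "T n = \<gamma> (s (h n))" for n
      have T: "T n \<in> I_TP r m" for n using s \<gamma>(2) by (simp add: T_def)
      have "\<forall>n. \<exists>U. unitary U \<and> mpow U m = mat 1 \<and> dual_map (T n) U = smul (beta m) U"
        using I_TP_dual_unitary[OF T m] by metis
      then obtain U where U: "\<And>n. unitary (U n)" "\<And>n. mpow (U n) m = mat 1"
        "\<And>n. dual_map (T n) (U n) = smul (beta m) (U n)" by metis
      have "bounded (range U)"
        using unitary_norm_bound[OF U(1)] by (intro boundedI) auto
      then obtain L g where g: "strict_mono g" and lim: "(U \<circ> g) \<longlonglongrightarrow> L"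
        using bounded_imp_convergent_subsequence by blast
      have limU: "(\<lambda>n. U (g n)) \<longlonglongrightarrow> L" using lim by (simp add: o_def)
      have limT: "(\<lambda>n. T (g n) Y) \<longlonglongrightarrow> \<gamma> a Y" for Y
      proof -
        have "strict_mono (h \<circ> g)" using h(1) g by (rule strict_mono_o)
        then have "(s \<circ> (h \<circ> g)) \<longlonglongrightarrow> a" using s by (intro LIMSEQ_subseq_LIMSEQ) auto
        then have "(\<lambda>n. s (h (g n))) \<longlonglongrightarrow> a" by (simp add: o_def)
        moreover have "continuous_on {0..1} (\<lambda>t. \<gamma> t Y)"
          using \<gamma>(1) by (rule continuous_on_product_then_coordinatewise)
        ultimately show ?thesis
          unfolding T_def using s a by (intro continuous_on_tendsto_compose[of "{0..1}" "\<lambda>t. \<gamma> t Y"]) auto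
      qed
      have uL: "unitary L"
      proof (rule unitaryI, rule LIMSEQ_unique)
        show "(\<lambda>n. adj (U (g n)) ** U (g n)) \<longlonglongrightarrow> adj L ** L" by (intro tendsto_intros limU)
        show "(\<lambda>n. adj (U (g n)) ** U (g n)) \<longlonglongrightarrow> mat 1" using U(1) by (simp add: unitary_def)
      qed
      have mL: "mpow L m = mat 1"
        using LIMSEQ_unique[OF tendsto_mpow[OF limU, of m]] U(2) by simp
      \<comment> \<open>\<open>dual_map\<close> is given by a description, so the limit is taken in
        the trace pairing that characterises it.\<close>
      have dL: "dual_map (\<gamma> a) L = smul (beta m) L"
      proof (rule dual_map_eqI, rule LIMSEQ_unique)
        fix Y
        have eq: "trace (adj (smul (beta m) (U n)) ** Y) = trace (adj (U n) ** T n Y)" for n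
        proof -
          obtain A where A: "T n = kmap r A" using I_TP_imp_kraus[OF T m] by metis
          have "kmap r (dag A) (U n) = smul (beta m) (U n)" using U(3)[of n] by (simp add: A dual_map_kmap)
          then show ?thesis using trace_kmap_dag[of r A "adj (U n)" Y] by (simp add: A kmap_adj)
        qed
        show "(\<lambda>n. trace (adj (smul (beta m) (U (g n))) ** Y)) \<longlonglongrightarrow> trace (adj (smul (beta m) L) ** Y)"
          by (intro tendsto_intros limU)
        show "(\<lambda>n. trace (adj (smul (beta m) (U (g n))) ** Y)) \<longlonglongrightarrow> trace (adj L ** \<gamma> a Y)"
          unfolding eq by (intro tendsto_intros limU limT)
      qed
      have "eventually (\<lambda>n. dvec m (U (g n)) = dvec m L) sequentially"
        by (rule eventually_dvec_eq[OF m U(1,2) uL mL limU])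
      then obtain n where "dvec m (U (g n)) = dvec m L" unfolding eventually_sequentially by blast
      then have "mult_index m (T (g n)) = mult_index m (\<gamma> a)"
        using mult_index_eq_rotations[OF T m U] mult_index_eq_rotations[OF \<gamma>(2)[OF a] m uL mL dL] by metis
      then show False using h(2)[of "g n"] by (simp add: T_def)
    qed
  qed
qed auto

theorem theorem2:
  fixes r m :: nat
  assumes "0 < r" and "0 < m"
  shows "\<forall>T0 \<in> (I_TP r m :: ('n::finite cmat \<Rightarrow> 'n cmat) set). \<forall>T1 \<in> I_TP r m.
     (path_component (I_TP r m) T0 T1 \<longleftrightarrow> mult_index m T0 = mult_index m T1) \<and>
     (mult_index m T0 = mult_index m T1 \<longrightarrow>
        (\<exists>\<gamma>::real \<Rightarrow> ('n cmat \<Rightarrow> 'n cmat).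
           path \<gamma> \<and> path_image \<gamma> \<subseteq> I_TP r m \<and>
           pathstart \<gamma> = T0 \<and> pathfinish \<gamma> = T1 \<and>
           (\<forall>i j k l. real_analytic_on {0..1} (\<lambda>t. \<gamma> t (munit i j) $ k $ l))))"
proof (intro ballI conjI impI)
  fix T0 T1 :: "'n cmat \<Rightarrow> 'n cmat" assume T: "T0 \<in> I_TP r m" "T1 \<in> I_TP r m"
  show "path_component (I_TP r m) T0 T1 \<longleftrightarrow> mult_index m T0 = mult_index m T1"
  proof
    assume "path_component (I_TP r m) T0 T1"
    then obtain \<gamma> where \<gamma>: "path \<gamma>" "path_image \<gamma> \<subseteq> I_TP r m" "pathstart \<gamma> = T0" "pathfinish \<gamma> = T1"
      unfolding path_component_def by blast
    have "mult_index m (\<gamma> 0) = mult_index m (\<gamma> 1)"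
      by (rule mult_index_path_constant[OF assms(2)]) (use \<gamma> in \<open>auto simp: path_def path_image_def\<close>)
    then show "mult_index m T0 = mult_index m T1" using \<gamma> by (simp add: pathstart_def pathfinish_def)
  next
    assume "mult_index m T0 = mult_index m T1"
    then show "path_component (I_TP r m) T0 T1"
      using analytic_connection[OF assms(2) T] unfolding path_component_def by blast
  qed
qed (use analytic_connection[OF assms(2)] in blast)

end
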